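(* Let $d\ge 1$, $2<p<\infty$ and $1\leqslant q<\infty$, and let $q'$ be the dual exponent ($\frac1q+\frac1{q'}=1$, so $q'=\infty$ if $q=1$). Let $S\subset\mathbb{R}^d$ be a compact set which is $\sigma$-finite with respect to $\mathcal{H}_{\frac{2d}{p},\frac{q'}{2}}$, i.e. $S$ is a countable union of sets $S_i$ with $\mathcal{H}_{\frac{2d}{p},\frac{q'}{2}}(S_i)<\infty$. Let $\zeta$ be a tempered distribution on $\mathbb{R}^d$ such that $\hat{\zeta}\in L_{p,q}(\mathbb{R}^d)$ and $\operatorname{supp}\zeta\subset S$. Then $\zeta=0$.
   Context: Lorentz spaces: for a measure space $(X,\mu)$ and $p,q\in(0,\infty)$, $\|f\|^q_{L_{p,q}}=q\int_0^\infty (m_f(t)t^p)^{q/p}\frac{dt}{t}$, where $m_f(t)=\mu(\{x: |f(x)|\geqslant t\})$; $L_{p,q}(\mathbb{R}^d)$ is taken with Lebesgue measure. Netrusov--Hausdorff capacity: let $\Delta_k=[2^{-k-1},2^{-k})$ for $k\in\mathbb{Z}$. For $F\subset\mathbb{R}^d$, $\alpha>0$, $\delta>0$ and $0<\beta<\infty$ set $\mathcal{H}_{\alpha,\beta}(F,\delta)=\inf\big\{\sum_{k}\big(\sum_{j:\,\operatorname{diam}B_j\in\Delta_k}(\operatorname{diam}B_j)^\alpha\big)^\beta : F\subset\bigcup_j B_j,\ \operatorname{diam}B_j<\delta\big\}$ (infimum over countable covers by sets $B_j$), and for $\beta=\infty$ replace $\sum_k(\cdot)^\beta$ by $\sup_k(\cdot)$.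 Then $\mathcal{H}_{\alpha,\beta}(F)=\lim_{\delta\to0}\mathcal{H}_{\alpha,\beta}(F,\delta)$. *)

theory Defs
  imports "HOL-Analysis.Analysis"
begin

definition epow :: "ennreal \<Rightarrow> real \<Rightarrow> ennreal" where
  "epow x b = (if x = top then top else ennreal (enn2real x powr b))"

definition distrib_fun :: "'a measure \<Rightarrow> ('a \<Rightarrow> complex) \<Rightarrow> real \<Rightarrow> ennreal" where
  "distrib_fun M f t = emeasure M {x \<in> space M. cmod (f x) \<ge> t}"

definition lorentz_qnorm_pow :: "real \<Rightarrow> real \<Rightarrow> 'a measure \<Rightarrow> ('a \<Rightarrow> complex) \<Rightarrow> ennreal" where
  "lorentz_qnorm_pow p q M f =
     ennreal q * (\<integral>\<^sup>+ t. indicator {0<..} t *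
        epow (distrib_fun M f t * ennreal (t powr p)) (q / p) * ennreal (1 / t) \<partial>lborel)"

definition in_lorentz :: "real \<Rightarrow> real \<Rightarrow> 'a measure \<Rightarrow> ('a \<Rightarrow> complex) \<Rightarrow> bool" where
  "in_lorentz p q M f \<longleftrightarrow> f \<in> borel_measurable M \<and> lorentz_qnorm_pow p q M f < top"

definition dyadic_band :: "int \<Rightarrow> real set" where
  "dyadic_band k = {2 powr (- real_of_int k - 1) ..< 2 powr (- real_of_int k)}"

definition nnsum :: "('i \<Rightarrow> ennreal) \<Rightarrow> ennreal" where
  "nnsum f = (SUP K \<in> {K. finite K}. sum f K)"

definition cover_cost :: "real \<Rightarrow> ereal \<Rightarrow> (nat \<Rightarrow> 'a::metric_space set) \<Rightarrow> ennreal" where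
  "cover_cost \<alpha> \<beta> B =
     (let inner = (\<lambda>k::int. nnsum (\<lambda>j::nat.
                     if diameter (B j) \<in> dyadic_band k then ennreal (diameter (B j) powr \<alpha>) else 0))
      in if \<beta> = \<infinity> then (SUP k. inner k)
         else nnsum (\<lambda>k. epow (inner k) (real_of_ereal \<beta>)))"

definition NH_cap_delta :: "real \<Rightarrow> ereal \<Rightarrow> 'a::metric_space set \<Rightarrow> real \<Rightarrow> ennreal" where
  "NH_cap_delta \<alpha> \<beta> F \<delta> =
     (INF B \<in> {B :: nat \<Rightarrow> 'a set. F \<subseteq> (\<Union>j. B j) \<and> (\<forall>j. bounded (B j) \<and> diameter (B j) < \<delta>)}.
        cover_cost \<alpha> \<beta> B)"

text \<open>H_{alpha,beta}(F) = lim_{delta -> 0} H_{alpha,beta}(F,delta); the function is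
  nonincreasing in delta, so the limit is the supremum over delta > 0.\<close>
definition NH_cap :: "real \<Rightarrow> ereal \<Rightarrow> 'a::metric_space set \<Rightarrow> ennreal" where
  "NH_cap \<alpha> \<beta> F = (SUP \<delta> \<in> {0<..}. NH_cap_delta \<alpha> \<beta> F \<delta>)"

definition sigma_finite_NH :: "real \<Rightarrow> ereal \<Rightarrow> 'a::metric_space set \<Rightarrow> bool" where
  "sigma_finite_NH \<alpha> \<beta> S \<longleftrightarrow> (\<exists>Si :: nat \<Rightarrow> 'a set. S = (\<Union>i. Si i) \<and> (\<forall>i. NH_cap \<alpha> \<beta> (Si i) < top))"

definition dual_exp :: "real \<Rightarrow> ereal" where
  "dual_exp q = (if q = 1 then \<infinity> else ereal (q / (q - 1)))"

fun dir_derivs :: "'a::real_normed_vector list \<Rightarrow> ('a \<Rightarrow> complex) \<Rightarrow> ('a \<Rightarrow> complex)" where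
  "dir_derivs [] f = f"
| "dir_derivs (v # vs) f = (\<lambda>x. vector_derivative (\<lambda>t::real. dir_derivs vs f (x + t *\<^sub>R v)) (at 0))"

definition smooth_fun :: "('a::real_normed_vector \<Rightarrow> complex) \<Rightarrow> bool" where
  "smooth_fun f \<longleftrightarrow> (\<forall>vs x. dir_derivs vs f differentiable (at x))"

definition tsupport :: "('a::topological_space \<Rightarrow> complex) \<Rightarrow> 'a set" where
  "tsupport f = closure {x. f x \<noteq> 0}"

definition test_fun_off :: "'a::euclidean_space set \<Rightarrow> ('a \<Rightarrow> complex) \<Rightarrow> bool" where
  "test_fun_off S \<phi> \<longleftrightarrow> smooth_fun \<phi> \<and> compact (tsupport \<phi>) \<and> tsupport \<phi> \<inter> S = {}"

definition inv_fourier :: "('a::euclidean_space \<Rightarrow> complex) \<Rightarrow> 'a \<Rightarrow> complex" where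
  "inv_fourier \<phi> \<xi> = (\<integral>x. \<phi> x * cis (x \<bullet> \<xi>) \<partial>lebesgue)"

text \<open>The tempered distribution zeta with Fourier transform g (a function in L_{p,q}) has
  support in S: <zeta, phi> = <g, F^{-1} phi> vanishes for every test function phi supported off S.\<close>
definition ft_distrib_supported_in :: "('a::euclidean_space \<Rightarrow> complex) \<Rightarrow> 'a set \<Rightarrow> bool" where
  "ft_distrib_supported_in g S \<longleftrightarrow>
     (\<forall>\<phi>. test_fun_off S \<phi> \<longrightarrow> (\<integral>\<xi>. g \<xi> * inv_fourier \<phi> \<xi> \<partial>lebesgue) = 0)"

end

theory Submission
  imports Defs "HOL-Probability.Characteristic_Functions" "HOL-Probability.Sinc_Integral"
begin

text \<open>
  Write F for the Fourier transform of a test function. Cover S by finitely many balls, the i-th piece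
  of S being covered at scales below \<open>2 ^ - K i\<close>, and split a test function \<open>\<psi>\<close> into a part vanishing near S
  and layers \<open>\<Phi> k\<close> supported on the dyadic cubes of side comparable to \<open>2 ^ - k\<close> that meet the balls of that
  scale. The cutoff for scale k is multiplied by the complements of all coarser cutoffs; their
  derivatives, measured at scale k, form a geometric series, so the layers satisfy uniform bounds.
  The pairing of g with \<open>F (\<Phi> k)\<close> is estimated by cutting g at a height \<open>lam k\<close>: above it by Bessel's
  inequality, below it by the decay of \<open>F (\<Phi> k)\<close>. With \<open>a k\<close> the number of cubes times \<open>2 ^ - (2 d k / p)\<close>,
  the result is at most a constant times \<open>w k * sqrt (a k)\<close>, where choosing \<open>lam k\<close> as the height above which
  g lives on a set of measure \<open>2 ^ (d k)\<close> makes the q-th powers of \<open>w k\<close> summable, because g is in the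
  Lorentz space. By duality with the capacity, the sum over k is small once all scales are
  fine, each piece of S choosing its own \<open>K i\<close>. Hence g annihilates the Fourier transform of every test
  function, and an approximate identity argument gives g = 0.
\<close>


section \<open>Smooth functions\<close>

text \<open>The capacity parameters come from scaling. A layer of scale k is bounded and lives on
  N_k cubes of total measure about N_k 2^-(dk). Splitting 2^-(dk) into 2^-(2dk/p) and the square of
  2^-(dk(1/2-1/p)) leaves sqrt (a_k) for the cover and hands the other factor to g, where it
  balances the growth in k of the L2 norm of g above its threshold; p > 2 makes the series behind
  that norm converge. Hoelder with exponents q and q' then asks for the sum of a_k^(q'/2), which is
  the capacity. The capacity of a piece of S is finite, not small. Smallness comes from the tail of
  the weights w, which depend on g alone and are fixed before any cover. The obstacle is the mixing
  of scales. A layer carries complements from an unbounded number of coarser scales, so each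
  complement must have a bound tending to 1 as its own scale becomes coarse relative to k; a fixed
  constant above 1 per factor would be fatal. The weighted norms below are therefore
  submultiplicative with constant 1. They use one derivative per coordinate, so that all decay is a
  product of one-dimensional factors.\<close>

definition dird :: "'a::real_normed_vector \<Rightarrow> ('a \<Rightarrow> complex) \<Rightarrow> 'a \<Rightarrow> complex" where
  "dird v f x = vector_derivative (\<lambda>t::real. f (x + t *\<^sub>R v)) (at 0)"

lemma dir_derivs_snoc: "dir_derivs (vs @ [v]) f = dir_derivs vs (dird v f)"
  by (induction vs) (auto simp: dird_def[abs_def])

text \<open>\<open>dir_derivs\<close> applies the head of its list last. An induction from the right
  end therefore replaces \<open>f\<close> by \<open>dird v f\<close>, which stays in
  \<open>P\<close>.\<close>

lemma smooth_fun_coinduct: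
  assumes "P f" and step: "\<And>f. P f \<Longrightarrow> (\<forall>x. f differentiable (at x)) \<and> (\<forall>v. P (dird v f))"
  shows "smooth_fun f"
proof -
  have "\<forall>f. P f \<longrightarrow> (\<forall>x. dir_derivs vs f differentiable (at x))" for vs
  proof (induction vs rule: rev_induct)
    case Nil then show ?case using step by simp
  next
    case (snoc v vs) then show ?case using step by (simp add: dir_derivs_snoc)
  qed
  then show ?thesis using assms(1) unfolding smooth_fun_def by blast
qed

lemma smooth_fun_differentiable: "smooth_fun f \<Longrightarrow> f differentiable (at x)"
  unfolding smooth_fun_def by (metis dir_derivs.simps(1))

lemma smooth_fun_dird: "smooth_fun f \<Longrightarrow> smooth_fun (dird v f)"
  unfolding smooth_fun_def by (metis dir_derivs_snoc)

lemma dird_eqI: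
  assumes "(f has_derivative f') (at x)"
  shows "dird v f x = f' v"
proof -
  have "((\<lambda>t::real. f (x + t *\<^sub>R v)) has_derivative (\<lambda>t. f' (t *\<^sub>R v))) (at 0)"
    by (rule has_derivative_compose[where f="\<lambda>t::real. x + t *\<^sub>R v" and g=f])
       (use assms in \<open>auto intro!: derivative_eq_intros\<close>)
  moreover have "f' (t *\<^sub>R v) = t *\<^sub>R f' v" for t
    using assms by (simp add: has_derivative_linear linear_cmul)
  ultimately have "((\<lambda>t::real. f (x + t *\<^sub>R v)) has_vector_derivative f' v) (at 0)"
    by (simp add: has_vector_derivative_def)
  then show ?thesis unfolding dird_def by (rule vector_derivative_at)
qed

lemma has_derivative_dird:
  assumes "f differentiable (at x)"
  shows "(f has_derivative (\<lambda>v. dird v f x)) (at x)"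
proof -
  obtain f' where f': "(f has_derivative f') (at x)"
    using assms by (auto simp: differentiable_def)
  then have "f' = (\<lambda>v. dird v f x)" by (auto simp: dird_eqI)
  then show ?thesis using f' by simp
qed

lemma smooth_fun_has_derivative: "smooth_fun f \<Longrightarrow> (f has_derivative (\<lambda>v. dird v f x)) (at x)"
  by (intro has_derivative_dird smooth_fun_differentiable)

lemma smooth_fun_continuous_on: "smooth_fun f \<Longrightarrow> continuous_on A f"
  by (meson continuous_at_imp_continuous_on differentiable_imp_continuous_within smooth_fun_differentiable)

lemma smooth_fun_borel [measurable (raw)]:
  fixes f :: "'a::real_normed_vector \<Rightarrow> complex"
  shows "smooth_fun f \<Longrightarrow> f \<in> borel_measurable borel"
  by (intro borel_measurable_continuous_onI smooth_fun_continuous_on)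

text \<open>This class is invariant under differentiation, hence consists of smooth functions.\<close>

inductive smooth_alg :: "('a::real_normed_vector \<Rightarrow> complex) \<Rightarrow> bool" where
  base: "smooth_fun f \<Longrightarrow> smooth_alg f"
| const: "smooth_alg (\<lambda>_. c)"
| add: "smooth_alg f \<Longrightarrow> smooth_alg g \<Longrightarrow> smooth_alg (\<lambda>x. f x + g x)"
| mult: "smooth_alg f \<Longrightarrow> smooth_alg g \<Longrightarrow> smooth_alg (\<lambda>x. f x * g x)"
| inv: "smooth_alg f \<Longrightarrow> (\<And>x. f x \<noteq> 0) \<Longrightarrow> smooth_alg (\<lambda>x. inverse (f x))"

lemma smooth_alg_step:
  "smooth_alg f \<Longrightarrow> (\<forall>x. f differentiable (at x)) \<and> (\<forall>v. smooth_alg (dird v f))"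
proof (induction rule: smooth_alg.induct)
  case (base f)
  then show ?case by (auto intro: smooth_alg.base smooth_fun_dird smooth_fun_differentiable)
next
  case (const c)
  have "dird v (\<lambda>_. c) = (\<lambda>_. 0)" for v :: 'a by (auto intro!: ext dird_eqI)
  then show ?case by (auto intro: smooth_alg.const)
next
  case (add f g)
  have "dird v (\<lambda>x. f x + g x) = (\<lambda>x. dird v f x + dird v g x)" for v
    using add by (auto intro!: ext dird_eqI derivative_eq_intros has_derivative_dird)
  then show ?case using add by (auto intro: smooth_alg.add)
next
  case (mult f g)
  have "dird v (\<lambda>x. f x * g x) = (\<lambda>x. f x * dird v g x + dird v f x * g x)" for v
    using mult by (auto intro!: ext dird_eqI derivative_eq_intros has_derivative_dird)
  then show ?case using mult by (auto intro!: smooth_alg.add smooth_alg.mult)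
next
  case (inv f)
  have d: "((\<lambda>x. inverse (f x)) has_derivative (\<lambda>v. - (inverse (f x) * dird v f x * inverse (f x)))) (at x)" for x
    by (rule Deriv.has_derivative_inverse) (use inv in \<open>auto intro: has_derivative_dird\<close>)
  \<comment> \<open>The sign is a factor \<open>-1\<close> because \<open>smooth_alg\<close> has no
    rule for negation.\<close>
  have "dird v (\<lambda>x. inverse (f x)) = (\<lambda>x. (-1) * (inverse (f x) * (dird v f x * inverse (f x))))" for v
    by (rule ext, subst dird_eqI[OF d]) auto
  moreover have "smooth_alg (\<lambda>x. (-1) * (inverse (f x) * (dird v f x * inverse (f x))))" for v
    using inv by (intro smooth_alg.const smooth_alg.mult smooth_alg.inv) auto
  ultimately show ?case using d by (metis differentiable_def)
qed

lemma smooth_alg_smooth: "smooth_alg f \<Longrightarrow> smooth_fun f"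
  by (rule smooth_fun_coinduct[OF _ smooth_alg_step])

lemma smooth_fun_const [simp]: "smooth_fun (\<lambda>_. c)"
  by (rule smooth_alg_smooth, rule smooth_alg.const)

lemma smooth_fun_add: "smooth_fun f \<Longrightarrow> smooth_fun g \<Longrightarrow> smooth_fun (\<lambda>x. f x + g x)"
  by (rule smooth_alg_smooth, rule smooth_alg.add) (auto intro: smooth_alg.base)

lemma smooth_fun_mult: "smooth_fun f \<Longrightarrow> smooth_fun g \<Longrightarrow> smooth_fun (\<lambda>x. f x * g x)"
  by (rule smooth_alg_smooth, rule smooth_alg.mult) (auto intro: smooth_alg.base)

lemma smooth_fun_inverse: "smooth_fun f \<Longrightarrow> (\<And>x. f x \<noteq> 0) \<Longrightarrow> smooth_fun (\<lambda>x. inverse (f x))"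
  by (rule smooth_alg_smooth, rule smooth_alg.inv) (auto intro: smooth_alg.base)

lemma smooth_fun_uminus: "smooth_fun f \<Longrightarrow> smooth_fun (\<lambda>x. - f x)"
  using smooth_fun_mult[of "\<lambda>_. -1" f] by simp

lemma smooth_fun_diff: "smooth_fun f \<Longrightarrow> smooth_fun g \<Longrightarrow> smooth_fun (\<lambda>x. f x - g x)"
  using smooth_fun_add[of f "\<lambda>x. - g x"] smooth_fun_uminus[of g] by simp

lemma smooth_fun_sum:
  assumes "\<And>i. i \<in> I \<Longrightarrow> smooth_fun (f i)"
  shows "smooth_fun (\<lambda>x. \<Sum>i\<in>I. f i x)"
  using assms by (induction I rule: infinite_finite_induct) (auto intro: smooth_fun_add)

lemma smooth_fun_prod:
  assumes "\<And>i. i \<in> I \<Longrightarrow> smooth_fun (f i)"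
  shows "smooth_fun (\<lambda>x. \<Prod>i\<in>I. f i x)"
  using assms by (induction I rule: infinite_finite_induct) (auto intro: smooth_fun_mult)

lemma dird_const [simp]: "dird v (\<lambda>_. c) x = 0"
  by (intro dird_eqI) auto

lemma dird_add:
  "smooth_fun f \<Longrightarrow> smooth_fun g \<Longrightarrow> dird v (\<lambda>x. f x + g x) x = dird v f x + dird v g x"
  by (auto intro!: dird_eqI derivative_eq_intros smooth_fun_has_derivative)

lemma dird_mult:
  "smooth_fun f \<Longrightarrow> smooth_fun g \<Longrightarrow> dird v (\<lambda>x. f x * g x) x = f x * dird v g x + dird v f x * g x"
  by (auto intro!: dird_eqI derivative_eq_intros smooth_fun_has_derivative)

text \<open>Cutoffs and characters are built from functions \<open>h\<close> of one real variable. A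
  directional derivative of a ridge function is again a ridge function, which is the invariant for
  \<open>smooth_fun_coinduct\<close>. Matching the offset \<open>a\<close> is the reason for the
  \<open>+ 0\<close> in later formulas.\<close>

lemma smooth_fun_ridge:
  fixes u :: "'a::euclidean_space" and h :: "real \<Rightarrow> complex"
  assumes "smooth_fun h"
  shows "smooth_fun (\<lambda>x. h (x \<bullet> u + a))" and "dird v (\<lambda>x. h (x \<bullet> u + a)) x = (v \<bullet> u) * dird 1 h (x \<bullet> u + a)"
proof -
  have d: "((\<lambda>x. h (x \<bullet> u + a)) has_derivative (\<lambda>v. dird (v \<bullet> u) h (x \<bullet> u + a))) (at x)"
    if "smooth_fun h" for x and h :: "real \<Rightarrow> complex"
    by (rule has_derivative_compose[where g=h and f="\<lambda>x. x \<bullet> u + a"])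
       (use smooth_fun_has_derivative[OF that] in \<open>auto intro!: derivative_eq_intros\<close>)
  have e: "dird t h y = t * dird 1 h y" if "smooth_fun h" for t y and h :: "real \<Rightarrow> complex"
  proof -
    have "linear (\<lambda>t. dird t h y)"
      using smooth_fun_has_derivative[OF that] has_derivative_linear by blast
    from linear_cmul[OF this, of t 1] show ?thesis by (simp add: scaleR_conv_of_real)
  qed
  have dd: "dird v (\<lambda>x. h (x \<bullet> u + a)) = (\<lambda>x. (v \<bullet> u) * dird 1 h (x \<bullet> u + a))"
    if "smooth_fun h" for v and h :: "real \<Rightarrow> complex"
    by (rule ext) (simp only: dird_eqI[OF d[OF that]] e[OF that, of "v \<bullet> u"])
  show "dird v (\<lambda>x. h (x \<bullet> u + a)) x = (v \<bullet> u) * dird 1 h (x \<bullet> u + a)"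
    using dd[OF assms] by simp
  show "smooth_fun (\<lambda>x. h (x \<bullet> u + a))"
  proof (rule smooth_fun_coinduct[where P="\<lambda>f. \<exists>h. smooth_fun h \<and> f = (\<lambda>x. h (x \<bullet> u + a))"])
    fix f :: "'a \<Rightarrow> complex" assume "\<exists>h. smooth_fun h \<and> f = (\<lambda>x. h (x \<bullet> u + a))"
    then obtain h where h: "smooth_fun h" "f = (\<lambda>x. h (x \<bullet> u + a))" by blast
    have "smooth_fun (\<lambda>y. (v \<bullet> u) * dird 1 h y)" for v
      by (intro smooth_fun_mult smooth_fun_dird h smooth_fun_const)
    then have "\<exists>h. smooth_fun h \<and> dird v f = (\<lambda>x. h (x \<bullet> u + a))" for v
      unfolding h(2) dd[OF h(1)] by blast
    then show "(\<forall>x. f differentiable at x) \<and> (\<forall>v. \<exists>h. smooth_fun h \<and> dird v f = (\<lambda>x. h (x \<bullet> u + a)))"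
      using d[OF h(1)] unfolding h(2) differentiable_def by blast
  qed (use assms in blast)
qed

lemma smooth_fun_cis: "smooth_fun (\<lambda>t::real. cis t)"
proof (rule smooth_fun_coinduct[where P="\<lambda>f. \<exists>c. f = (\<lambda>t::real. c * cis t)"])
  fix f :: "real \<Rightarrow> complex" assume "\<exists>c. f = (\<lambda>t. c * cis t)"
  then obtain c where f: "f = (\<lambda>t. c * cis t)" by blast
  have d: "(f has_derivative (\<lambda>v. c * (v *\<^sub>R (\<i> * cis x)))) (at x)" for x
    unfolding f by (auto intro!: derivative_eq_intros)
  have "dird v f = (\<lambda>x. (c * v * \<i>) * cis x)" for v
    by (rule ext) (simp add: dird_eqI[OF d] scaleR_conv_of_real)
  then show "(\<forall>x. f differentiable at x) \<and> (\<forall>v. \<exists>c. dird v f = (\<lambda>t. c * cis t))"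
    using d by (auto simp: differentiable_def)
qed (auto intro: exI[of _ 1])

section \<open>A smooth partition of unity on the line\<close>

text \<open>The case n = 0 is the standard flat function; the powers of 1 / x are kept as a
  parameter because differentiation produces them, so that the linear combinations of the family are
  closed under it.\<close>

definition expinv :: "nat \<Rightarrow> real \<Rightarrow> complex" where
  "expinv n x = (if x > 0 then of_real ((1 / x) ^ n * exp (- 1 / x)) else 0)"

text \<open>Put y = 1 / x: the quotient becomes y^(n+1) / exp y at infinity. Division by x is what
  differentiability at 0 with derivative 0 requires.\<close>

lemma expinv_flat: "((\<lambda>x. expinv n x / of_real x) \<longlongrightarrow> 0) (at 0)"
proof -
  have "((\<lambda>y::real. y ^ Suc n / exp y) \<longlongrightarrow> 0) at_top" by (rule tendsto_power_div_exp_0)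
  then have "((\<lambda>x::real. (inverse x) ^ Suc n / exp (inverse x)) \<longlongrightarrow> 0) (at_right 0)"
    by (rule filterlim_compose) (rule filterlim_inverse_at_top_right)
  then have "((\<lambda>x::real. complex_of_real ((inverse x) ^ Suc n / exp (inverse x))) \<longlongrightarrow> of_real 0) (at_right 0)"
    by (intro tendsto_of_real)
  then have "((\<lambda>x::real. complex_of_real ((inverse x) ^ Suc n / exp (inverse x))) \<longlongrightarrow> 0) (at_right 0)"
    by simp
  moreover have "\<forall>\<^sub>F x in at_right 0. complex_of_real ((inverse x) ^ Suc n / exp (inverse x)) = expinv n x / of_real x"
    unfolding eventually_at_filter
    by (rule always_eventually) (auto simp: expinv_def exp_minus field_simps)
  ultimately have r: "((\<lambda>x. expinv n x / of_real x) \<longlongrightarrow> 0) (at_right 0)"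
    by (rule Lim_transform_eventually)
  have l: "((\<lambda>x. expinv n x / of_real x) \<longlongrightarrow> 0) (at_left 0)"
    by (rule tendsto_eventually) (auto simp: eventually_at_filter expinv_def)
  show ?thesis using r l filterlim_split_at by blast
qed

lemma expinv_has_derivative:
  "(expinv n has_vector_derivative (expinv (n+2) x - n * expinv (n+1) x)) (at x)"
proof -
  consider "x < 0" | "x = 0" | "x > 0" by linarith
  then show ?thesis
  proof cases
    case 1
    have "((\<lambda>_. 0::complex) has_vector_derivative 0) (at x)" by simp
    then have "(expinv n has_vector_derivative 0) (at x)"
      by (rule has_vector_derivative_transform_within_open[where S="{..<0}"]) (use 1 in \<open>auto simp: expinv_def\<close>)
    then show ?thesis using 1 by (simp add: expinv_def)
  next
    case 2
    have "(expinv n has_vector_derivative 0) (at 0)"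
    proof -
      have "((\<lambda>y. norm (expinv n y / of_real y)) \<longlongrightarrow> 0) (at 0)"
        by (rule tendsto_norm_zero[OF expinv_flat])
      then have "((\<lambda>y. norm ((1 / \<bar>y\<bar>) *\<^sub>R (expinv n y - expinv n 0))) \<longlongrightarrow> 0) (at 0)"
        by (rule Lim_transform_eventually)
           (auto intro!: always_eventually simp: expinv_def norm_divide norm_mult divide_simps)
      then have "((\<lambda>y. (1 / \<bar>y\<bar>) *\<^sub>R (expinv n y - expinv n 0)) \<longlongrightarrow> 0) (at 0)"
        by (rule tendsto_norm_zero_cancel)
      then show ?thesis
        unfolding has_vector_derivative_def has_derivative_at2 by simp
    qed
    then show ?thesis using 2 by (simp add: expinv_def)
  next
    case 3
    have "((\<lambda>x. ((1 / x) ^ n * exp (- 1 / x))) has_real_derivative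
        ((1/x)^(n+2) * exp (-1/x) - n * ((1/x)^(n+1) * exp (-1/x)))) (at x)"
    proof -
      have "((\<lambda>x. (1/x)^n) has_real_derivative (real n * ((-1/x^2) * (1/x)^(n-1)))) (at x)"
        using 3 by (auto intro!: derivative_eq_intros simp: power2_eq_square)
      moreover have "real n * ((-1/x^2) * (1/x)^(n-1)) = - n * (1/x)^(n+1)"
        using 3 by (cases n) (auto simp: field_simps power2_eq_square)
      ultimately have d: "((\<lambda>x. (1/x)^n) has_real_derivative - n * (1/x)^(n+1)) (at x)" by simp
      have e: "((\<lambda>x. exp (-1/x)) has_real_derivative (1/x)^2 * exp (-1/x)) (at x)"
        using 3 by (auto intro!: derivative_eq_intros simp: power2_eq_square)
      show ?thesis
        using DERIV_mult[OF d e] by (simp add: algebra_simps power_add power2_eq_square)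
    qed
    then have "((\<lambda>x. complex_of_real ((1 / x) ^ n * exp (- 1 / x))) has_vector_derivative
        complex_of_real ((1/x)^(n+2) * exp (-1/x) - n * ((1/x)^(n+1) * exp (-1/x)))) (at x)"
      by (rule has_vector_derivative_of_real)
    then have "(expinv n has_vector_derivative
        complex_of_real ((1/x)^(n+2) * exp (-1/x) - n * ((1/x)^(n+1) * exp (-1/x)))) (at x)"
      by (rule has_vector_derivative_transform_within_open[where S="{0<..}"]) (use 3 in \<open>auto simp: expinv_def\<close>)
    then show ?thesis using 3 by (simp add: expinv_def)
  qed
qed

lemma smooth_expinv: "smooth_fun (expinv n)"
proof (rule smooth_fun_coinduct[where P="\<lambda>f. \<exists>N c. f = (\<lambda>x. \<Sum>n<N. c n * expinv n x)"])
  have "expinv n = (\<lambda>x. \<Sum>m<Suc n. (if m = n then 1 else 0) * expinv m x)"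
    by (auto simp: if_distrib[of "\<lambda>c. c * _"] cong: if_cong)
  then show "\<exists>N c. expinv n = (\<lambda>x. \<Sum>n<N. c n * expinv n x)"
    by (intro exI[of _ "Suc n"] exI[of _ "\<lambda>m. if m = n then 1 else 0"])
next
  fix f assume "\<exists>N c. f = (\<lambda>x. \<Sum>n<N. c n * expinv n x)"
  then obtain N c where f: "f = (\<lambda>x. \<Sum>n<N. c n * expinv n x)" by blast
  have d: "(f has_derivative (\<lambda>v. \<Sum>n<N. c n * (v *\<^sub>R (expinv (n+2) x - n * expinv (n+1) x)))) (at x)" for x
    unfolding f using expinv_has_derivative[unfolded has_vector_derivative_def]
    by (intro has_derivative_sum has_derivative_mult_right) auto
  have "\<exists>M b. dird v f = (\<lambda>x. \<Sum>n<M. b n * expinv n x)" for v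
  proof -
    \<comment> \<open>Differentiation sends index n to n+2 and n+1; \<open>b\<close> collects the
      contributions to index m, so the new range is \<open>N+2\<close>.\<close>
    define b where "b m = (\<Sum>n<N. c n * v * ((if m = n+2 then 1 else 0) - of_nat n * (if m = n+1 then 1 else 0)))" for m
    have "dird v f x = (\<Sum>m<N+2. b m * expinv m x)" for x
    proof -
      have "(\<Sum>m<N+2. b m * expinv m x) = (\<Sum>m<N+2. \<Sum>n<N. c n * v * ((if m = n+2 then 1 else 0) - of_nat n * (if m = n+1 then 1 else 0)) * expinv m x)"
        by (simp add: b_def sum_distrib_right)
      also have "\<dots> = (\<Sum>n<N. \<Sum>m<N+2. c n * v * ((if m = n+2 then 1 else 0) - of_nat n * (if m = n+1 then 1 else 0)) * expinv m x)"
        by (rule sum.swap)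
      also have "\<dots> = (\<Sum>n<N. c n * v * (\<Sum>m<N+2. (if m = n+2 then expinv m x else 0) - (if m = n+1 then n * expinv m x else 0)))"
        unfolding sum_distrib_left by (intro sum.cong refl) auto
      also have "\<dots> = (\<Sum>n<N. c n * (v *\<^sub>R (expinv (n+2) x - n * expinv (n+1) x)))"
      proof (intro sum.cong refl)
        fix n assume "n \<in> {..<N}"
        then have "(\<Sum>m<N+2. if m = n+2 then expinv m x else 0) = expinv (n+2) x"
          "(\<Sum>m<N+2. if m = n+1 then n * expinv m x else 0) = n * expinv (n+1) x"
          by (subst sum.delta; simp)+
        then show "c n * v * (\<Sum>m<N+2. (if m = n+2 then expinv m x else 0) - (if m = n+1 then n * expinv m x else 0))
          = c n * (v *\<^sub>R (expinv (n+2) x - n * expinv (n+1) x))"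
          by (simp only: sum_subtractf scaleR_conv_of_real mult.assoc)
      qed
      finally show ?thesis by (simp add: dird_eqI[OF d])
    qed
    then show ?thesis by blast
  qed
  then show "(\<forall>x. f differentiable at x) \<and> (\<forall>v. \<exists>N c. dird v f = (\<lambda>x. \<Sum>n<N. c n * expinv n x))"
    using d by (auto simp: differentiable_def)
qed

section \<open>A smooth step and a bump whose integer translates sum to 1\<close>

definition smooth_step :: "real \<Rightarrow> complex" where
  "smooth_step x = expinv 0 x * inverse (expinv 0 x + expinv 0 (1 - x))"

lemma smooth_step_eq:
  "smooth_step x = complex_of_real (Re (smooth_step x))" "0 \<le> Re (smooth_step x)" "Re (smooth_step x) \<le> 1"
  "x \<le> 0 \<Longrightarrow> smooth_step x = 0" "x \<ge> 1 \<Longrightarrow> smooth_step x = 1"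
proof -
  define a where "a = (if x > 0 then exp (- 1 / x) else 0)"
  define b where "b = (if 1 - x > 0 then exp (- 1 / (1 - x)) else 0)"
  have s: "smooth_step x = complex_of_real (a * inverse (a + b))"
    unfolding smooth_step_def expinv_def a_def b_def by auto
  have ab: "a \<ge> 0" "b \<ge> 0" "a + b > 0" by (auto simp: a_def b_def add_pos_pos)
  show "smooth_step x = complex_of_real (Re (smooth_step x))" "0 \<le> Re (smooth_step x)" "Re (smooth_step x) \<le> 1"
    using ab by (auto simp: s field_simps)
  show "x \<le> 0 \<Longrightarrow> smooth_step x = 0" "x \<ge> 1 \<Longrightarrow> smooth_step x = 1"
    by (auto simp: smooth_step_def expinv_def)
qed

lemma smooth_smooth_step: "smooth_fun smooth_step"
proof -
  have 1: "smooth_fun (\<lambda>x::real. expinv 0 (1 - x))"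
    using smooth_fun_ridge(1)[OF smooth_expinv[of 0], of "-1::real" 1] by simp
  have "expinv 0 x + expinv 0 (1 - x) \<noteq> 0" for x
  proof -
    have "expinv 0 x + expinv 0 (1 - x) = complex_of_real ((if x > 0 then exp (- 1 / x) else 0) + (if 1 - x > 0 then exp (- 1 / (1 - x)) else 0))"
      by (auto simp: expinv_def)
    moreover have "(if x > 0 then exp (- 1 / x) else 0) + (if 1 - x > 0 then exp (- 1 / (1 - x)) else 0) > 0"
      by (auto simp: add_pos_pos)
    ultimately show ?thesis by (metis less_irrefl of_real_eq_0_iff)
  qed
  then show ?thesis unfolding smooth_step_def[abs_def]
    by (intro smooth_fun_mult smooth_fun_inverse smooth_fun_add smooth_expinv 1)
qed

text \<open>A difference of two shifted steps, so that sums over integer translates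
  telescope.\<close>

definition ubump :: "real \<Rightarrow> complex" where
  "ubump x = smooth_step (x + 1) - smooth_step x"

lemma smooth_ubump: "smooth_fun ubump"
  unfolding ubump_def[abs_def]
  using smooth_fun_ridge(1)[OF smooth_smooth_step, of "1::real" 1] smooth_smooth_step
  by (intro smooth_fun_diff) auto

lemma ubump_supp: "\<bar>x\<bar> \<ge> 1 \<Longrightarrow> ubump x = 0"
  by (auto simp: ubump_def abs_if smooth_step_eq(4,5) split: if_splits)

lemma ubump_0 [simp]: "ubump 0 = 1"
  by (simp add: ubump_def smooth_step_eq(4,5))

lemma ubump_nonneg: "ubump x = of_real (cmod (ubump x))"
proof -
  obtain r where r: "smooth_step x = of_real r" "0 \<le> r" "r \<le> 1" using smooth_step_eq(1-3)[of x] by blast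
  obtain t where t: "smooth_step (x+1) = of_real t" "0 \<le> t" "t \<le> 1" using smooth_step_eq(1-3)[of "x+1"] by blast
  have "\<exists>r\<ge>0. ubump x = of_real r"
  proof (cases "x \<ge> 0")
    case True
    then have "ubump x = of_real (1 - r)" using r by (simp add: ubump_def smooth_step_eq(5))
    then show ?thesis using r by (intro exI[of _ "1 - r"]) auto
  next
    case False
    then have "ubump x = of_real t" using t by (simp add: ubump_def smooth_step_eq(4))
    then show ?thesis using t by blast
  qed
  then show ?thesis by auto
qed

text \<open>At y only the translates by \<open>\<lfloor>y\<rfloor>\<close> and
  \<open>\<lfloor>y\<rfloor> + 1\<close> survive, and their sum telescopes to 1. Arbitrary finite
  \<open>F\<close> is allowed because cutoffs will use only the lattice points near the set
  S.\<close>

lemma ubump_sum_le: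
  assumes "finite F"
  shows "(\<Sum>n\<in>F. cmod (ubump (y - of_int n))) \<le> 1"
    and "{\<lfloor>y\<rfloor>, \<lfloor>y\<rfloor> + 1} \<subseteq> F \<Longrightarrow> (\<Sum>n\<in>F. ubump (y - of_int n)) = 1"
proof -
  let ?G = "{\<lfloor>y\<rfloor>, \<lfloor>y\<rfloor> + 1}"
  have z: "ubump (y - of_int n) = 0" if "n \<notin> ?G" for n
  proof -
    have "n \<le> \<lfloor>y\<rfloor> - 1 \<or> n \<ge> \<lfloor>y\<rfloor> + 2" using that by auto
    then have "\<bar>y - of_int n\<bar> \<ge> 1" by linarith
    then show ?thesis by (rule ubump_supp)
  qed
  have "smooth_step (y - of_int \<lfloor>y\<rfloor> + 1) = 1" "smooth_step (y - of_int \<lfloor>y\<rfloor> - 1) = 0"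
    by (auto intro!: smooth_step_eq(4,5)) linarith+
  then have G: "(\<Sum>n\<in>?G. ubump (y - of_int n)) = 1"
    by (simp add: ubump_def algebra_simps)
  have "complex_of_real (\<Sum>n\<in>?G. cmod (ubump (y - of_int n))) = (\<Sum>n\<in>?G. ubump (y - of_int n))"
    unfolding of_real_sum by (intro sum.cong refl ubump_nonneg[symmetric])
  then have G': "(\<Sum>n\<in>?G. cmod (ubump (y - of_int n))) = 1" using G by (metis of_real_eq_1_iff)
  have "(\<Sum>n\<in>F. cmod (ubump (y - of_int n))) = (\<Sum>n\<in>F \<inter> ?G. cmod (ubump (y - of_int n)))"
    by (rule sum.mono_neutral_right) (use z assms in auto)
  also have "\<dots> \<le> (\<Sum>n\<in>?G. cmod (ubump (y - of_int n)))" by (rule sum_mono2) auto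
  finally show "(\<Sum>n\<in>F. cmod (ubump (y - of_int n))) \<le> 1" using G' by simp
  show "(\<Sum>n\<in>F. ubump (y - of_int n)) = 1" if "?G \<subseteq> F"
  proof -
    have "(\<Sum>n\<in>?G. ubump (y - of_int n)) = (\<Sum>n\<in>F. ubump (y - of_int n))"
      by (rule sum.mono_neutral_left) (use z assms that in auto)
    then show ?thesis using G by simp
  qed
qed

lemma dird_ubump_sum_le: "\<exists>M\<ge>0. \<forall>F y. finite F \<longrightarrow> (\<Sum>n\<in>F. cmod (dird 1 ubump (y - of_int n))) \<le> M"
proof -
  have z: "dird 1 ubump x = 0" if "\<bar>x\<bar> > 1" for x
  proof (rule dird_eqI)
    have "((\<lambda>_. 0::complex) has_derivative (\<lambda>_. 0)) (at x)" by simp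
    then show "(ubump has_derivative (\<lambda>_. 0)) (at x)"
      by (rule has_derivative_transform_within_open[where s="{x. \<bar>x\<bar> > 1}"])
         (use that in \<open>auto simp: ubump_supp intro!: open_Collect_less continuous_intros\<close>)
  qed
  have "continuous_on {-1..1} (dird 1 ubump)" by (intro smooth_fun_continuous_on smooth_fun_dird smooth_ubump)
  then have "compact (dird 1 ubump ` {-1..1})" by (intro compact_continuous_image) auto
  then obtain B where B: "\<forall>x\<in>{-1..1}. cmod (dird 1 ubump x) \<le> B" by (auto dest!: compact_imp_bounded simp: bounded_iff)
  have B': "cmod (dird 1 ubump x) \<le> max B 0" for x
    using z[of x] B[rule_format, of x] by (cases "\<bar>x\<bar> \<le> 1") (auto simp: abs_le_iff intro: max.coboundedI1)
  have "(\<Sum>n\<in>F. cmod (dird 1 ubump (y - of_int n))) \<le> 4 * max B 0" if "finite F" for F y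
  proof -
    \<comment> \<open>The derivative is known to vanish only where \<bar>x\<bar> > 1 strictly, since
      the argument needs an open set; hence a window of four integers instead of two.\<close>
    let ?G = "{\<lfloor>y\<rfloor> - 1..\<lfloor>y\<rfloor> + 2}"
    have "(\<Sum>n\<in>F. cmod (dird 1 ubump (y - of_int n))) = (\<Sum>n\<in>F \<inter> ?G. cmod (dird 1 ubump (y - of_int n)))"
    proof (rule sum.mono_neutral_right)
      show "\<forall>n\<in>F - F \<inter> ?G. cmod (dird 1 ubump (y - of_int n)) = 0"
      proof
        fix n assume "n \<in> F - F \<inter> ?G"
        then have "n \<le> \<lfloor>y\<rfloor> - 2 \<or> n \<ge> \<lfloor>y\<rfloor> + 3" by auto
        then have "\<bar>y - of_int n\<bar> > 1" by linarith
        then show "cmod (dird 1 ubump (y - of_int n)) = 0" using z by simp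
      qed
    qed (use that in auto)
    also have "\<dots> \<le> (\<Sum>n\<in>?G. cmod (dird 1 ubump (y - of_int n)))" by (rule sum_mono2) auto
    also have "\<dots> \<le> (\<Sum>n\<in>?G. max B 0)" by (intro sum_mono B')
    finally show ?thesis by simp
  qed
  then show ?thesis by (intro exI[of _ "4 * max B 0"]) auto
qed


section \<open>Weighted sums of mixed derivatives\<close>

text \<open>For a list of distinct basis vectors, \<open>wsum s bs f x\<close> is the sum of \<open>s ^ k * cmod (D f x)\<close> over
  all mixed derivatives D of order k that use each direction of the list at most once.\<close>

fun wsum :: "real \<Rightarrow> 'a::euclidean_space list \<Rightarrow> ('a \<Rightarrow> complex) \<Rightarrow> 'a \<Rightarrow> real" where
  "wsum s [] f x = cmod (f x)"
| "wsum s (b # bs) f x = wsum s bs f x + s * wsum s bs (dird b f) x"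

text \<open>The product over the listed directions of 1 + s d/db. On the Fourier side it multiplies
  by the product of 1 - i s (b, \<xi>); over a full basis the reciprocal of this multiplier is
  square integrable in every dimension.\<close>

fun bessel_op :: "real \<Rightarrow> 'a::euclidean_space list \<Rightarrow> ('a \<Rightarrow> complex) \<Rightarrow> 'a \<Rightarrow> complex" where
  "bessel_op s [] f = f"
| "bessel_op s (b # bs) f = bessel_op s bs (\<lambda>x. f x + of_real s * dird b f x)"

lemma dird_cmult: "smooth_fun f \<Longrightarrow> dird v (\<lambda>x. c * f x) x = c * dird v f x"
  by (subst dird_mult) auto

lemma dird_zero_on:
  assumes "open U" "x \<in> U" "\<And>x. x \<in> U \<Longrightarrow> f x = 0"
  shows "dird v f x = 0"
proof (rule dird_eqI)
  have "((\<lambda>_. 0::complex) has_derivative (\<lambda>_. 0)) (at x)" by simp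
  then show "(f has_derivative (\<lambda>_. 0)) (at x)"
    by (rule has_derivative_transform_within_open[where s=U]) (use assms in auto)
qed

lemma wsum_nonneg: "0 \<le> s \<Longrightarrow> 0 \<le> wsum s bs f x"
  by (induction bs arbitrary: f) auto

lemma wsum_const: "wsum s bs (\<lambda>_. c) x = cmod c"
proof (induction bs arbitrary: c)
  case (Cons b bs)
  have "dird b (\<lambda>_. c) = (\<lambda>_. 0)" by (rule ext) simp
  then show ?case using Cons[of c] Cons[of 0] by simp
qed simp

lemma wsum_add:
  assumes "0 \<le> s" "smooth_fun f" "smooth_fun g"
  shows "wsum s bs (\<lambda>x. f x + g x) x \<le> wsum s bs f x + wsum s bs g x"
  using assms(2,3)
proof (induction bs arbitrary: f g)
  case (Cons b bs)
  have "dird b (\<lambda>x. f x + g x) = (\<lambda>x. dird b f x + dird b g x)"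
    using Cons.prems by (auto simp: dird_add)
  then have "wsum s bs (dird b (\<lambda>x. f x + g x)) x \<le> wsum s bs (dird b f) x + wsum s bs (dird b g) x"
    using Cons.IH[OF smooth_fun_dird smooth_fun_dird, OF Cons.prems] by simp
  from mult_left_mono[OF this assms(1)] Cons.IH[OF Cons.prems] show ?case by (simp add: algebra_simps)
qed (simp add: norm_triangle_ineq)

lemma wsum_uminus: "smooth_fun f \<Longrightarrow> wsum s bs (\<lambda>x. - f x) x = wsum s bs f x"
proof (induction bs arbitrary: f)
  case (Cons b bs)
  have "dird b (\<lambda>x. - f x) = (\<lambda>x. - dird b f x)"
    using dird_cmult[OF Cons.prems, of b "-1"] by auto
  then show ?case using Cons.IH[of f] Cons.IH[of "dird b f"] Cons.prems by (simp add: smooth_fun_dird)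
qed simp

lemma wsum_sum:
  assumes "0 \<le> s" "finite I" "\<And>i. i \<in> I \<Longrightarrow> smooth_fun (f i)"
  shows "wsum s bs (\<lambda>x. \<Sum>i\<in>I. f i x) x \<le> (\<Sum>i\<in>I. wsum s bs (f i) x)"
  using assms(2,3)
proof (induction I)
  case (insert i I)
  have "wsum s bs (\<lambda>x. f i x + (\<Sum>i\<in>I. f i x)) x \<le> wsum s bs (f i) x + wsum s bs (\<lambda>x. \<Sum>i\<in>I. f i x) x"
    by (intro wsum_add assms smooth_fun_sum insert) auto
  then show ?case using insert by fastforce
qed (simp add: wsum_const)

text \<open>Multiplying out the right-hand side in one direction gives the Leibniz terms plus the
  product of the two derivative parts, which is nonnegative and is dropped. The constant 1 is
  essential, since \<open>wsum_prod\<close> is applied to an unbounded number of factors.\<close>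

lemma wsum_mult:
  assumes "0 \<le> s" "smooth_fun f" "smooth_fun g"
  shows "wsum s bs (\<lambda>x. f x * g x) x \<le> wsum s bs f x * wsum s bs g x"
  using assms(2,3)
proof (induction bs arbitrary: f g)
  case (Cons b bs)
  note f = Cons.prems(1) and g = Cons.prems(2)
  note df = smooth_fun_dird[OF f, of b] and dg = smooth_fun_dird[OF g, of b]
  have "dird b (\<lambda>x. f x * g x) = (\<lambda>x. f x * dird b g x + dird b f x * g x)"
    using f g by (auto simp: dird_mult)
  then have "wsum s bs (dird b (\<lambda>x. f x * g x)) x
      \<le> wsum s bs (\<lambda>x. f x * dird b g x) x + wsum s bs (\<lambda>x. dird b f x * g x) x"
    using wsum_add[OF assms(1) smooth_fun_mult[OF f dg] smooth_fun_mult[OF df g]] by simp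
  also have "\<dots> \<le> wsum s bs f x * wsum s bs (dird b g) x + wsum s bs (dird b f) x * wsum s bs g x"
    by (intro add_mono Cons.IH f g df dg)
  finally have "s * wsum s bs (dird b (\<lambda>x. f x * g x)) x
      \<le> s * (wsum s bs f x * wsum s bs (dird b g) x + wsum s bs (dird b f) x * wsum s bs g x)"
    using assms(1) by (intro mult_left_mono)
  moreover have "0 \<le> (s * wsum s bs (dird b f) x) * (s * wsum s bs (dird b g) x)"
    using assms(1) by (simp add: wsum_nonneg)
  ultimately show ?case using Cons.IH[OF f g] by (simp add: algebra_simps)
qed (simp add: norm_mult)

lemma wsum_prod:
  assumes "0 \<le> s" "finite I" "\<And>i. i \<in> I \<Longrightarrow> smooth_fun (f i)"
  shows "wsum s bs (\<lambda>x. \<Prod>i\<in>I. f i x) x \<le> (\<Prod>i\<in>I. wsum s bs (f i) x)"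
  using assms(2,3)
proof (induction I)
  case (insert i I)
  have "wsum s bs (\<lambda>x. f i x * (\<Prod>i\<in>I. f i x)) x \<le> wsum s bs (f i) x * wsum s bs (\<lambda>x. \<Prod>i\<in>I. f i x) x"
    by (intro wsum_mult assms smooth_fun_prod insert) auto
  also have "\<dots> \<le> wsum s bs (f i) x * (\<Prod>i\<in>I. wsum s bs (f i) x)"
    by (intro mult_left_mono insert wsum_nonneg assms) auto
  finally show ?case using insert by simp
qed (simp add: wsum_const)

text \<open>Every derivative of 1 - f is that of f up to sign, so only the term of order zero
  changes. The equality keeps the order-zero terms of f and 1 - f from being counted twice, as the
  triangle inequality would do.\<close>

lemma wsum_one_minus:
  assumes "smooth_fun f"
  shows "wsum s bs (\<lambda>x. 1 - f x) x = cmod (1 - f x) + wsum s bs f x - cmod (f x)"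
  using assms
proof (induction bs)
  case (Cons b bs)
  have "dird b (\<lambda>x. 1 - f x) = (\<lambda>x. - dird b f x)"
    using dird_add[of "\<lambda>_. 1" "\<lambda>x. - f x" b] dird_cmult[OF Cons.prems, of b "-1"] Cons.prems
    by (auto simp: smooth_fun_uminus)
  then show ?case using Cons by (simp add: wsum_uminus smooth_fun_dird)
qed simp

lemma wsum_mono: "0 \<le> s \<Longrightarrow> s \<le> t \<Longrightarrow> wsum s bs f x \<le> wsum t bs f x"
proof (induction bs arbitrary: f)
  case (Cons b bs)
  show ?case using Cons by (auto intro!: add_mono mult_mono wsum_nonneg)
qed simp

lemma wsum_zero_on:
  assumes "open U" "x \<in> U" "\<And>x. x \<in> U \<Longrightarrow> f x = 0"
  shows "wsum s bs f x = 0"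
  using assms(2,3)
proof (induction bs arbitrary: f x)
  case (Cons b bs)
  have "wsum s bs f x = 0" using Cons by blast
  moreover have "wsum s bs (dird b f) x = 0"
    by (rule Cons.IH) (use Cons.prems dird_zero_on[OF assms(1)] in auto)
  ultimately show ?case by simp
qed simp

lemma wsum_continuous_on: "smooth_fun f \<Longrightarrow> continuous_on A (wsum s bs f)"
proof (induction bs arbitrary: f)
  case Nil
  have "wsum s [] f = (\<lambda>x. cmod (f x))" by auto
  then show ?case using Nil by (auto intro!: continuous_intros smooth_fun_continuous_on)
next
  case (Cons b bs)
  have "wsum s (b # bs) f = (\<lambda>x. wsum s bs f x + s * wsum s bs (dird b f) x)" by auto
  then show ?case using Cons by (auto intro!: continuous_intros simp: smooth_fun_dird)
qed

lemma bessel_op_le_wsum: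
  assumes "0 \<le> s" "smooth_fun f"
  shows "cmod (bessel_op s bs f x) \<le> wsum s bs f x"
  using assms(2)
proof (induction bs arbitrary: f)
  case (Cons b bs)
  note df = smooth_fun_dird[OF Cons.prems, of b]
  have c: "wsum s bs (\<lambda>x. of_real s * dird b f x) x \<le> s * wsum s bs (dird b f) x"
    using wsum_mult[OF assms(1) smooth_fun_const df, of bs "of_real s"] assms(1) by (simp add: wsum_const)
  have "cmod (bessel_op s (b # bs) f x) \<le> wsum s bs (\<lambda>x. f x + of_real s * dird b f x) x"
    unfolding bessel_op.simps
    by (intro Cons.IH smooth_fun_add smooth_fun_mult Cons.prems df smooth_fun_const)
  also have "\<dots> \<le> wsum s bs f x + wsum s bs (\<lambda>x. of_real s * dird b f x) x"
    by (intro wsum_add assms Cons.prems smooth_fun_mult df) auto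
  finally show ?case using c by simp
qed simp

text \<open>Derivatives along basis vectors other than b vanish by orthogonality, and no direction
  occurs twice, so one first derivative is all that is left.\<close>

lemma wsum_ridge:
  assumes "0 \<le> s" "0 \<le> r" "b \<in> Basis" "set bs \<subseteq> Basis" "distinct bs" "smooth_fun h"
  shows "wsum s bs (\<lambda>x. h (x \<bullet> (r *\<^sub>R b) + a)) x
      \<le> cmod (h (x \<bullet> (r *\<^sub>R b) + a)) + s * r * cmod (dird 1 h (x \<bullet> (r *\<^sub>R b) + a))"
proof -
  have off: "dird c (\<lambda>x. h (x \<bullet> (r *\<^sub>R b) + a)) = (\<lambda>_. 0)" if "c \<in> Basis" "c \<noteq> b" "smooth_fun h" for c h
    by (rule ext) (use that assms(3) in \<open>simp only: smooth_fun_ridge(2), simp add: inner_Basis\<close>)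
  have 0: "wsum s cs (\<lambda>x. h (x \<bullet> (r *\<^sub>R b) + a)) x = cmod (h (x \<bullet> (r *\<^sub>R b) + a))"
    if "set cs \<subseteq> Basis" "b \<notin> set cs" "smooth_fun h" for cs h
    using that
  proof (induction cs)
    case (Cons c cs)
    then have "c \<in> Basis" "c \<noteq> b" by auto
    from off[OF this Cons.prems(3)] Cons show ?case by (simp add: wsum_const)
  qed simp
  show ?thesis using assms(4,5)
  proof (induction bs)
    case Nil then show ?case using assms by simp
  next
    case (Cons c cs)
    show ?case
    proof (cases "c = b")
      case True
      have "dird b (\<lambda>x. h (x \<bullet> (r *\<^sub>R b) + a)) = (\<lambda>x. r * dird 1 h (x \<bullet> (r *\<^sub>R b) + a))"
        by (rule ext) (use assms in \<open>simp only: smooth_fun_ridge(2), simp\<close>)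
      moreover have "wsum s cs (\<lambda>x. of_real r * dird 1 h (x \<bullet> (r *\<^sub>R b) + a)) x = cmod (of_real r * dird 1 h (x \<bullet> (r *\<^sub>R b) + a))"
        using 0[of cs "\<lambda>y. of_real r * dird 1 h y"] Cons True assms
        by (auto simp: smooth_fun_mult smooth_fun_dird)
      ultimately show ?thesis using 0[of cs h] Cons True assms by (simp add: norm_mult)
    next
      case False
      then show ?thesis using off[of c h] Cons assms by (simp add: wsum_const)
    qed
  qed
qed

section \<open>Cutoff functions adapted to dyadic cubes\<close>

text \<open>The tensor bump centred at the lattice point n / 2^l, in the form of
  \<open>smooth_fun_ridge\<close>. Lattice points are functions on \<open>Basis\<close>; later they
  are required to be extensional, so that each point has a single representative.\<close>

definition lbump :: "nat \<Rightarrow> ('a::euclidean_space \<Rightarrow> int) \<Rightarrow> 'a \<Rightarrow> complex" where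
  "lbump l n x = (\<Prod>b\<in>Basis. ubump (x \<bullet> ((2 ^ l) *\<^sub>R b) + - of_int (n b)))"

definition lcut :: "nat \<Rightarrow> ('a::euclidean_space \<Rightarrow> int) set \<Rightarrow> 'a \<Rightarrow> complex" where
  "lcut l Q x = (\<Sum>n\<in>Q. lbump l n x)"

lemma smooth_lbump: "smooth_fun (lbump l n)"
  unfolding lbump_def[abs_def] by (intro smooth_fun_prod smooth_fun_ridge(1) smooth_ubump)

lemma smooth_lcut: "smooth_fun (lcut l Q)"
  unfolding lcut_def[abs_def] by (intro smooth_fun_sum smooth_lbump)

lemma lbump_nonneg: "lbump l n x = of_real (cmod (lbump l n x))"
  unfolding lbump_def prod_norm[symmetric] of_real_prod
  by (intro prod.cong refl ubump_nonneg)

lemma lcut_nonneg: "lcut l Q x = of_real (\<Sum>n\<in>Q. cmod (lbump l n x))"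
  unfolding lcut_def of_real_sum by (intro sum.cong refl lbump_nonneg)

lemma norm_lcut: "cmod (lcut l Q x) = (\<Sum>n\<in>Q. cmod (lbump l n x))"
  unfolding lcut_nonneg norm_of_real by (intro abs_of_nonneg sum_nonneg) auto

lemma lbump_supp: "lbump l n x \<noteq> 0 \<Longrightarrow> b \<in> Basis \<Longrightarrow> \<bar>2 ^ l * (x \<bullet> b) - of_int (n b)\<bar> \<le> 1"
  using ubump_supp[of "2 ^ l * (x \<bullet> b) - of_int (n b)"] by (auto simp: lbump_def) (meson linear)

text \<open>The index set is embedded in a product set, over which a sum of products factors into
  one-dimensional sums. Each \<open>F b\<close> also holds the two translates active at x, so that
  the sum of \<open>ubump\<close> over it is 1.\<close>

lemma lcut_sum_PiE:
  fixes Q :: "('a::euclidean_space \<Rightarrow> int) set"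
  assumes "finite Q" "Q \<subseteq> extensional Basis"
  obtains F where "\<And>b. b \<in> Basis \<Longrightarrow> finite (F b)" "\<And>b. b \<in> Basis \<Longrightarrow> {\<lfloor>2 ^ l * (x \<bullet> b)\<rfloor>, \<lfloor>2 ^ l * (x \<bullet> b)\<rfloor> + 1} \<subseteq> F b"
    "Q \<subseteq> PiE Basis F"
proof
  define F where "F b = {\<lfloor>2 ^ l * (x \<bullet> b)\<rfloor>, \<lfloor>2 ^ l * (x \<bullet> b)\<rfloor> + 1} \<union> (\<lambda>n. n b) ` Q" for b
  show "finite (F b)" "{\<lfloor>2 ^ l * (x \<bullet> b)\<rfloor>, \<lfloor>2 ^ l * (x \<bullet> b)\<rfloor> + 1} \<subseteq> F b" for b using assms by (auto simp: F_def)
  show "Q \<subseteq> PiE Basis F" using assms(2) by (auto simp: F_def PiE_iff subset_iff)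
qed

text \<open>Every bump that sees x has its index in Q, so the sum may be extended to a product set,
  where it factors into one-dimensional partitions of unity.\<close>

lemma lcut_eq_1:
  fixes Q :: "('a::euclidean_space \<Rightarrow> int) set"
  assumes "finite Q" "Q \<subseteq> extensional Basis"
    and all: "\<And>n. n \<in> extensional Basis \<Longrightarrow> (\<forall>b\<in>Basis. \<bar>2 ^ l * (x \<bullet> b) - of_int (n b)\<bar> \<le> 1) \<Longrightarrow> n \<in> Q"
  shows "lcut l Q x = 1"
proof -
  obtain F where F: "\<And>b. b \<in> Basis \<Longrightarrow> finite (F b)" "\<And>b. b \<in> Basis \<Longrightarrow> {\<lfloor>2 ^ l * (x \<bullet> b)\<rfloor>, \<lfloor>2 ^ l * (x \<bullet> b)\<rfloor> + 1} \<subseteq> F b"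
    "Q \<subseteq> PiE Basis F" using lcut_sum_PiE[OF assms(1,2)] by blast
  have fin: "finite (PiE Basis F)" using F(1) by (auto intro: finite_PiE)
  have "lcut l Q x = (\<Sum>n\<in>PiE Basis F. lbump l n x)"
    unfolding lcut_def
  proof (rule sum.mono_neutral_left[OF fin F(3)], safe)
    fix n assume "n \<in> PiE Basis F" "n \<notin> Q"
    then show "lbump l n x = 0" using all[of n] lbump_supp[of l n x] by (auto simp: PiE_iff)
  qed
  also have "\<dots> = (\<Prod>b\<in>Basis. \<Sum>n\<in>F b. ubump (2 ^ l * (x \<bullet> b) - of_int n))"
    unfolding lbump_def by (subst prod_sum_PiE) (use F(1) in auto)
  also have "\<dots> = 1"
    by (intro prod.neutral ballI ubump_sum_le(2) F)
  finally show ?thesis .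
qed

text \<open>Each summand of the difference is nonnegative, so enlarging Q to the whole product set
  increases it, and there both sums factor. With f the values and g the values plus derivatives,
  this bounds the derivative part alone, whatever subset Q is.\<close>

lemma prod_sum_diff_mono:
  fixes f g :: "'a \<Rightarrow> 'b \<Rightarrow> real"
  assumes "finite A" "\<And>a. a \<in> A \<Longrightarrow> finite (F a)" "Q \<subseteq> PiE A F"
    and "\<And>a i. 0 \<le> f a i" "\<And>a i. f a i \<le> g a i"
  shows "(\<Sum>n\<in>Q. \<Prod>a\<in>A. g a (n a)) - (\<Sum>n\<in>Q. \<Prod>a\<in>A. f a (n a))
     \<le> (\<Prod>a\<in>A. \<Sum>i\<in>F a. g a i) - (\<Prod>a\<in>A. \<Sum>i\<in>F a. f a i)"
proof -
  have "(\<Sum>n\<in>Q. (\<Prod>a\<in>A. g a (n a)) - (\<Prod>a\<in>A. f a (n a)))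
     \<le> (\<Sum>n\<in>PiE A F. (\<Prod>a\<in>A. g a (n a)) - (\<Prod>a\<in>A. f a (n a)))"
    by (rule sum_mono2) (use assms in \<open>auto intro!: finite_PiE prod_mono\<close>)
  then show ?thesis
    using assms(1,2) by (simp add: sum_subtractf prod_sum_PiE)
qed

text \<open>The derivative part of \<open>lcut\<close> is at most (1 + s 2^l M)^d - 1 by
  \<open>prod_sum_diff_mono\<close>, because values sum to 1 and derivatives to at most M in each
  coordinate. The order-zero part of \<open>lcut\<close> and that of its complement are at most 1.
  So both bounds tend to 1 as s 2^l tends to 0.\<close>

lemma wsum_lcut:
  shows "\<exists>M\<ge>0. \<forall>s l Q bs (x::'a::euclidean_space). 0 \<le> s \<longrightarrow> finite Q \<longrightarrow> Q \<subseteq> extensional Basis \<longrightarrow>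
    set bs \<subseteq> Basis \<longrightarrow> distinct bs \<longrightarrow>
      wsum s bs (lcut l Q) x \<le> (1 + s * 2 ^ l * M) ^ DIM('a) \<and>
      wsum s bs (\<lambda>x. 1 - lcut l Q x) x \<le> (1 + s * 2 ^ l * M) ^ DIM('a)"
proof -
  obtain M where M: "M \<ge> 0" "\<And>F y. finite F \<Longrightarrow> (\<Sum>n\<in>F. cmod (dird 1 ubump (y - of_int n))) \<le> M"
    using dird_ubump_sum_le by blast
  show ?thesis
  proof (intro exI[of _ M] conjI allI impI M(1))
    fix s :: real and l and Q :: "('a \<Rightarrow> int) set" and bs :: "'a list" and x :: 'a
    assume s: "0 \<le> s" and Q: "finite Q" "Q \<subseteq> extensional Basis" and bs: "set bs \<subseteq> Basis" "distinct bs"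
    obtain F where F: "\<And>b. b \<in> Basis \<Longrightarrow> finite (F b)" "\<And>b. b \<in> Basis \<Longrightarrow> {\<lfloor>2 ^ l * (x \<bullet> b)\<rfloor>, \<lfloor>2 ^ l * (x \<bullet> b)\<rfloor> + 1} \<subseteq> F b"
      "Q \<subseteq> PiE Basis F" using lcut_sum_PiE[OF Q] by blast
    define f where "f b i = cmod (ubump (2 ^ l * (x \<bullet> b) - of_int i))" for b i
    define g where "g b i = f b i + s * 2 ^ l * cmod (dird 1 ubump (2 ^ l * (x \<bullet> b) - of_int i))" for b i
    have Ff: "(\<Sum>i\<in>F b. f b i) = 1" if "b \<in> Basis" for b
    proof -
      have "complex_of_real (\<Sum>i\<in>F b. f b i) = (\<Sum>i\<in>F b. ubump (2 ^ l * (x \<bullet> b) - of_int i))"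
        unfolding f_def of_real_sum by (intro sum.cong refl ubump_nonneg[symmetric])
      also have "\<dots> = 1" by (intro ubump_sum_le(2) F that)
      finally show ?thesis by (metis of_real_eq_1_iff)
    qed
    have Fg: "(\<Sum>i\<in>F b. g b i) \<le> 1 + s * 2 ^ l * M" if "b \<in> Basis" for b
      unfolding g_def sum.distrib Ff[OF that] sum_distrib_left[symmetric]
      using s by (intro add_left_mono mult_left_mono M F that) auto
    have fg: "0 \<le> f b i" "f b i \<le> g b i" for b i using s by (auto simp: f_def g_def)
    have "(\<Sum>n\<in>Q. \<Prod>b\<in>Basis. g b (n b)) - (\<Sum>n\<in>Q. \<Prod>b\<in>Basis. f b (n b))
        \<le> (\<Prod>b\<in>Basis. \<Sum>i\<in>F b. g b i) - (\<Prod>b\<in>Basis. \<Sum>i\<in>F b. f b i)"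
      by (intro prod_sum_diff_mono F fg) auto
    also have "\<dots> \<le> (\<Prod>b\<in>(Basis::'a set). 1 + s * 2 ^ l * M) - 1"
      using order_trans[OF fg] Fg by (intro diff_mono prod_mono) (auto simp: Ff intro!: sum_nonneg)
    finally have 1: "(\<Sum>n\<in>Q. \<Prod>b\<in>Basis. g b (n b)) - (\<Sum>n\<in>Q. \<Prod>b\<in>Basis. f b (n b)) \<le> (1 + s * 2 ^ l * M) ^ DIM('a) - 1"
      by simp
    have f: "(\<Sum>n\<in>Q. \<Prod>b\<in>Basis. f b (n b)) = cmod (lcut l Q x)"
      unfolding norm_lcut by (simp add: lbump_def f_def prod_norm)
    have "wsum s bs (lbump l n) x \<le> (\<Prod>b\<in>Basis. g b (n b))" for n :: "'a \<Rightarrow> int"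
    proof -
      have "wsum s bs (lbump l n) x \<le> (\<Prod>b\<in>Basis. wsum s bs (\<lambda>x. ubump (x \<bullet> ((2 ^ l) *\<^sub>R b) + - of_int (n b))) x)"
        unfolding lbump_def[abs_def] by (intro wsum_prod s smooth_fun_ridge(1) smooth_ubump) auto
      also have "\<dots> \<le> (\<Prod>b\<in>Basis. g b (n b))"
      proof (intro prod_mono conjI wsum_nonneg s)
        fix b :: 'a assume "b \<in> Basis"
        from wsum_ridge[OF s _ this bs smooth_ubump, of "2 ^ l" "- of_int (n b)" x]
        show "wsum s bs (\<lambda>x. ubump (x \<bullet> ((2 ^ l) *\<^sub>R b) + - of_int (n b))) x \<le> g b (n b)"
          by (simp add: g_def f_def)
      qed
      finally show ?thesis .
    qed
    then have 2: "wsum s bs (lcut l Q) x \<le> (\<Sum>n\<in>Q. \<Prod>b\<in>Basis. g b (n b))"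
      unfolding lcut_def[abs_def]
      by (intro order_trans[OF wsum_sum[OF s Q(1) smooth_lbump]] sum_mono)
    have le1: "cmod (lcut l Q x) \<le> 1"
    proof -
      have "(\<Sum>n\<in>Q. \<Prod>b\<in>Basis. f b (n b)) \<le> (\<Sum>n\<in>PiE Basis F. \<Prod>b\<in>Basis. f b (n b))"
        using F fg by (intro sum_mono2 finite_PiE prod_nonneg) auto
      also have "\<dots> = (\<Prod>b\<in>Basis. \<Sum>i\<in>F b. f b i)" by (rule prod_sum_PiE[symmetric]) (use F in auto)
      also have "\<dots> = 1" by (intro prod.neutral ballI Ff)
      finally show ?thesis using f by simp
    qed
    show "wsum s bs (lcut l Q) x \<le> (1 + s * 2 ^ l * M) ^ DIM('a)" using 1 2 f le1 by linarith
    \<comment> \<open>\<open>lcut\<close> is real with values in [0, 1].\<close>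
    have "cmod (1 - lcut l Q x) = 1 - cmod (lcut l Q x)"
    proof -
      obtain r where r: "lcut l Q x = of_real r" "r \<ge> 0"
        using lcut_nonneg[of l Q x] by (metis norm_lcut norm_ge_zero)
      have "cmod (1 - complex_of_real r) = \<bar>1 - r\<bar>" by (metis norm_of_real of_real_1 of_real_diff)
      then show ?thesis using r le1 by simp
    qed
    then show "wsum s bs (\<lambda>x. 1 - lcut l Q x) x \<le> (1 + s * 2 ^ l * M) ^ DIM('a)"
      using 1 2 f norm_ge_zero[of "lcut l Q x"] wsum_one_minus[OF smooth_lcut, of s bs l Q x] by linarith
  qed
qed

lemma wsum_lcut_prod:
  shows "\<exists>C\<ge>0. \<forall>k Q bs (x::'a::euclidean_space). (\<forall>l. finite (Q l) \<and> Q l \<subseteq> extensional Basis) \<longrightarrow>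
    set bs \<subseteq> Basis \<longrightarrow> distinct bs \<longrightarrow>
      wsum (1 / 2 ^ k) bs (\<lambda>x. lcut k (Q k) x * (\<Prod>l<k. 1 - lcut l (Q l) x)) x \<le> C"
proof -
  obtain M where M: "M \<ge> 0" and M': "\<And>s l Q bs (x::'a). 0 \<le> s \<Longrightarrow> finite Q \<Longrightarrow> Q \<subseteq> extensional Basis \<Longrightarrow>
    set bs \<subseteq> Basis \<Longrightarrow> distinct bs \<Longrightarrow>
      wsum s bs (lcut l Q) x \<le> (1 + s * 2 ^ l * M) ^ DIM('a) \<and>
      wsum s bs (\<lambda>x. 1 - lcut l Q x) x \<le> (1 + s * 2 ^ l * M) ^ DIM('a)"
    using wsum_lcut[where 'a='a] by blast
  show ?thesis
  \<comment> \<open>The power of 1 + M comes from the cutoff of scale k itself. The complement of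
    scale l < k contributes at most exp (d M 2^(l-k)), and these exponents sum to less than d M when
    M > 0.\<close>
  proof (intro exI[of _ "(1 + M) ^ DIM('a) * exp (M * DIM('a))"] conjI allI impI)
    fix k and bs :: "'a list" and Q :: "nat \<Rightarrow> ('a \<Rightarrow> int) set" and x :: 'a
    assume Q: "\<forall>l. finite (Q l) \<and> Q l \<subseteq> extensional Basis" and bs: "set bs \<subseteq> Basis" "distinct bs"
    let ?s = "1 / 2 ^ k :: real"
    have "wsum ?s bs (\<lambda>x. \<Prod>l<k. 1 - lcut l (Q l) x) x \<le> (\<Prod>l<k. wsum ?s bs (\<lambda>x. 1 - lcut l (Q l) x) x)"
      by (intro wsum_prod smooth_fun_diff smooth_lcut) auto
    also have "\<dots> \<le> (\<Prod>l<k. exp (real DIM('a) * (?s * 2 ^ l * M)))"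
    proof (intro prod_mono conjI wsum_nonneg)
      fix l
      have "wsum ?s bs (\<lambda>x. 1 - lcut l (Q l) x) x \<le> (1 + ?s * 2 ^ l * M) ^ DIM('a)"
        using M'[of ?s "Q l" bs l x] Q bs by simp
      also have "\<dots> \<le> exp (?s * 2 ^ l * M) ^ DIM('a)"
        using M by (intro power_mono exp_ge_add_one_self add_nonneg_nonneg) auto
      finally show "wsum ?s bs (\<lambda>x. 1 - lcut l (Q l) x) x \<le> exp (real DIM('a) * (?s * 2 ^ l * M))"
        by (simp only: exp_of_nat_mult)
    qed auto
    also have "\<dots> = exp (\<Sum>l<k. real DIM('a) * (?s * 2 ^ l * M))" by (simp add: exp_sum)
    also have "\<dots> \<le> exp (M * DIM('a))"
    proof -
      have "(\<Sum>l<k. real DIM('a) * (?s * 2 ^ l * M)) = real DIM('a) * M * (?s * (\<Sum>l<k. 2 ^ l))"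
        unfolding sum_distrib_left by (intro sum.cong) auto
      also have "(\<Sum>l<k. 2 ^ l :: real) = 2 ^ k - 1" by (induction k) auto
      also have "real DIM('a) * M * (?s * (2 ^ k - 1)) \<le> real DIM('a) * M * 1"
        using M by (intro mult_left_mono) (auto simp: field_simps)
      finally show ?thesis by (simp add: mult.commute)
    qed
    finally have P: "wsum ?s bs (\<lambda>x. \<Prod>l<k. 1 - lcut l (Q l) x) x \<le> exp (M * DIM('a))" .
    have E: "wsum ?s bs (lcut k (Q k)) x \<le> (1 + M) ^ DIM('a)"
      using M'[of ?s "Q k" bs k x] Q bs by simp
    have "wsum ?s bs (\<lambda>x. lcut k (Q k) x * (\<Prod>l<k. 1 - lcut l (Q l) x)) x
        \<le> wsum ?s bs (lcut k (Q k)) x * wsum ?s bs (\<lambda>x. \<Prod>l<k. 1 - lcut l (Q l) x) x"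
      by (intro wsum_mult smooth_fun_prod smooth_fun_diff smooth_lcut) auto
    also have "\<dots> \<le> (1 + M) ^ DIM('a) * exp (M * DIM('a))"
      using M by (intro mult_mono P E wsum_nonneg) auto
    finally show "wsum ?s bs (\<lambda>x. lcut k (Q k) x * (\<Prod>l<k. 1 - lcut l (Q l) x)) x
       \<le> (1 + M) ^ DIM('a) * exp (M * DIM('a))" .
  qed (use M in auto)
qed


section \<open>Lebesgue integrals on Euclidean space\<close>

lemma nn_integral_lborel_affine:
  fixes f :: "'a::euclidean_space \<Rightarrow> ennreal"
  assumes [measurable]: "f \<in> borel_measurable borel" and c: "c \<noteq> 0"
  shows "(\<integral>\<^sup>+x. f x \<partial>lborel) = ennreal (\<bar>c\<bar> ^ DIM('a)) * (\<integral>\<^sup>+x. f (t + c *\<^sub>R x) \<partial>lborel)"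
  by (subst lborel_affine[OF c, of t])
     (simp add: nn_integral_density nn_integral_distr nn_integral_cmult)

lemma integral_lborel_affine:
  fixes f :: "'a::euclidean_space \<Rightarrow> 'b::{banach, second_countable_topology}"
  assumes [measurable]: "f \<in> borel_measurable borel" and c: "c \<noteq> 0"
  shows "(\<integral>x. f x \<partial>lborel) = (\<bar>c\<bar> ^ DIM('a)) *\<^sub>R (\<integral>x. f (t + c *\<^sub>R x) \<partial>lborel)"
  by (subst lborel_affine[OF c, of t]) (simp add: integral_density integral_distr)

lemma integrable_lborel_affine:
  fixes f :: "'a::euclidean_space \<Rightarrow> 'b::{banach, second_countable_topology}"
  assumes "integrable lborel f" and c: "c \<noteq> 0"
  shows "integrable lborel (\<lambda>x. f (t + c *\<^sub>R x))"
proof -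
  have [measurable]: "f \<in> borel_measurable borel" using assms by auto
  have "(\<integral>\<^sup>+x. norm (f x) \<partial>lborel) < \<infinity>" using assms by (simp add: integrable_iff_bounded)
  then show ?thesis
    using nn_integral_lborel_affine[of "\<lambda>x. ennreal (norm (f x))" c t] c
    by (auto simp: integrable_iff_bounded ennreal_mult_less_top)
qed

lemma integral_lborel_prod:
  fixes f :: "'a::euclidean_space \<Rightarrow> real \<Rightarrow> 'b::{real_normed_field, banach, second_countable_topology}"
  assumes "\<And>b. b \<in> Basis \<Longrightarrow> integrable lborel (f b)"
  shows "(\<integral>x. (\<Prod>b\<in>Basis. f b (x \<bullet> b)) \<partial>lborel) = (\<Prod>b\<in>Basis. (\<integral>t. f b t \<partial>lborel))"
    and "integrable lborel (\<lambda>x::'a. \<Prod>b\<in>Basis. f b (x \<bullet> b))"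
proof -
  interpret product_sigma_finite "\<lambda>_::'a. lborel :: real measure" by standard
  have [measurable]: "\<And>b. b \<in> Basis \<Longrightarrow> f b \<in> borel_measurable borel" using assms by auto
  have e: "(\<Prod>b\<in>Basis. f b ((\<Sum>b\<in>Basis. g b *\<^sub>R b) \<bullet> b)) = (\<Prod>b\<in>Basis. f b (g b))" for g
    by (intro prod.cong) auto
  show "(\<integral>x. (\<Prod>b\<in>Basis. f b (x \<bullet> b)) \<partial>lborel) = (\<Prod>b\<in>Basis. (\<integral>t. f b t \<partial>lborel))"
    by (subst lborel_eq, subst integral_distr) (simp_all add: e product_integral_prod assms)
  show "integrable lborel (\<lambda>x::'a. \<Prod>b\<in>Basis. f b (x \<bullet> b))"
    by (subst lborel_eq, subst integrable_distr_eq) (simp_all add: e product_integrable_prod assms)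
qed

section \<open>Smooth functions of bounded support and the integrals of their derivatives\<close>

lemma integrable_continuous_bounded_support:
  fixes f :: "'a::euclidean_space \<Rightarrow> 'b::{banach, second_countable_topology}"
  assumes "continuous_on UNIV f" "bounded {x. f x \<noteq> 0}"
  shows "integrable lborel f"
proof -
  obtain R where R: "{x. f x \<noteq> 0} \<subseteq> cball 0 R"
    using assms(2) by (auto simp: bounded_iff subset_iff)
  have "integrable lborel (\<lambda>x. indicator (cball 0 R) x *\<^sub>R f x)"
    by (intro borel_integrable_compact compact_cball continuous_on_subset[OF assms(1)]) auto
  moreover have "(\<lambda>x. indicator (cball 0 R) x *\<^sub>R f x) = f"
    using R by (intro ext) (auto simp: indicator_def subset_iff)
  ultimately show ?thesis by simp
qed

text \<open>In a Euclidean space a bounded nonvanishing set is the same as compact support, and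
  boundedness passes to products and sums without taking closures.\<close>

definition test_fun :: "('a::euclidean_space \<Rightarrow> complex) \<Rightarrow> bool" where
  "test_fun f \<longleftrightarrow> smooth_fun f \<and> bounded {x. f x \<noteq> 0}"

lemma dird_outside: "x \<notin> closure {x. f x \<noteq> 0} \<Longrightarrow> dird v f x = 0"
  by (rule dird_zero_on[of "- closure {x. f x \<noteq> 0}"]) (use closure_subset[of "{x. f x \<noteq> 0}"] in auto)

lemma test_fun_dird: "test_fun f \<Longrightarrow> test_fun (dird v f)"
  unfolding test_fun_def
  using bounded_subset[OF bounded_closure[of "{x. f x \<noteq> 0}"], of "{x. dird v f x \<noteq> 0}"] dird_outside[of _ f v]
  by (auto intro: smooth_fun_dird)

lemma test_fun_mult: "test_fun f \<Longrightarrow> smooth_fun g \<Longrightarrow> test_fun (\<lambda>x. f x * g x)"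
  unfolding test_fun_def by (auto intro: smooth_fun_mult elim!: bounded_subset)

lemma test_fun_add: "test_fun f \<Longrightarrow> test_fun g \<Longrightarrow> test_fun (\<lambda>x. f x + g x)"
  unfolding test_fun_def
  by (auto intro!: smooth_fun_add intro: bounded_subset[of "{x. f x \<noteq> 0} \<union> {x. g x \<noteq> 0}"])

lemma test_fun_cmult: "test_fun f \<Longrightarrow> test_fun (\<lambda>x. c * f x)"
  using test_fun_mult[of f "\<lambda>_. c"] by (simp add: mult.commute)

lemma test_fun_bessel_op: "test_fun f \<Longrightarrow> test_fun (bessel_op s bs f)"
  by (induction bs arbitrary: f) (auto simp: test_fun_add test_fun_cmult test_fun_dird)

lemma test_fun_integrable: "test_fun f \<Longrightarrow> integrable lborel f"
  unfolding test_fun_def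
  by (auto intro: integrable_continuous_bounded_support smooth_fun_continuous_on)

lemma test_fun_borel: "test_fun f \<Longrightarrow> f \<in> borel_measurable borel"
  by (simp add: test_fun_def smooth_fun_borel)

lemma test_fun_bounded:
  assumes "test_fun f" shows "\<exists>B. \<forall>x. cmod (f x) \<le> B"
proof -
  have f: "smooth_fun f" "bounded {x. f x \<noteq> 0}" using assms by (auto simp: test_fun_def)
  have "compact (f ` closure {x. f x \<noteq> 0})"
    using f by (intro compact_continuous_image smooth_fun_continuous_on) (auto simp: compact_closure)
  then obtain B where "\<forall>x\<in>closure {x. f x \<noteq> 0}. cmod (f x) \<le> B"
    by (auto dest!: compact_imp_bounded simp: bounded_iff)
  then have "cmod (f x) \<le> max B 0" for x
    using closure_subset[of "{x. f x \<noteq> 0}"] by (cases "f x = 0") (auto intro: max.coboundedI1)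
  then show ?thesis by blast
qed

lemma has_vector_derivative_line:
  assumes "smooth_fun f"
  shows "((\<lambda>t. f (x + t *\<^sub>R v)) has_vector_derivative dird v f (x + t *\<^sub>R v)) (at t)"
proof -
  have "((\<lambda>t. f (x + t *\<^sub>R v)) has_derivative (\<lambda>s. dird (s *\<^sub>R v) f (x + t *\<^sub>R v))) (at t)"
    by (rule has_derivative_compose[where f="\<lambda>t::real. x + t *\<^sub>R v" and g=f])
       (use smooth_fun_has_derivative[OF assms] in \<open>auto intro!: derivative_eq_intros\<close>)
  moreover have "dird (s *\<^sub>R v) f y = s *\<^sub>R dird v f y" for s y
    using linear_cmul[OF has_derivative_linear[OF smooth_fun_has_derivative[OF assms]]] by blast
  ultimately show ?thesis by (simp add: has_vector_derivative_def)
qed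

lemma integral_translate:
  fixes f :: "'a::euclidean_space \<Rightarrow> 'b::{banach, second_countable_topology}"
  assumes "f \<in> borel_measurable borel"
  shows "(\<integral>x. f (x + t) \<partial>lborel) = (\<integral>x. f x \<partial>lborel)"
  using integral_lborel_affine[OF assms, of 1 t] by (simp add: add.commute)

text \<open>Difference quotients have integral zero by translation invariance; pass to the limit.\<close>

lemma integral_dird:
  fixes f :: "'a::euclidean_space \<Rightarrow> complex"
  assumes "test_fun f"
  shows "(\<integral>x. dird v f x \<partial>lborel) = 0"
proof -
  have sm: "smooth_fun f" using assms by (simp add: test_fun_def)
  have [measurable]: "f \<in> borel_measurable borel" "dird v f \<in> borel_measurable borel"
    using assms test_fun_borel test_fun_dird by blast+
  obtain B where B: "\<And>x. cmod (dird v f x) \<le> B" using test_fun_bounded[OF test_fun_dird[OF assms]] by blast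
  obtain R where R: "\<And>x. f x \<noteq> 0 \<Longrightarrow> norm x \<le> R" using assms by (auto simp: test_fun_def bounded_iff)
  define q where "q n x = of_nat (Suc n) * (f (x + (1 / real (Suc n)) *\<^sub>R v) - f x)" for n x
  \<comment> \<open>The mean value inequality along the line bounds all difference quotients by the
    supremum of the derivative, which serves as the dominating constant.\<close>
  have lip: "cmod (q n x) \<le> B" for n x
  proof -
    let ?t = "1 / real (Suc n)"
    have "cmod (f (x + ?t *\<^sub>R v) - f (x + 0 *\<^sub>R v)) \<le> B * norm (?t - 0)"
    proof (rule differentiable_bound[where S=UNIV and f="\<lambda>t. f (x + t *\<^sub>R v)" and f'="\<lambda>t s. s *\<^sub>R dird v f (x + t *\<^sub>R v)"])
      show "((\<lambda>t. f (x + t *\<^sub>R v)) has_derivative (\<lambda>s. s *\<^sub>R dird v f (x + t *\<^sub>R v))) (at t within UNIV)" for t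
        using has_vector_derivative_line[OF sm, of x v t] by (simp add: has_vector_derivative_def)
      show "onorm (\<lambda>s. s *\<^sub>R dird v f (x + t *\<^sub>R v)) \<le> B" for t
      proof (rule onorm_le)
        show "norm (s *\<^sub>R dird v f (x + t *\<^sub>R v)) \<le> B * norm s" for s
          using mult_left_mono[OF B[of "x + t *\<^sub>R v"], of "\<bar>s\<bar>"] by (simp add: mult.commute)
      qed
    qed auto
    then have "real (Suc n) * cmod (f (x + ?t *\<^sub>R v) - f x) \<le> real (Suc n) * (B * ?t)"
      by (intro mult_left_mono) auto
    then show ?thesis by (simp add: q_def norm_mult del: of_nat_Suc)
  qed
  have B0: "B \<ge> 0" using B[of 0] norm_ge_zero order_trans by blast
  have "(\<lambda>n. \<integral>x. q n x \<partial>lborel) \<longlonglongrightarrow> (\<integral>x. dird v f x \<partial>lborel)"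
  proof (rule integral_dominated_convergence)
    \<comment> \<open>The increments have norm at most that of v, so this enlarged ball contains the
      supports of all the quotients.\<close>
    show "integrable lborel (\<lambda>x::'a. indicator (cball 0 (R + norm v)) x *\<^sub>R B)"
      by (intro borel_integrable_compact) auto
    show "AE x in lborel. norm (q n x) \<le> indicator (cball 0 (R + norm v)) x *\<^sub>R B" for n
    proof (rule AE_I2)
      fix x
      show "norm (q n x) \<le> indicator (cball 0 (R + norm v)) x *\<^sub>R B"
      proof (cases "x \<in> cball 0 (R + norm v)")
        case True then show ?thesis using lip by simp
      next
        case False
        then have x: "norm x > R + norm v" by simp
        have "norm ((1 / real (Suc n)) *\<^sub>R v) \<le> norm v"
          by (simp add: field_simps mult_left_le_one_le)
        then have "norm (x + (1 / real (Suc n)) *\<^sub>R v) > R"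
          using x norm_diff_ineq[of x "(1 / real (Suc n)) *\<^sub>R v"] by linarith
        then have "f (x + (1 / real (Suc n)) *\<^sub>R v) = 0" "f x = 0"
          using R x norm_ge_zero[of v] by (metis not_le, smt (verit))
        then show ?thesis using B0 by (simp add: q_def indicator_def)
      qed
    qed
    show "AE x in lborel. (\<lambda>n. q n x) \<longlonglongrightarrow> dird v f x"
    proof (rule AE_I2)
      fix x
      have "((\<lambda>y. (1 / \<bar>y\<bar>) *\<^sub>R (f (x + y *\<^sub>R v) - (f x + y *\<^sub>R dird v f x))) \<longlongrightarrow> 0) (at 0)"
        using has_vector_derivative_line[OF sm, of x v 0]
        by (simp add: has_vector_derivative_def has_derivative_at2)
      then have "((\<lambda>y. norm ((1 / \<bar>y\<bar>) *\<^sub>R (f (x + y *\<^sub>R v) - (f x + y *\<^sub>R dird v f x)))) \<longlongrightarrow> 0) (at 0)"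
        by (intro tendsto_norm_zero)
      then have "((\<lambda>y. norm ((f (x + y *\<^sub>R v) - f x) /\<^sub>R y - dird v f x)) \<longlongrightarrow> 0) (at 0)"
      proof (rule Lim_transform_eventually)
        have "norm ((1 / \<bar>y\<bar>) *\<^sub>R (f (x + y *\<^sub>R v) - (f x + y *\<^sub>R dird v f x))) = norm ((f (x + y *\<^sub>R v) - f x) /\<^sub>R y - dird v f x)"
          if "y \<noteq> 0" for y
        proof -
          have "(f (x + y *\<^sub>R v) - f x) /\<^sub>R y - dird v f x = (1 / y) *\<^sub>R (f (x + y *\<^sub>R v) - (f x + y *\<^sub>R dird v f x))"
            using that by (simp add: algebra_simps divide_inverse)
          then show ?thesis by simp
        qed
        then show "\<forall>\<^sub>F y in at 0. norm ((1 / \<bar>y\<bar>) *\<^sub>R (f (x + y *\<^sub>R v) - (f x + y *\<^sub>R dird v f x))) = norm ((f (x + y *\<^sub>R v) - f x) /\<^sub>R y - dird v f x)"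
          by (simp add: eventually_at_filter)
      qed
      then have "((\<lambda>t. (f (x + t *\<^sub>R v) - f x) /\<^sub>R t) \<longlongrightarrow> dird v f x) (at 0)"
        by (rule LIM_zero_cancel[OF tendsto_norm_zero_cancel])
      then have "(\<lambda>n. (f (x + (1 / real (Suc n)) *\<^sub>R v) - f x) /\<^sub>R (1 / real (Suc n))) \<longlonglongrightarrow> dird v f x"
        by (rule filterlim_compose) (use LIMSEQ_Suc[OF lim_1_over_n] in \<open>auto simp: filterlim_at\<close>)
      then show "(\<lambda>n. q n x) \<longlonglongrightarrow> dird v f x"
        by (simp add: q_def scaleR_conv_of_real)
    qed
    show "q n \<in> borel_measurable lborel" for n unfolding q_def by measurable
  qed auto
  moreover have "(\<integral>x. q n x \<partial>lborel) = 0" for n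
  proof -
    have i: "integrable lborel f" by (rule test_fun_integrable[OF assms])
    have i': "integrable lborel (\<lambda>x. f (x + t))" for t
      using integrable_lborel_affine[OF i, of 1 t] by (simp add: add.commute)
    show ?thesis unfolding q_def using i i' by (simp add: integral_translate)
  qed
  ultimately show ?thesis by (simp add: LIMSEQ_const_iff)
qed

section \<open>The Fourier transform of test functions\<close>

lemma borel_measurable_cis [measurable]: "cis \<in> borel_measurable borel"
  by (intro borel_measurable_continuous_onI continuous_intros continuous_on_cis)

lemma inv_fourier_lborel:
  fixes f :: "'a::euclidean_space \<Rightarrow> complex"
  assumes [measurable]: "f \<in> borel_measurable borel"
  shows "inv_fourier f \<xi> = (\<integral>x. f x * cis (x \<bullet> \<xi>) \<partial>lborel)"
  unfolding inv_fourier_def by (rule integral_completion) measurable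

lemma integrable_mult_cis:
  fixes f :: "'a::euclidean_space \<Rightarrow> complex"
  assumes "integrable lborel f"
  shows "integrable lborel (\<lambda>x. f x * cis (x \<bullet> \<xi>))"
proof (rule Bochner_Integration.integrable_bound[OF assms])
  have [measurable]: "f \<in> borel_measurable borel" using assms by auto
  show "(\<lambda>x. f x * cis (x \<bullet> \<xi>)) \<in> borel_measurable lborel" by measurable
qed (auto simp: norm_mult)

lemma inv_fourier_add:
  assumes "integrable lborel f" "integrable lborel g"
  shows "inv_fourier (\<lambda>x. f x + g x) \<xi> = inv_fourier f \<xi> + inv_fourier g \<xi>"
proof -
  have [measurable]: "f \<in> borel_measurable borel" "g \<in> borel_measurable borel" using assms by auto
  show ?thesis
    using assms by (simp add: inv_fourier_lborel distrib_right integrable_mult_cis)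
qed

lemma norm_inv_fourier_le:
  assumes "integrable lborel f"
  shows "cmod (inv_fourier f \<xi>) \<le> (\<integral>x. cmod (f x) \<partial>lborel)"
proof -
  have [measurable]: "f \<in> borel_measurable borel" using assms by auto
  have "cmod (\<integral>x. f x * cis (x \<bullet> \<xi>) \<partial>lborel) \<le> (\<integral>x. cmod (f x * cis (x \<bullet> \<xi>)) \<partial>lborel)"
    by (rule integral_norm_bound)
  then show ?thesis by (simp add: inv_fourier_lborel norm_mult)
qed

lemma borel_measurable_inv_fourier:
  assumes [measurable]: "f \<in> borel_measurable borel"
  shows "inv_fourier f \<in> borel_measurable borel"
proof -
  have "(\<lambda>\<xi>. \<integral>x. f x * cis (x \<bullet> \<xi>) \<partial>lborel) \<in> borel_measurable borel" by measurable
  moreover have "inv_fourier f = (\<lambda>\<xi>. \<integral>x. f x * cis (x \<bullet> \<xi>) \<partial>lborel)"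
    by (rule ext) (simp add: inv_fourier_lborel)
  ultimately show ?thesis by simp
qed

text \<open>Integration by parts: the derivative of f times the character has integral zero. The
  sign reflects the kernel exp (i (x, \<xi>)).\<close>

lemma inv_fourier_dird:
  fixes f :: "'a::euclidean_space \<Rightarrow> complex"
  assumes "test_fun f"
  shows "inv_fourier (dird v f) \<xi> = - \<i> * (v \<bullet> \<xi>) * inv_fourier f \<xi>"
proof -
  have sm: "smooth_fun f" using assms by (simp add: test_fun_def)
  let ?e = "\<lambda>x. cis (x \<bullet> \<xi> + 0)"
  have e: "smooth_fun ?e" by (rule smooth_fun_ridge(1)[OF smooth_fun_cis])
  have c: "dird 1 cis t = \<i> * cis t" for t
  proof -
    have "(cis has_derivative (\<lambda>v. v *\<^sub>R (\<i> * cis t))) (at t)" by (auto intro!: derivative_eq_intros)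
    then show ?thesis by (simp add: dird_eqI)
  qed
  have de: "dird v ?e x = (v \<bullet> \<xi>) * (\<i> * ?e x)" for x
    using smooth_fun_ridge(2)[OF smooth_fun_cis, of v \<xi> 0 x] c by simp
  have "0 = (\<integral>x. dird v (\<lambda>x. f x * ?e x) x \<partial>lborel)"
    by (rule integral_dird[symmetric]) (intro test_fun_mult assms e)
  also have "\<dots> = (\<integral>x. (\<i> * (v \<bullet> \<xi>)) * (f x * ?e x) + dird v f x * ?e x \<partial>lborel)"
    by (intro Bochner_Integration.integral_cong) (simp_all only: dird_mult[OF sm e] de, simp add: algebra_simps)
  also have "\<dots> = (\<i> * (v \<bullet> \<xi>)) * inv_fourier f \<xi> + inv_fourier (dird v f) \<xi>"
    using integrable_mult_cis[OF test_fun_integrable[OF assms]] integrable_mult_cis[OF test_fun_integrable[OF test_fun_dird[OF assms]]]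
    by (simp add: inv_fourier_lborel test_fun_borel test_fun_dird assms)
  finally show ?thesis by (simp add: eq_neg_iff_add_eq_0 add.commute)
qed

lemma inv_fourier_bessel_op:
  fixes f :: "'a::euclidean_space \<Rightarrow> complex"
  assumes "test_fun f"
  shows "inv_fourier (bessel_op s bs f) \<xi> = (\<Prod>b\<leftarrow>bs. 1 - \<i> * of_real (s * (b \<bullet> \<xi>))) * inv_fourier f \<xi>"
  using assms
proof (induction bs arbitrary: f)
  case (Cons b bs)
  have t: "test_fun (\<lambda>x. of_real s * dird b f x)" by (intro test_fun_cmult test_fun_dird Cons.prems)
  have "inv_fourier (\<lambda>x. of_real s * dird b f x) \<xi> = of_real s * inv_fourier (dird b f) \<xi>"
    unfolding inv_fourier_def by (simp add: mult.assoc)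
  then have "inv_fourier (\<lambda>x. f x + of_real s * dird b f x) \<xi> = (1 - \<i> * of_real (s * (b \<bullet> \<xi>))) * inv_fourier f \<xi>"
    using Cons.prems t by (simp add: inv_fourier_add test_fun_integrable inv_fourier_dird algebra_simps)
  moreover have "test_fun (\<lambda>x. f x + of_real s * dird b f x)"
    by (intro test_fun_add Cons.prems t)
  ultimately show ?case using Cons.IH by (simp add: mult.assoc mult.left_commute)
qed simp


section \<open>Gaussian regularisation and the Bessel inequality\<close>

text \<open>It tends to 1 as e tends to 0 and so acts as a convergence factor; its Fourier transform
  is a multiple of \<open>gauss (1 / e)\<close>, a kernel that concentrates at 0.\<close>

definition gauss :: "real \<Rightarrow> 'a::euclidean_space \<Rightarrow> real" where
  "gauss e x = exp (- (e\<^sup>2 * (x \<bullet> x)) / 2)"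

lemma gauss_prod: "gauss e x = (\<Prod>b\<in>Basis. exp (- ((e * (x \<bullet> b))\<^sup>2) / 2))"
proof -
  have "- (e\<^sup>2 * (x \<bullet> x)) / 2 = (\<Sum>b\<in>Basis. - ((e * (x \<bullet> b))\<^sup>2) / 2)"
    by (subst euclidean_inner) (simp add: sum_distrib_left sum_negf sum_divide_distrib power2_eq_square algebra_simps)
  then show ?thesis unfolding gauss_def by (simp only: exp_sum[OF finite_Basis])
qed

lemma gauss_nonneg [simp]: "0 \<le> gauss e x" and gauss_le_1: "gauss e x \<le> 1"
  by (auto simp: gauss_def)

lemma gauss_uminus: "gauss e (- x) = gauss e x"
  by (simp add: gauss_def)

lemma borel_measurable_gauss [measurable]: "gauss e \<in> borel_measurable borel"
  unfolding gauss_def[abs_def] by measurable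

lemma borel_measurable_cnj [measurable]: "cnj \<in> borel_measurable borel"
  by (intro borel_measurable_continuous_onI continuous_intros)

lemma cis_inner_prod:
  fixes z \<xi> :: "'a::euclidean_space"
  shows "cis (z \<bullet> \<xi>) = (\<Prod>b\<in>Basis. cis ((z \<bullet> b) * (\<xi> \<bullet> b)))"
  by (subst euclidean_inner) (simp add: cis_conv_exp exp_sum sum_distrib_left)

text \<open>The substitution of e x for x reduces both claims to the characteristic function of the
  standard normal distribution.\<close>

lemma gauss_fourier_1:
  fixes e t :: real
  assumes "e > 0"
  shows "integrable lborel (\<lambda>x. cis (t * x) * complex_of_real (exp (- ((e * x)\<^sup>2) / 2)))"
    and "(\<integral>x. cis (t * x) * complex_of_real (exp (- ((e * x)\<^sup>2) / 2)) \<partial>lborel)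
      = complex_of_real (sqrt (2 * pi) / e * exp (- ((t / e)\<^sup>2) / 2))"
proof -
  have i1: "integrable lborel (\<lambda>x::real. exp (- (x\<^sup>2) / 2))"
    using integrable_mult_right[OF integrable_normal_density[of 1 0], of "sqrt (2 * pi)"]
    by (simp add: std_normal_density_def)
  have i2: "integrable lborel (\<lambda>x. cis (t * x) * complex_of_real (exp (- (x\<^sup>2) / 2)))" for t
    by (rule Bochner_Integration.integrable_bound[OF i1]) (auto simp: norm_mult)
  have n: "(\<integral>x. cis (t * x) * complex_of_real (exp (- (x\<^sup>2) / 2)) \<partial>lborel) = complex_of_real (sqrt (2 * pi) * exp (- (t\<^sup>2) / 2))" for t
  proof -
    have "char std_normal_distribution t = (\<integral>x. std_normal_density x *\<^sub>R iexp (t * x) \<partial>lborel)"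
      unfolding char_def by (subst integral_density) auto
    also have "\<dots> = (\<integral>x. complex_of_real (1 / sqrt (2 * pi)) * (cis (t * x) * complex_of_real (exp (- (x\<^sup>2) / 2))) \<partial>lborel)"
      by (intro Bochner_Integration.integral_cong)
         (auto simp: std_normal_density_def scaleR_conv_of_real cis_conv_exp)
    also have "\<dots> = complex_of_real (1 / sqrt (2 * pi)) * (\<integral>x. cis (t * x) * complex_of_real (exp (- (x\<^sup>2) / 2)) \<partial>lborel)"
      by (rule integral_mult_right_zero)
    finally show ?thesis
      by (simp add: char_std_normal_distribution field_simps)
  qed
  have eq: "(\<lambda>x. cis (t / e * (0 + e * x)) * complex_of_real (exp (- ((0 + e * x)\<^sup>2) / 2)))
     = (\<lambda>x. cis (t * x) * complex_of_real (exp (- ((e * x)\<^sup>2) / 2)))"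
    using assms by auto
  show "integrable lborel (\<lambda>x. cis (t * x) * complex_of_real (exp (- ((e * x)\<^sup>2) / 2)))"
    using lborel_integrable_real_affine[OF i2[of "t / e"], of e 0] assms unfolding eq by simp
  have "complex_of_real (sqrt (2 * pi) * exp (- ((t / e)\<^sup>2) / 2))
     = e *\<^sub>R (\<integral>x. cis (t * x) * complex_of_real (exp (- ((e * x)\<^sup>2) / 2)) \<partial>lborel)"
    using lborel_integral_real_affine[of e "\<lambda>x. cis (t / e * x) * complex_of_real (exp (- (x\<^sup>2) / 2))" 0] assms
    unfolding eq n by simp
  then show "(\<integral>x. cis (t * x) * complex_of_real (exp (- ((e * x)\<^sup>2) / 2)) \<partial>lborel)
      = complex_of_real (sqrt (2 * pi) / e * exp (- ((t / e)\<^sup>2) / 2))"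
    using assms by (simp add: scaleR_conv_of_real field_simps)
qed

lemma gauss_fourier:
  fixes z :: "'a::euclidean_space"
  assumes "e > 0"
  shows "integrable lborel (\<lambda>\<xi>. cis (z \<bullet> \<xi>) * complex_of_real (gauss e \<xi>))"
    and "(\<integral>\<xi>. cis (z \<bullet> \<xi>) * complex_of_real (gauss e \<xi>) \<partial>lborel)
      = complex_of_real ((sqrt (2 * pi) / e) ^ DIM('a) * gauss (1 / e) z)"
proof -
  let ?f = "\<lambda>b t. cis ((z \<bullet> b) * t) * complex_of_real (exp (- ((e * t)\<^sup>2) / 2))"
  have eq: "(\<lambda>\<xi>. cis (z \<bullet> \<xi>) * complex_of_real (gauss e \<xi>)) = (\<lambda>\<xi>. \<Prod>b\<in>Basis. ?f b (\<xi> \<bullet> b))"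
    by (simp add: cis_inner_prod gauss_prod prod.distrib of_real_prod)
  show "integrable lborel (\<lambda>\<xi>. cis (z \<bullet> \<xi>) * complex_of_real (gauss e \<xi>))"
    unfolding eq by (intro integral_lborel_prod(2) gauss_fourier_1(1) assms)
  have "(\<integral>\<xi>. cis (z \<bullet> \<xi>) * complex_of_real (gauss e \<xi>) \<partial>lborel)
     = (\<Prod>b\<in>Basis. complex_of_real (sqrt (2 * pi) / e * exp (- (((z \<bullet> b) / e)\<^sup>2) / 2)))"
    unfolding eq by (subst integral_lborel_prod(1)) (use gauss_fourier_1[OF assms] in auto)
  also have "\<dots> = complex_of_real ((sqrt (2 * pi) / e) ^ DIM('a) * gauss (1 / e) z)"
  proof -
    have "(\<Prod>b\<in>(Basis::'a set). sqrt (2 * pi) / e * exp (- (((z \<bullet> b) / e)\<^sup>2) / 2)) = (sqrt (2 * pi) / e) ^ DIM('a) * gauss (1 / e) z"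
      by (simp only: prod.distrib gauss_prod prod_constant) simp
    then show ?thesis by (simp only: of_real_prod[symmetric])
  qed
  finally show "(\<integral>\<xi>. cis (z \<bullet> \<xi>) * complex_of_real (gauss e \<xi>) \<partial>lborel)
      = complex_of_real ((sqrt (2 * pi) / e) ^ DIM('a) * gauss (1 / e) z)" .
qed

lemma integrable_gauss:
  assumes "e > 0" shows "integrable lborel (gauss e :: 'a::euclidean_space \<Rightarrow> real)"
  using gauss_fourier(1)[OF assms, of "0::'a"] by (simp add: complex_of_real_integrable_eq)

lemma integral_gauss:
  assumes "e > 0"
  shows "(\<integral>x. gauss e x \<partial>(lborel :: 'a::euclidean_space measure)) = (sqrt (2 * pi) / e) ^ DIM('a)"
proof -
  have "complex_of_real (\<integral>x. gauss e x \<partial>(lborel :: 'a measure)) = complex_of_real ((sqrt (2 * pi) / e) ^ DIM('a))"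
    using gauss_fourier(2)[OF assms, of "0::'a"] by (simp add: gauss_def)
  then show ?thesis by (simp only: of_real_eq_iff)
qed

section \<open>The multiplication formula and Bessel's inequality\<close>

lemma norm_integral_le_nn:
  fixes f :: "'a \<Rightarrow> 'b::{banach, second_countable_topology}"
  shows "ennreal (norm (integral\<^sup>L M f)) \<le> (\<integral>\<^sup>+x. ennreal (norm (f x)) \<partial>M)"
  by (cases "integrable M f") (auto simp: integral_norm_bound_ennreal not_integrable_integral_eq)

text \<open>Fubini moves the transform from f to u. It is applied to u carrying a Gaussian factor,
  which supplies the integrability of u.\<close>

lemma inv_fourier_mult_formula:
  fixes f u :: "'a::euclidean_space \<Rightarrow> complex"
  assumes f: "integrable lborel f" and u: "integrable lborel u"
  shows "(\<integral>\<xi>. inv_fourier f \<xi> * u \<xi> \<partial>lborel) = (\<integral>x. f x * (\<integral>\<xi>. cis (x \<bullet> \<xi>) * u \<xi> \<partial>lborel) \<partial>lborel)"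
proof -
  have [measurable]: "f \<in> borel_measurable borel" "u \<in> borel_measurable borel" using assms by auto
  let ?h = "\<lambda>(x, \<xi>). f x * cis (x \<bullet> \<xi>) * u \<xi>"
  have "integrable (lborel \<Otimes>\<^sub>M lborel) ?h"
  proof (rule lborel_pair.Fubini_integrable)
    show "?h \<in> borel_measurable (lborel \<Otimes>\<^sub>M lborel)" by measurable
    have "integrable lborel (\<lambda>x. cmod (f x) * (\<integral>\<xi>. cmod (u \<xi>) \<partial>lborel))"
      using f by simp
    then show "integrable lborel (\<lambda>x. \<integral>y. norm (case (x, y) of (x, \<xi>) \<Rightarrow> f x * cis (x \<bullet> \<xi>) * u \<xi>) \<partial>lborel)"
      by (simp add: norm_mult)
    show "AE x in lborel. integrable lborel (\<lambda>y. case (x, y) of (x, \<xi>) \<Rightarrow> f x * cis (x \<bullet> \<xi>) * u \<xi>)"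
    proof (rule AE_I2)
      fix x
      have "integrable lborel (\<lambda>\<xi>. f x * (u \<xi> * cis (\<xi> \<bullet> x)))"
        by (intro integrable_mult_right integrable_mult_cis u)
      then show "integrable lborel (\<lambda>y. case (x, y) of (x, \<xi>) \<Rightarrow> f x * cis (x \<bullet> \<xi>) * u \<xi>)"
        by (simp add: inner_commute mult_ac)
    qed
  qed
  then have i: "integrable (lborel \<Otimes>\<^sub>M lborel) (\<lambda>(x, \<xi>). f x * cis (x \<bullet> \<xi>) * u \<xi>)" by simp
  have "(\<integral>\<xi>. (\<integral>x. f x * cis (x \<bullet> \<xi>) * u \<xi> \<partial>lborel) \<partial>lborel) = (\<integral>x. (\<integral>\<xi>. f x * cis (x \<bullet> \<xi>) * u \<xi> \<partial>lborel) \<partial>lborel)"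
    by (rule lborel_pair.Fubini_integral[OF i])
  moreover have "(\<integral>x. f x * cis (x \<bullet> \<xi>) * u \<xi> \<partial>lborel) = inv_fourier f \<xi> * u \<xi>" for \<xi>
    by (simp add: inv_fourier_lborel)
  moreover have "(\<integral>\<xi>. f x * cis (x \<bullet> \<xi>) * u \<xi> \<partial>lborel) = f x * (\<integral>\<xi>. cis (x \<bullet> \<xi>) * u \<xi> \<partial>lborel)" for x
    by (simp add: mult.assoc)
  ultimately show ?thesis by (simp only:)
qed

text \<open>The powers of e in the height and in the width of the kernel cancel, so the mass, and
  with it the constant in Bessel's inequality, does not depend on e.\<close>

lemma nn_integral_gauss:
  fixes x :: "'a::euclidean_space"
  assumes "e > 0"
  shows "(\<integral>\<^sup>+y. ennreal ((sqrt (2 * pi) / e) ^ DIM('a) * gauss (1 / e) (y - x)) \<partial>lborel) = ennreal ((2 * pi) ^ DIM('a))"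
proof -
  let ?c = "(sqrt (2 * pi) / e) ^ DIM('a)"
  have "(\<integral>\<^sup>+y. ennreal (?c * gauss (1 / e) (y - x)) \<partial>lborel) = (\<integral>\<^sup>+y. ennreal (?c * gauss (1 / e) y) \<partial>(lborel :: 'a measure))"
    using nn_integral_lborel_affine[of "\<lambda>y. ennreal (?c * gauss (1 / e) (y - x))" 1 x] by simp
  also have "\<dots> = ennreal (\<integral>y. ?c * gauss (1 / e) y \<partial>(lborel :: 'a measure))"
    using assms by (intro nn_integral_eq_integral integrable_mult_right integrable_gauss) auto
  also have "(\<integral>y. ?c * gauss (1 / e) y \<partial>(lborel :: 'a measure)) = ?c * (sqrt (2 * pi) / (1 / e)) ^ DIM('a)"
    using integral_gauss[of "1 / e", where 'a='a] assms by simp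
  also have "\<dots> = (2 * pi) ^ DIM('a)"
  proof -
    have "sqrt (2 * pi) / e * (sqrt (2 * pi) / (1 / e)) = 2 * pi" using assms by simp
    then show ?thesis by (simp only: power_mult_distrib[symmetric])
  qed
  finally show ?thesis .
qed

text \<open>The left side is the pairing of F with cnj F times a Gaussian. Moving the transform off
  turns it into a double integral of f(x) cnj (f(y)) against a symmetric kernel of mass (2 pi)^d;
  then ab \<le> (a^2 + b^2)/2 and the symmetry of the kernel bound it, as in Schur's test.\<close>

lemma bessel_gauss:
  fixes f :: "'a::euclidean_space \<Rightarrow> complex"
  assumes f: "integrable lborel f" and e: "e > 0"
  shows "(\<integral>\<^sup>+\<xi>. ennreal ((cmod (inv_fourier f \<xi>))\<^sup>2 * gauss e \<xi>) \<partial>lborel)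
     \<le> ennreal ((2 * pi) ^ DIM('a)) * (\<integral>\<^sup>+x. ennreal ((cmod (f x))\<^sup>2) \<partial>lborel)"
proof -
  let ?F = "inv_fourier f"
  define \<Gamma> :: "'a \<Rightarrow> real" where "\<Gamma> z = (sqrt (2 * pi) / e) ^ DIM('a) * gauss (1 / e) z" for z
  have [measurable]: "f \<in> borel_measurable borel" using f by auto
  have [measurable]: "?F \<in> borel_measurable borel" by (rule borel_measurable_inv_fourier) measurable
  have [measurable]: "\<Gamma> \<in> borel_measurable borel" unfolding \<Gamma>_def[abs_def] by measurable
  have \<Gamma>0: "\<Gamma> z \<ge> 0" for z using e by (simp add: \<Gamma>_def)
  define B where "B = (\<integral>x. cmod (f x) \<partial>lborel)"
  have FB: "cmod (?F \<xi>) \<le> B" for \<xi> unfolding B_def by (rule norm_inv_fourier_le[OF f])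
  have ig: "integrable lborel (\<lambda>\<xi>::'a. B * gauss e \<xi>)" by (intro integrable_mult_right integrable_gauss e)
  have iu: "integrable lborel (\<lambda>\<xi>. cnj (?F \<xi>) * of_real (gauss e \<xi>))"
    by (rule Bochner_Integration.integrable_bound[OF ig])
       (auto simp: norm_mult intro!: AE_I2 order_trans[OF mult_right_mono[OF FB] abs_ge_self])
  \<comment> \<open>The multiplication formula is used with the opposite phase and the result is
    conjugated, which expresses the transform of cnj F times a Gaussian through f itself.\<close>
  have inner: "(\<integral>\<xi>. cis (x \<bullet> \<xi>) * (cnj (?F \<xi>) * of_real (gauss e \<xi>)) \<partial>lborel) = cnj (\<integral>y. f y * of_real (\<Gamma> (y - x)) \<partial>lborel)" for x
  proof -
    have iv: "integrable lborel (\<lambda>\<xi>. cis (- (x \<bullet> \<xi>)) * complex_of_real (gauss e \<xi>))"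
      using gauss_fourier(1)[OF e, of "- x"] by simp
    have "(\<integral>\<xi>. ?F \<xi> * (cis (- (x \<bullet> \<xi>)) * of_real (gauss e \<xi>)) \<partial>lborel)
        = (\<integral>y. f y * (\<integral>\<xi>. cis (y \<bullet> \<xi>) * (cis (- (x \<bullet> \<xi>)) * of_real (gauss e \<xi>)) \<partial>lborel) \<partial>lborel)"
      by (rule inv_fourier_mult_formula[OF f iv])
    also have "\<dots> = (\<integral>y. f y * of_real (\<Gamma> (y - x)) \<partial>lborel)"
    proof (intro Bochner_Integration.integral_cong refl)
      fix y
      have "(\<lambda>\<xi>. cis (y \<bullet> \<xi>) * (cis (- (x \<bullet> \<xi>)) * complex_of_real (gauss e \<xi>))) = (\<lambda>\<xi>. cis ((y - x) \<bullet> \<xi>) * of_real (gauss e \<xi>))"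
        by (simp add: mult.assoc[symmetric] cis_mult inner_diff_left)
      then show "f y * (\<integral>\<xi>. cis (y \<bullet> \<xi>) * (cis (- (x \<bullet> \<xi>)) * of_real (gauss e \<xi>)) \<partial>lborel) = f y * of_real (\<Gamma> (y - x))"
        using gauss_fourier(2)[OF e, of "y - x"] by (simp add: \<Gamma>_def)
    qed
    finally have "cnj (\<integral>\<xi>. ?F \<xi> * (cis (- (x \<bullet> \<xi>)) * of_real (gauss e \<xi>)) \<partial>lborel) = cnj (\<integral>y. f y * of_real (\<Gamma> (y - x)) \<partial>lborel)"
      by simp
    moreover have "(\<integral>\<xi>. cis (x \<bullet> \<xi>) * (cnj (?F \<xi>) * of_real (gauss e \<xi>)) \<partial>lborel)
       = (\<integral>\<xi>. cnj (?F \<xi> * (cis (- (x \<bullet> \<xi>)) * of_real (gauss e \<xi>))) \<partial>lborel)"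
      by (intro Bochner_Integration.integral_cong refl) (simp add: cis_cnj)
    ultimately show ?thesis by (simp only: Bochner_Integration.integral_cnj)
  qed
  have "complex_of_real (\<integral>\<xi>. (cmod (?F \<xi>))\<^sup>2 * gauss e \<xi> \<partial>lborel) = (\<integral>\<xi>. ?F \<xi> * (cnj (?F \<xi>) * of_real (gauss e \<xi>)) \<partial>lborel)"
    unfolding integral_complex_of_real[symmetric]
    by (intro Bochner_Integration.integral_cong refl) (simp add: complex_norm_square mult.assoc del: of_real_power)
  also have "\<dots> = (\<integral>x. f x * cnj (\<integral>y. f y * of_real (\<Gamma> (y - x)) \<partial>lborel) \<partial>lborel)"
    by (subst inv_fourier_mult_formula[OF f iu]) (simp add: inner)
  finally have "ennreal (cmod (complex_of_real (\<integral>\<xi>. (cmod (?F \<xi>))\<^sup>2 * gauss e \<xi> \<partial>lborel)))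
     \<le> (\<integral>\<^sup>+x. ennreal (cmod (f x * cnj (\<integral>y. f y * of_real (\<Gamma> (y - x)) \<partial>lborel))) \<partial>lborel)"
    by (simp only: norm_integral_le_nn)
  also have "\<dots> \<le> (\<integral>\<^sup>+x. (\<integral>\<^sup>+y. ennreal (cmod (f x) * (cmod (f y) * \<Gamma> (y - x))) \<partial>lborel) \<partial>lborel)"
  proof (intro nn_integral_mono)
    fix x
    have "ennreal (cmod (\<integral>y. f y * of_real (\<Gamma> (y - x)) \<partial>lborel)) \<le> (\<integral>\<^sup>+y. ennreal (cmod (f y * of_real (\<Gamma> (y - x)))) \<partial>lborel)"
      by (rule norm_integral_le_nn)
    then have "ennreal (cmod (f x)) * ennreal (cmod (\<integral>y. f y * of_real (\<Gamma> (y - x)) \<partial>lborel))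
       \<le> ennreal (cmod (f x)) * (\<integral>\<^sup>+y. ennreal (cmod (f y) * \<Gamma> (y - x)) \<partial>lborel)"
      by (intro mult_left_mono) (auto simp: norm_mult \<Gamma>0)
    then show "ennreal (cmod (f x * cnj (\<integral>y. f y * of_real (\<Gamma> (y - x)) \<partial>lborel)))
       \<le> (\<integral>\<^sup>+y. ennreal (cmod (f x) * (cmod (f y) * \<Gamma> (y - x))) \<partial>lborel)"
      by (simp add: norm_mult ennreal_mult nn_integral_cmult \<Gamma>0)
  qed
  also have "\<dots> \<le> (\<integral>\<^sup>+x. (\<integral>\<^sup>+y. ennreal ((cmod (f x))\<^sup>2 / 2 * \<Gamma> (y - x)) + ennreal ((cmod (f y))\<^sup>2 / 2 * \<Gamma> (y - x)) \<partial>lborel) \<partial>lborel)"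
  proof (intro nn_integral_mono)
    fix x y
    have "0 \<le> (cmod (f x) - cmod (f y))\<^sup>2" by simp
    then have "cmod (f x) * cmod (f y) \<le> (cmod (f x))\<^sup>2 / 2 + (cmod (f y))\<^sup>2 / 2"
      by (simp add: power2_diff)
    from mult_right_mono[OF this \<Gamma>0[of "y - x"]]
    show "ennreal (cmod (f x) * (cmod (f y) * \<Gamma> (y - x))) \<le> ennreal ((cmod (f x))\<^sup>2 / 2 * \<Gamma> (y - x)) + ennreal ((cmod (f y))\<^sup>2 / 2 * \<Gamma> (y - x))"
      using \<Gamma>0 by (simp add: ennreal_plus[symmetric] algebra_simps del: ennreal_plus)
  qed
  also have "\<dots> = (\<integral>\<^sup>+x. (\<integral>\<^sup>+y. ennreal ((cmod (f x))\<^sup>2 / 2 * \<Gamma> (y - x)) \<partial>lborel) \<partial>lborel)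
      + (\<integral>\<^sup>+x. (\<integral>\<^sup>+y. ennreal ((cmod (f y))\<^sup>2 / 2 * \<Gamma> (y - x)) \<partial>lborel) \<partial>lborel)"
    by (simp add: nn_integral_add)
  also have "(\<integral>\<^sup>+x. (\<integral>\<^sup>+y. ennreal ((cmod (f y))\<^sup>2 / 2 * \<Gamma> (y - x)) \<partial>lborel) \<partial>lborel)
      = (\<integral>\<^sup>+y. (\<integral>\<^sup>+x. ennreal ((cmod (f y))\<^sup>2 / 2 * \<Gamma> (y - x)) \<partial>lborel) \<partial>lborel)"
    by (rule lborel_pair.Fubini') measurable
  also have "\<dots> = (\<integral>\<^sup>+x. (\<integral>\<^sup>+y. ennreal ((cmod (f x))\<^sup>2 / 2 * \<Gamma> (y - x)) \<partial>lborel) \<partial>lborel)"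
  proof -
    have "\<Gamma> (y - x) = \<Gamma> (x - y)" for x y using gauss_uminus[of "1 / e" "x - y"] by (simp add: \<Gamma>_def)
    then show ?thesis by simp
  qed
  also have "(\<integral>\<^sup>+x. (\<integral>\<^sup>+y. ennreal ((cmod (f x))\<^sup>2 / 2 * \<Gamma> (y - x)) \<partial>lborel) \<partial>lborel)
    = (\<integral>\<^sup>+x. ennreal ((cmod (f x))\<^sup>2 / 2) \<partial>lborel) * ennreal ((2 * pi) ^ DIM('a))"
  proof -
    have "(\<integral>\<^sup>+y. ennreal (a * \<Gamma> (y - x)) \<partial>lborel) = ennreal a * ennreal ((2 * pi) ^ DIM('a))" if "a \<ge> 0" for a x
    proof -
      have "(\<integral>\<^sup>+y. ennreal (a * \<Gamma> (y - x)) \<partial>lborel) = ennreal a * (\<integral>\<^sup>+y. ennreal (\<Gamma> (y - x)) \<partial>lborel)"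
        using that by (subst nn_integral_cmult[symmetric]) (auto simp: ennreal_mult' \<Gamma>0)
      then show ?thesis unfolding \<Gamma>_def using nn_integral_gauss[OF e, of x] by (simp only:)
    qed
    then have "(\<integral>\<^sup>+x. (\<integral>\<^sup>+y. ennreal ((cmod (f x))\<^sup>2 / 2 * \<Gamma> (y - x)) \<partial>lborel) \<partial>lborel)
       = (\<integral>\<^sup>+x. ennreal ((cmod (f x))\<^sup>2 / 2) * ennreal ((2 * pi) ^ DIM('a)) \<partial>lborel)"
      by (simp only: zero_le_divide_iff zero_le_power2 zero_le_numeral simp_thms)
    then show ?thesis by (simp only:) (rule nn_integral_multc, measurable)
  qed
  also have "\<dots> + \<dots> = (\<integral>\<^sup>+x. ennreal ((cmod (f x))\<^sup>2 / 2) + ennreal ((cmod (f x))\<^sup>2 / 2) \<partial>lborel) * ennreal ((2 * pi) ^ DIM('a))"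
    by (subst nn_integral_add) (auto simp: distrib_right)
  also have "\<dots> = ennreal ((2 * pi) ^ DIM('a)) * (\<integral>\<^sup>+x. ennreal ((cmod (f x))\<^sup>2) \<partial>lborel)"
    by (simp add: ennreal_plus[symmetric] mult.commute del: ennreal_plus)
  finally have *: "ennreal (cmod (complex_of_real (\<integral>\<xi>. (cmod (?F \<xi>))\<^sup>2 * gauss e \<xi> \<partial>lborel))) \<le> ennreal ((2 * pi) ^ DIM('a)) * (\<integral>\<^sup>+x. ennreal ((cmod (f x))\<^sup>2) \<partial>lborel)" .
  have ig2: "integrable lborel (\<lambda>\<xi>::'a. B\<^sup>2 * gauss e \<xi>)" by (intro integrable_mult_right integrable_gauss e)
  have "integrable lborel (\<lambda>\<xi>. (cmod (?F \<xi>))\<^sup>2 * gauss e \<xi>)"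
    by (rule Bochner_Integration.integrable_bound[OF ig2])
       (auto simp: abs_mult intro!: AE_I2 mult_right_mono power_mono FB)
  then have "(\<integral>\<^sup>+\<xi>. ennreal ((cmod (?F \<xi>))\<^sup>2 * gauss e \<xi>) \<partial>lborel) = ennreal (\<integral>\<xi>. (cmod (?F \<xi>))\<^sup>2 * gauss e \<xi> \<partial>lborel)"
    by (intro nn_integral_eq_integral) auto
  then show ?thesis using * by (auto intro: order_trans[OF ennreal_leI])
qed

text \<open>Fatou's lemma removes the Gaussian, since the bound of \<open>bessel_gauss\<close> is
  independent of e.\<close>

lemma bessel_inequality:
  fixes f :: "'a::euclidean_space \<Rightarrow> complex"
  assumes f: "integrable lborel f"
  shows "(\<integral>\<^sup>+\<xi>. ennreal ((cmod (inv_fourier f \<xi>))\<^sup>2) \<partial>lborel)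
     \<le> ennreal ((2 * pi) ^ DIM('a)) * (\<integral>\<^sup>+x. ennreal ((cmod (f x))\<^sup>2) \<partial>lborel)" (is "_ \<le> ?C")
proof -
  let ?F = "inv_fourier f"
  have [measurable]: "?F \<in> borel_measurable borel"
    by (rule borel_measurable_inv_fourier) (use f in auto)
  define u where "u n \<xi> = ennreal ((cmod (?F \<xi>))\<^sup>2 * gauss (1 / real (Suc n)) \<xi>)" for n \<xi>
  have "(\<lambda>n. u n \<xi>) \<longlonglongrightarrow> ennreal ((cmod (?F \<xi>))\<^sup>2 * 1)" for \<xi>
    unfolding u_def gauss_def
  proof (intro tendsto_ennrealI tendsto_mult tendsto_const)
    have "(\<lambda>n. exp (- ((1 / real (Suc n))\<^sup>2 * (\<xi> \<bullet> \<xi>)) / 2)) \<longlonglongrightarrow> exp (- (0\<^sup>2 * (\<xi> \<bullet> \<xi>)) / 2)"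
      by (intro tendsto_intros LIMSEQ_Suc[OF lim_1_over_n]) auto
    then show "(\<lambda>n. exp (- ((1 / real (Suc n))\<^sup>2 * (\<xi> \<bullet> \<xi>)) / 2)) \<longlonglongrightarrow> 1" by simp
  qed
  then have "liminf (\<lambda>n. u n \<xi>) = ennreal ((cmod (?F \<xi>))\<^sup>2)" for \<xi>
    by (intro lim_imp_Liminf) auto
  then have "(\<integral>\<^sup>+\<xi>. ennreal ((cmod (?F \<xi>))\<^sup>2) \<partial>lborel) = (\<integral>\<^sup>+\<xi>. liminf (\<lambda>n. u n \<xi>) \<partial>lborel)" by simp
  also have "\<dots> \<le> liminf (\<lambda>n. \<integral>\<^sup>+\<xi>. u n \<xi> \<partial>lborel)"
    by (rule nn_integral_liminf) (simp add: u_def[abs_def])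
  also have "\<dots> \<le> limsup (\<lambda>n. \<integral>\<^sup>+\<xi>. u n \<xi> \<partial>lborel)" by (rule Liminf_le_Limsup) simp
  also have "\<dots> \<le> ?C"
    unfolding u_def by (rule Limsup_bounded, rule always_eventually, rule allI, rule bessel_gauss[OF f]) simp
  finally show ?thesis .
qed

section \<open>Pairing a function with the Fourier transform of a test function\<close>

lemma ennreal_le_of_power2_le:
  assumes "x\<^sup>2 \<le> ennreal (y\<^sup>2)" "0 \<le> y"
  shows "x \<le> ennreal y"
proof (cases x)
  case (real r)
  then have "r\<^sup>2 \<le> y\<^sup>2" using assms by (simp add: ennreal_power)
  then show ?thesis using real assms by (auto intro: ennreal_leI power2_le_imp_le)
qed (use assms in \<open>auto simp: top_unique\<close>)

lemma Cauchy_Schwarz_nn_integral_le: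
  assumes [measurable]: "f \<in> borel_measurable M" "g \<in> borel_measurable M"
    and "(\<integral>\<^sup>+x. f x ^ 2 \<partial>M) \<le> ennreal (a\<^sup>2)" "(\<integral>\<^sup>+x. g x ^ 2 \<partial>M) \<le> ennreal (b\<^sup>2)" "0 \<le> a" "0 \<le> b"
  shows "(\<integral>\<^sup>+x. f x * g x \<partial>M) \<le> ennreal (a * b)"
proof (rule ennreal_le_of_power2_le)
  have "(\<integral>\<^sup>+x. f x * g x \<partial>M)\<^sup>2 \<le> (\<integral>\<^sup>+x. f x ^ 2 \<partial>M) * (\<integral>\<^sup>+x. g x ^ 2 \<partial>M)"
    by (rule Cauchy_Schwarz_nn_integral) auto
  also have "\<dots> \<le> ennreal (a\<^sup>2) * ennreal (b\<^sup>2)" by (intro mult_mono assms) auto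
  also have "\<dots> = ennreal ((a * b)\<^sup>2)" by (simp add: ennreal_mult power_mult_distrib)
  finally show "(\<integral>\<^sup>+x. f x * g x \<partial>M)\<^sup>2 \<le> ennreal ((a * b)\<^sup>2)" .
qed (use assms in auto)

text \<open>The squared L2 norm of the reciprocal of the \<open>bessel_op\<close> multiplier:
  one-dimensional Cauchy densities, each rescaled by s. The factor (1/s)^d is the volume of the
  frequencies resolved at scale s.\<close>

lemma nn_integral_cauchy_kernel:
  "\<exists>K\<ge>0. \<forall>s>0. (\<integral>\<^sup>+\<xi>. ennreal (1 / (\<Prod>b\<in>Basis. 1 + (s * (\<xi> \<bullet> b))\<^sup>2)) \<partial>(lborel :: 'a::euclidean_space measure)) = ennreal (K * (1 / s) ^ DIM('a))"
proof -
  have "integrable lborel (\<lambda>x::real. inverse (1 + x\<^sup>2))"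
    using integrable_inverse_1_plus_square by (simp add: set_integrable_def)
  then have K0: "(\<integral>\<^sup>+x. ennreal (inverse (1 + x\<^sup>2)) \<partial>lborel) = ennreal (\<integral>x. inverse (1 + x\<^sup>2) \<partial>(lborel::real measure))"
    by (intro nn_integral_eq_integral) auto
  define K where "K = (\<integral>x. inverse (1 + x\<^sup>2) \<partial>(lborel::real measure))"
  have K: "K \<ge> 0" unfolding K_def by (intro integral_nonneg_AE) auto
  show ?thesis
  proof (intro exI[of _ "K ^ DIM('a)"] conjI allI impI)
    fix s :: real assume s: "s > 0"
    have "ennreal K = ennreal s * (\<integral>\<^sup>+x. ennreal (inverse (1 + (s * x)\<^sup>2)) \<partial>lborel)"
      using nn_integral_real_affine[of "\<lambda>x. ennreal (inverse (1 + x\<^sup>2))" s 0] s K0 by (simp add: K_def)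
    then have "ennreal (1 / s) * ennreal K = ennreal (1 / s) * ennreal s * (\<integral>\<^sup>+x. ennreal (inverse (1 + (s * x)\<^sup>2)) \<partial>lborel)"
      by (simp add: mult.assoc)
    then have 1: "(\<integral>\<^sup>+x. ennreal (inverse (1 + (s * x)\<^sup>2)) \<partial>lborel) = ennreal (K / s)"
      using s K by (simp add: ennreal_mult[symmetric])
    have "(\<integral>\<^sup>+\<xi>. ennreal (1 / (\<Prod>b\<in>Basis. 1 + (s * (\<xi> \<bullet> b))\<^sup>2)) \<partial>(lborel :: 'a measure))
        = (\<integral>\<^sup>+\<xi>. (\<Prod>b\<in>Basis. ennreal (inverse (1 + (s * (\<xi> \<bullet> b))\<^sup>2))) \<partial>(lborel :: 'a measure))"
      by (intro nn_integral_cong) (simp add: prod_ennreal prod_inversef[symmetric] divide_inverse o_def)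
    also have "\<dots> = (\<Prod>b\<in>(Basis :: 'a set). ennreal (K / s))"
      by (subst nn_integral_lborel_prod) (auto simp: 1)
    also have "\<dots> = ennreal (K ^ DIM('a) * (1 / s) ^ DIM('a))"
      using K s by (simp add: ennreal_power power_divide)
    finally show "(\<integral>\<^sup>+\<xi>. ennreal (1 / (\<Prod>b\<in>Basis. 1 + (s * (\<xi> \<bullet> b))\<^sup>2)) \<partial>(lborel :: 'a measure)) = ennreal (K ^ DIM('a) * (1 / s) ^ DIM('a))" .
  qed (use K in auto)
qed

lemma norm_inv_fourier_bessel_op:
  fixes f :: "'a::euclidean_space \<Rightarrow> complex"
  assumes "test_fun f" "distinct bs" "set bs = Basis"
  shows "(cmod (inv_fourier (bessel_op s bs f) \<xi>))\<^sup>2 = (\<Prod>b\<in>Basis. 1 + (s * (\<xi> \<bullet> b))\<^sup>2) * (cmod (inv_fourier f \<xi>))\<^sup>2"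
proof -
  have "(\<Prod>b\<leftarrow>bs. 1 - \<i> * complex_of_real (s * (b \<bullet> \<xi>))) = (\<Prod>b\<in>Basis. 1 - \<i> * complex_of_real (s * (b \<bullet> \<xi>)))"
    using assms(2,3) by (metis prod.distinct_set_conv_list)
  moreover have "(cmod (1 - \<i> * complex_of_real (s * (b \<bullet> \<xi>))))\<^sup>2 = 1 + (s * (\<xi> \<bullet> b))\<^sup>2" for b
    by (simp add: cmod_power2 inner_commute)
  ultimately show ?thesis
    using assms(1)
    by (simp only: inv_fourier_bessel_op norm_mult power_mult_distrib prod_norm[symmetric] prod_power_distrib)
qed

text \<open>Where g is large, use Bessel's inequality directly; where it is small, use the decay of the
  Fourier transform expressed by \<open>bessel_op\<close>.\<close>

lemma inv_fourier_pairing_bound: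
  "\<exists>C>0. \<forall>g f s \<mu> G V bs. g \<in> borel_measurable (borel :: 'a::euclidean_space measure) \<longrightarrow> test_fun f \<longrightarrow> 0 < s \<longrightarrow> 0 \<le> \<mu> \<longrightarrow> 0 \<le> G \<longrightarrow> 0 \<le> V \<longrightarrow>
     distinct bs \<longrightarrow> set bs = (Basis :: 'a set) \<longrightarrow>
     (\<integral>\<^sup>+\<xi>. ennreal ((cmod (g \<xi>))\<^sup>2) * indicator {\<xi>. cmod (g \<xi>) > \<mu>} \<xi> \<partial>lborel) \<le> ennreal (G\<^sup>2) \<longrightarrow>
     (\<integral>\<^sup>+x. ennreal ((cmod (bessel_op s bs f x))\<^sup>2) \<partial>lborel) \<le> ennreal (V\<^sup>2) \<longrightarrow>
     (\<integral>\<^sup>+\<xi>. ennreal (cmod (g \<xi>) * cmod (inv_fourier f \<xi>)) \<partial>lborel) \<le> ennreal (C * (G + \<mu> * sqrt ((1 / s) ^ DIM('a))) * V)"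
proof -
  obtain K where K: "K \<ge> 0" and K': "\<And>s. s > 0 \<Longrightarrow> (\<integral>\<^sup>+\<xi>. ennreal (1 / (\<Prod>b\<in>Basis. 1 + (s * (\<xi> \<bullet> b))\<^sup>2)) \<partial>(lborel :: 'a::euclidean_space measure)) = ennreal (K * (1 / s) ^ DIM('a))"
    using nn_integral_cauchy_kernel[where 'a='a] by blast
  define c where "c = sqrt ((2 * pi) ^ DIM('a))"
  have c: "c > 0" by (simp add: c_def)
  show ?thesis
  proof (intro exI[of _ "c * (1 + sqrt K)"] conjI allI impI)
    show "0 < c * (1 + sqrt K)" using c K by (intro mult_pos_pos add_pos_nonneg) auto
  next
    fix g f :: "'a \<Rightarrow> complex" and s \<mu> G V :: real and bs
    assume [measurable]: "g \<in> borel_measurable borel" and f: "test_fun f" and s: "0 < s" and l: "0 \<le> \<mu>" and G: "0 \<le> G" and V: "0 \<le> V"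
      and bs: "distinct bs" "set bs = (Basis :: 'a set)"
      and Gi: "(\<integral>\<^sup>+\<xi>. ennreal ((cmod (g \<xi>))\<^sup>2) * indicator {\<xi>. cmod (g \<xi>) > \<mu>} \<xi> \<partial>lborel) \<le> ennreal (G\<^sup>2)"
      and Vi: "(\<integral>\<^sup>+x. ennreal ((cmod (bessel_op s bs f x))\<^sup>2) \<partial>lborel) \<le> ennreal (V\<^sup>2)"
    let ?F = "inv_fourier f" and ?P = "inv_fourier (bessel_op s bs f)"
    let ?D = "\<lambda>\<xi>::'a. (\<Prod>b\<in>Basis. 1 + (s * (\<xi> \<bullet> b))\<^sup>2)"
    let ?A = "{\<xi>. cmod (g \<xi>) > \<mu>}"
    note tP = test_fun_bessel_op[OF f, of s bs]
    have [measurable]: "?F \<in> borel_measurable borel" "?P \<in> borel_measurable borel"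
      using f tP by (auto intro: borel_measurable_inv_fourier test_fun_borel)
    have D1: "?D \<xi> \<ge> 1" for \<xi> by (rule prod_ge_1) auto
    have PD: "(cmod (?P \<xi>))\<^sup>2 = ?D \<xi> * (cmod (?F \<xi>))\<^sup>2" for \<xi>
      by (rule norm_inv_fourier_bessel_op[OF f bs])
    have "(\<integral>\<^sup>+\<xi>. ennreal ((cmod (?P \<xi>))\<^sup>2) \<partial>lborel) \<le> ennreal ((2 * pi) ^ DIM('a)) * (\<integral>\<^sup>+x. ennreal ((cmod (bessel_op s bs f x))\<^sup>2) \<partial>lborel)"
      by (rule bessel_inequality[OF test_fun_integrable[OF tP]])
    also have "\<dots> \<le> ennreal ((2 * pi) ^ DIM('a)) * ennreal (V\<^sup>2)" by (intro mult_left_mono Vi) auto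
    also have "\<dots> = ennreal ((c * V)\<^sup>2)" by (simp add: c_def ennreal_mult power_mult_distrib)
    finally have P: "(\<integral>\<^sup>+\<xi>. ennreal ((cmod (?P \<xi>))\<^sup>2) \<partial>lborel) \<le> ennreal ((c * V)\<^sup>2)" .
    \<comment> \<open>For the part above the height it is enough that \<open>?D\<close> is at least
      1.\<close>
    have FP: "(\<integral>\<^sup>+\<xi>. ennreal (cmod (?F \<xi>)) ^ 2 \<partial>lborel) \<le> ennreal ((c * V)\<^sup>2)"
    proof (rule order_trans[OF nn_integral_mono P])
      fix \<xi>
      have "1 * (cmod (?F \<xi>))\<^sup>2 \<le> ?D \<xi> * (cmod (?F \<xi>))\<^sup>2" by (intro mult_right_mono D1) auto
      then show "ennreal (cmod (?F \<xi>)) ^ 2 \<le> ennreal ((cmod (?P \<xi>))\<^sup>2)"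
        by (simp add: ennreal_power PD ennreal_leI)
    qed
    have 1: "(\<integral>\<^sup>+\<xi>. (ennreal (cmod (g \<xi>)) * indicator ?A \<xi>) * ennreal (cmod (?F \<xi>)) \<partial>lborel) \<le> ennreal (G * (c * V))"
    proof (rule Cauchy_Schwarz_nn_integral_le[OF _ _ _ FP])
      have "(\<integral>\<^sup>+\<xi>. (ennreal (cmod (g \<xi>)) * indicator ?A \<xi>) ^ 2 \<partial>lborel) = (\<integral>\<^sup>+\<xi>. ennreal ((cmod (g \<xi>))\<^sup>2) * indicator ?A \<xi> \<partial>lborel)"
        by (intro nn_integral_cong) (auto simp: power_mult_distrib ennreal_power indicator_def)
      then show "(\<integral>\<^sup>+\<xi>. (ennreal (cmod (g \<xi>)) * indicator ?A \<xi>) ^ 2 \<partial>lborel) \<le> ennreal (G\<^sup>2)" using Gi by simp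
    qed (use G c V in auto)
    \<comment> \<open>For the part below the height, F has modulus \<bar>P\<bar> / sqrt D, and
      Cauchy-Schwarz is applied to the square-integrable factor 1 / sqrt D and to P.\<close>
    have 2: "(\<integral>\<^sup>+\<xi>. ennreal (\<mu> * (1 / sqrt (?D \<xi>))) * ennreal (cmod (?P \<xi>)) \<partial>lborel) \<le> ennreal ((\<mu> * sqrt (K * (1 / s) ^ DIM('a))) * (c * V))"
    proof (rule Cauchy_Schwarz_nn_integral_le)
      have "(\<integral>\<^sup>+\<xi>. ennreal (\<mu> * (1 / sqrt (?D \<xi>))) ^ 2 \<partial>lborel) = (\<integral>\<^sup>+\<xi>. ennreal (\<mu>\<^sup>2) * ennreal (1 / ?D \<xi>) \<partial>lborel)"
      proof (intro nn_integral_cong)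
        fix \<xi>
        have "?D \<xi> \<ge> 0" using D1[of \<xi>] by linarith
        then have "(\<mu> * (1 / sqrt (?D \<xi>)))\<^sup>2 = \<mu>\<^sup>2 * (1 / ?D \<xi>)" and "0 \<le> 1 / ?D \<xi>" and "0 \<le> \<mu> * (1 / sqrt (?D \<xi>))"
          using l by (simp_all add: power_mult_distrib power_divide)
        then show "ennreal (\<mu> * (1 / sqrt (?D \<xi>))) ^ 2 = ennreal (\<mu>\<^sup>2) * ennreal (1 / ?D \<xi>)"
          by (simp only: ennreal_power ennreal_mult'[symmetric] zero_le_power2)
      qed
      also have "\<dots> = ennreal (\<mu>\<^sup>2) * (\<integral>\<^sup>+\<xi>. ennreal (1 / ?D \<xi>) \<partial>lborel)"
        by (rule nn_integral_cmult) measurable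
      also have "\<dots> = ennreal ((\<mu> * sqrt (K * (1 / s) ^ DIM('a)))\<^sup>2)"
        unfolding K'[OF s] using K s by (simp add: ennreal_mult'[symmetric] power_mult_distrib)
      finally show "(\<integral>\<^sup>+\<xi>. ennreal (\<mu> * (1 / sqrt (?D \<xi>))) ^ 2 \<partial>lborel) \<le> ennreal ((\<mu> * sqrt (K * (1 / s) ^ DIM('a)))\<^sup>2)" by simp
      show "(\<integral>\<^sup>+\<xi>. ennreal (cmod (?P \<xi>)) ^ 2 \<partial>lborel) \<le> ennreal ((c * V)\<^sup>2)" using P by (simp add: ennreal_power)
    qed (use l K s c V in auto)
    have "(\<integral>\<^sup>+\<xi>. ennreal (cmod (g \<xi>) * cmod (?F \<xi>)) \<partial>lborel)
       \<le> (\<integral>\<^sup>+\<xi>. (ennreal (cmod (g \<xi>)) * indicator ?A \<xi>) * ennreal (cmod (?F \<xi>)) + ennreal (\<mu> * (1 / sqrt (?D \<xi>))) * ennreal (cmod (?P \<xi>)) \<partial>lborel)"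
    proof (rule nn_integral_mono)
      fix \<xi>
      show "ennreal (cmod (g \<xi>) * cmod (?F \<xi>)) \<le> (ennreal (cmod (g \<xi>)) * indicator ?A \<xi>) * ennreal (cmod (?F \<xi>)) + ennreal (\<mu> * (1 / sqrt (?D \<xi>))) * ennreal (cmod (?P \<xi>))"
      proof (cases "\<xi> \<in> ?A")
        case True then show ?thesis by (simp add: ennreal_mult)
      next
        case False
        have D: "sqrt (?D \<xi>) > 0" using D1[of \<xi>] by (simp add: less_le_trans[OF zero_less_one])
        have "cmod (?P \<xi>) = sqrt (?D \<xi>) * cmod (?F \<xi>)"
          using PD[of \<xi>] by (metis norm_ge_zero real_sqrt_mult real_sqrt_unique)
        moreover have "\<mu> * (1 / d) * (d * F) = \<mu> * F" if "d > 0" for d F :: real using that by simp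
        ultimately have "\<mu> * (1 / sqrt (?D \<xi>)) * cmod (?P \<xi>) = \<mu> * cmod (?F \<xi>)" using D by presburger
        moreover have "cmod (g \<xi>) * cmod (?F \<xi>) \<le> \<mu> * cmod (?F \<xi>)" using False by (intro mult_right_mono) auto
        ultimately have "ennreal (cmod (g \<xi>) * cmod (?F \<xi>)) \<le> ennreal (\<mu> * (1 / sqrt (?D \<xi>)) * cmod (?P \<xi>))" by (simp only: ennreal_leI)
        also have "\<dots> = ennreal (\<mu> * (1 / sqrt (?D \<xi>))) * ennreal (cmod (?P \<xi>))"
          using l D by (intro ennreal_mult) auto
        finally show ?thesis using False by simp
      qed
    qed
    also have "\<dots> = (\<integral>\<^sup>+\<xi>. (ennreal (cmod (g \<xi>)) * indicator ?A \<xi>) * ennreal (cmod (?F \<xi>)) \<partial>lborel) + (\<integral>\<^sup>+\<xi>. ennreal (\<mu> * (1 / sqrt (?D \<xi>))) * ennreal (cmod (?P \<xi>)) \<partial>lborel)"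
      by (rule nn_integral_add) measurable
    also have "\<dots> \<le> ennreal (G * (c * V)) + ennreal ((\<mu> * sqrt (K * (1 / s) ^ DIM('a))) * (c * V))"
      by (intro add_mono 1 2)
    also have "\<dots> = ennreal (G * (c * V) + (\<mu> * sqrt (K * (1 / s) ^ DIM('a))) * (c * V))"
      using G c V l K s by (intro ennreal_plus[symmetric]) auto
    also have "\<dots> \<le> ennreal (c * (1 + sqrt K) * (G + \<mu> * sqrt ((1 / s) ^ DIM('a))) * V)"
    proof (rule ennreal_leI)
      define r where "r = sqrt ((1 / s) ^ DIM('a))"
      have r: "r \<ge> 0" "sqrt (K * (1 / s) ^ DIM('a)) = sqrt K * r" using s by (auto simp: r_def real_sqrt_mult)
      \<comment> \<open>Nonnegative cross terms are added to bring the bound into product form; this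
        is the origin of the factor 1 + sqrt K.\<close>
      have "G * (c * V) + \<mu> * (sqrt K * r) * (c * V) + (sqrt K * G * (c * V) + \<mu> * r * (c * V)) = c * (1 + sqrt K) * (G + \<mu> * r) * V"
        by (simp add: algebra_simps)
      moreover have "0 \<le> sqrt K * G * (c * V) + \<mu> * r * (c * V)" using K G c V l r by auto
      ultimately show "G * (c * V) + \<mu> * sqrt (K * (1 / s) ^ DIM('a)) * (c * V) \<le> c * (1 + sqrt K) * (G + \<mu> * sqrt ((1 / s) ^ DIM('a))) * V"
        unfolding r(2) r_def[symmetric] by linarith
    qed
    finally show "(\<integral>\<^sup>+\<xi>. ennreal (cmod (g \<xi>) * cmod (?F \<xi>)) \<partial>lborel) \<le> ennreal (c * (1 + sqrt K) * (G + \<mu> * sqrt ((1 / s) ^ DIM('a))) * V)" .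
  qed
qed


section \<open>Level thresholds of functions in Lorentz spaces\<close>

lemma epow_mono: "x \<le> y \<Longrightarrow> 0 \<le> b \<Longrightarrow> epow x b \<le> epow y b"
  by (auto simp: epow_def top_unique less_top[symmetric] intro!: ennreal_leI powr_mono2 enn2real_mono)

lemma epow_ennreal: "0 \<le> x \<Longrightarrow> epow (ennreal x) b = ennreal (x powr b)"
  by (simp add: epow_def)

lemma add_powr_le:
  fixes a b q :: real
  assumes "0 \<le> a" "0 \<le> b" "0 \<le> q"
  shows "(a + b) powr q \<le> 2 powr q * (a powr q + b powr q)"
proof -
  have "(a + b) powr q \<le> (2 * max a b) powr q" using assms by (intro powr_mono2) auto
  also have "\<dots> = 2 powr q * max a b powr q" using assms by (simp add: powr_mult)
  also have "max a b powr q \<le> a powr q + b powr q" by (simp add: max_def)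
  finally show ?thesis by simp
qed

text \<open>The constant is divided out on the side of \<open>f\<close>, which is measurable.
  \<open>h\<close> stays arbitrary because it will be the integrand of the Lorentz
  functional.\<close>

lemma nn_integral_le_cmult:
  assumes [measurable]: "f \<in> borel_measurable M" and "c > 0" "\<And>x. f x \<le> ennreal c * h x"
  shows "(\<integral>\<^sup>+x. f x \<partial>M) \<le> ennreal c * (\<integral>\<^sup>+x. h x \<partial>M)"
proof -
  have c: "ennreal c * ennreal (1 / c) = 1" using assms(2) by (simp add: ennreal_mult[symmetric])
  have "(\<integral>\<^sup>+x. f x \<partial>M) = ennreal c * (ennreal (1 / c) * (\<integral>\<^sup>+x. f x \<partial>M))"
    by (simp only: mult.assoc[symmetric] c mult_1)
  also have "ennreal (1 / c) * (\<integral>\<^sup>+x. f x \<partial>M) = (\<integral>\<^sup>+x. ennreal (1 / c) * f x \<partial>M)"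
    by (rule nn_integral_cmult[symmetric]) measurable
  also have "\<dots> \<le> (\<integral>\<^sup>+x. h x \<partial>M)"
  proof (rule nn_integral_mono)
    fix x
    have "ennreal (1 / c) * f x \<le> ennreal (1 / c) * (ennreal c * h x)" by (intro mult_left_mono assms) auto
    also have "\<dots> = h x" by (simp only: mult.assoc[symmetric] mult.commute[of "ennreal (1 / c)"] c mult_1)
    finally show "ennreal (1 / c) * f x \<le> h x" .
  qed
  finally show ?thesis by (simp add: mult_left_mono)
qed

lemma sum_powr_int_le:
  fixes r :: real and F :: "int set"
  assumes "r > 1" "finite F" "\<And>k. k \<in> F \<Longrightarrow> k \<le> k0"
  shows "(\<Sum>k\<in>F. r powr real_of_int k) \<le> r powr real_of_int k0 * (1 / (1 - 1 / r))"
proof -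
  have inj: "inj_on (\<lambda>k. nat (k0 - k)) F" by (rule inj_onI) (use assms(3) in \<open>simp add: eq_nat_nat_iff\<close>)
  have "r powr real_of_int k = r powr real_of_int k0 * (1 / r) ^ nat (k0 - k)" if "k \<in> F" for k
  proof -
    have "(1 / r) ^ n = r powr - real n" for n
      using assms(1) by (simp add: powr_minus powr_realpow power_one_over inverse_eq_divide)
    from this[of "nat (k0 - k)"] have "(1 / r) ^ nat (k0 - k) = r powr (real_of_int k - real_of_int k0)"
      using assms(3)[OF that] by simp
    then show ?thesis using assms(1) by (simp add: powr_add[symmetric])
  qed
  then have "(\<Sum>k\<in>F. r powr real_of_int k) = r powr real_of_int k0 * (\<Sum>k\<in>F. (1 / r) ^ nat (k0 - k))"
    by (simp add: sum_distrib_left)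
  also have "(\<Sum>k\<in>F. (1 / r) ^ nat (k0 - k)) = (\<Sum>i\<in>(\<lambda>k. nat (k0 - k)) ` F. (1 / r) ^ i)"
    by (simp add: sum.reindex[OF inj])
  also have "\<dots> \<le> (\<Sum>i. (1 / r) ^ i)"
    using assms by (intro sum_le_suminf summable_geometric) auto
  also have "\<dots> = 1 / (1 - 1 / r)" using assms(1) by (intro suminf_geometric) auto
  finally show ?thesis by (simp add: mult_left_mono)
qed

text \<open>\<open>D\<close> will be the dimension: thresholds are indexed by the measures 2^(D k),
  the frequency volume belonging to scale 2^-k.\<close>

locale lorentz_function =
  fixes M :: "'a measure" and g :: "'a \<Rightarrow> complex" and p q D :: real
  assumes meas [measurable]: "g \<in> borel_measurable M" and p: "2 < p" and q: "1 \<le> q" and D: "0 < D"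
    and fin: "lorentz_qnorm_pow p q M g < top"
begin

section \<open>Dyadic heights and the finiteness of the Lorentz functional\<close>

definition energy :: ennreal where
  "energy = (\<integral>\<^sup>+ t. indicator {0<..} t * epow (distrib_fun M g t * ennreal (t powr p)) (q / p) * ennreal (1 / t) \<partial>lborel)"

lemma energy_finite: "energy < top"
  using fin q unfolding lorentz_qnorm_pow_def energy_def[symmetric]
  by (auto simp: ennreal_mult_less_top)

text \<open>Strict, unlike \<open>distrib_fun\<close>: these sets are increasing unions of the sets
  at larger heights, which lets \<open>emeasure_over_level\<close> hold at the infimum
  itself.\<close>

definition over :: "real \<Rightarrow> 'a set" where
  "over t = {x \<in> space M. cmod (g x) > t}"

lemma sets_over [measurable]: "over t \<in> sets M"
  unfolding over_def by measurable

lemma over_antimono: "s \<le> t \<Longrightarrow> over t \<subseteq> over s"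
  by (auto simp: over_def)

lemma over_le_distrib: "emeasure M (over t) \<le> distrib_fun M g t"
  unfolding over_def distrib_fun_def by (rule emeasure_mono) auto

lemma distrib_antimono: "s \<le> t \<Longrightarrow> distrib_fun M g t \<le> distrib_fun M g s"
  unfolding distrib_fun_def by (rule emeasure_mono) auto

text \<open>The decreasing rearrangement of \<bar>g\<bar> at measure 2^(D k).\<close>

definition level :: "int \<Rightarrow> real" where
  "level k = Inf {t. 0 \<le> t \<and> emeasure M (over t) \<le> ennreal (2 powr (D * k))}"

text \<open>A Chebyshev argument: as the distribution function is antitone, the heights between T/2
  and T alone contribute at least half of (m (T/2)^p)^(q/p) to the energy, where m is its value at
  T. So m is small for large T.\<close>

lemma level_set_nonempty: "{t. 0 \<le> t \<and> emeasure M (over t) \<le> ennreal (2 powr (D * of_int k))} \<noteq> {}"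
proof -
  define e where "e = 2 powr (D * of_int k)"
  have e: "e > 0" by (simp add: e_def)
  obtain E where E: "energy = ennreal E" "E \<ge> 0" using energy_finite by (cases energy) auto
  define J where "J = (2 * E) powr (p / q)"
  \<comment> \<open>Then T/2 \<ge> 1, so (T/2)^p \<ge> T/2, and m (J/e + 1) \<le> J forces m \<le>
    e.\<close>
  define T where "T = 2 * (J / e + 1)"
  have J: "J \<ge> 0" by (simp add: J_def)
  have T: "T / 2 \<ge> 1" "T > 0" using J e by (auto simp: T_def add_nonneg_pos)
  let ?c = "epow (distrib_fun M g T * ennreal ((T / 2) powr p)) (q / p)"
  have "?c * ennreal (1 / T) * ennreal (T / 2) = (\<integral>\<^sup>+ t. ?c * ennreal (1 / T) * indicator {T/2<..<T} t \<partial>lborel)"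
    using T by (simp add: nn_integral_cmult_indicator)
  also have "\<dots> \<le> energy"
    unfolding energy_def
  proof (rule nn_integral_mono)
    fix t
    show "?c * ennreal (1 / T) * indicator {T/2<..<T} t \<le> indicator {0<..} t * epow (distrib_fun M g t * ennreal (t powr p)) (q / p) * ennreal (1 / t)"
    proof (cases "t \<in> {T/2<..<T}")
      case True
      then have "?c \<le> epow (distrib_fun M g t * ennreal (t powr p)) (q / p)"
        using T p q by (intro epow_mono mult_mono distrib_antimono ennreal_leI powr_mono2) auto
      moreover have "ennreal (1 / T) \<le> ennreal (1 / t)" using True T by (intro ennreal_leI) (auto simp: field_simps)
      ultimately show ?thesis using True T by (auto intro!: mult_mono)
    qed simp
  qed
  finally have "?c * (ennreal (1 / T) * ennreal (T / 2)) \<le> ennreal E" using E by (simp add: mult.assoc)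
  then have "?c * ennreal (1 / 2) \<le> ennreal E" using T by (simp add: ennreal_mult[symmetric])
  then have "?c * (ennreal (1 / 2) * ennreal 2) \<le> ennreal E * ennreal 2" by (subst mult.assoc[symmetric]) (rule mult_right_mono, auto)
  then have c: "?c \<le> ennreal (2 * E)"
    using E by (simp only: ennreal_mult[symmetric]) (simp add: mult.commute)
  have nt: "distrib_fun M g T * ennreal ((T / 2) powr p) \<noteq> top" using c by (auto simp: epow_def top_unique)
  then have mt: "distrib_fun M g T \<noteq> top" using T by (auto simp: ennreal_top_mult)
  then obtain m where m: "distrib_fun M g T = ennreal m" "m \<ge> 0" by (cases "distrib_fun M g T") auto
  have "(m * (T / 2) powr p) powr (q / p) \<le> 2 * E"
    using c m E by (simp add: ennreal_mult[symmetric] epow_ennreal)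
  then have "((m * (T / 2) powr p) powr (q / p)) powr (p / q) \<le> J"
    unfolding J_def using p q by (intro powr_mono2) auto
  then have mJ: "m * (T / 2) powr p \<le> J" using p q m by (simp add: powr_powr)
  have "T / 2 = (T / 2) powr 1" using T by simp
  also have "\<dots> \<le> (T / 2) powr p" using T p by (intro powr_mono) auto
  finally have "m * (T / 2) \<le> J" using mJ m by (meson mult_left_mono order_trans)
  moreover have "T / 2 = J / e + 1" by (simp add: T_def)
  ultimately have "m * (J / e + 1) \<le> J" by simp
  then have "m * (J + e) \<le> e * J" using e by (simp add: field_simps)
  also have "\<dots> \<le> e * (J + e)" using e by simp
  finally have "m \<le> e" using J e by (simp add: add_nonneg_pos)
  then have "emeasure M (over T) \<le> ennreal e"
    using over_le_distrib[of T] m by (auto intro: order_trans[OF _ ennreal_leI])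
  then show ?thesis using T unfolding e_def by (auto intro!: exI[of _ T])
qed

lemma level_nonneg: "0 \<le> level k"
  unfolding level_def by (rule cInf_greatest[OF level_set_nonempty]) auto

lemma emeasure_over_gt:
  assumes "0 \<le> t" "t < level k" shows "ennreal (2 powr (D * k)) < emeasure M (over t)"
proof (rule ccontr)
  assume "\<not> ?thesis"
  then have "level k \<le> t" unfolding level_def using assms(1)
    by (intro cInf_lower) (auto simp: bdd_below_def)
  then show False using assms by simp
qed

lemma emeasure_over_level: "emeasure M (over (level k)) \<le> ennreal (2 powr (D * k))"
proof -
  have U: "over (level k) = (\<Union>n. over (level k + 1 / real (Suc n)))"
  proof (intro equalityI subsetI)
    fix x assume x: "x \<in> over (level k)"
    then have "cmod (g x) - level k > 0" by (simp add: over_def)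
    then obtain n where "inverse (real (Suc n)) < cmod (g x) - level k" using reals_Archimedean by blast
    then show "x \<in> (\<Union>n. over (level k + 1 / real (Suc n)))"
      using x by (auto simp: over_def inverse_eq_divide intro!: exI[of _ n])
  next
    fix x assume "x \<in> (\<Union>n. over (level k + 1 / real (Suc n)))"
    then obtain n where "x \<in> over (level k + 1 / real (Suc n))" by blast
    then show "x \<in> over (level k)" using over_antimono[of "level k" "level k + 1 / real (Suc n)"] by auto
  qed
  have "emeasure M (over (level k + 1 / real (Suc n))) \<le> ennreal (2 powr (D * k))" for n
  proof -
    have "Inf {t. 0 \<le> t \<and> emeasure M (over t) \<le> ennreal (2 powr (D * k))} < level k + 1 / real (Suc n)"
      unfolding level_def by simp
    then obtain t where t: "emeasure M (over t) \<le> ennreal (2 powr (D * k))" "t < level k + 1 / real (Suc n)"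
      using cInf_lessD[OF level_set_nonempty] by blast
    then show ?thesis using emeasure_mono[OF over_antimono[of t "level k + 1 / real (Suc n)"] sets_over]
      by (meson less_imp_le order_trans)
  qed
  moreover have "incseq (\<lambda>n. over (level k + 1 / real (Suc n)))"
    by (intro incseq_SucI over_antimono) (simp add: field_simps)
  then have "emeasure M (over (level k)) = (SUP n. emeasure M (over (level k + 1 / real (Suc n))))"
    unfolding U by (intro SUP_emeasure_incseq[symmetric]) auto
  ultimately show ?thesis by (auto intro: SUP_least)
qed

text \<open>The discrete form of the Lorentz norm. Each (level k / 2)^q is at most the integral of
  t^(q-1) over 0 < t < level k, using q \<ge> 1. After exchanging sum and integral, the indices with
  level k > t form a geometric sum dominated by the largest of them, whose measure 2^(D k) lies
  below the distribution function at t.\<close>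

lemma level_sum_bound: "\<exists>C\<ge>0. \<forall>F. finite F \<longrightarrow> (\<Sum>k\<in>F. (level k * 2 powr (D * k / p)) powr q) \<le> C"
proof -
  obtain E where E: "energy = ennreal E" "E \<ge> 0" using energy_finite by (cases energy) auto
  define r where "r = 2 powr (D * q / p)"
  have r: "r > 1" using D p q unfolding r_def by (intro gr_one_powr) auto
  define c where "c = 1 / (1 - 1 / r)"
  have c: "c > 0" using r by (simp add: c_def)
  have bound: "(\<Sum>k\<in>F. r powr k * (level k / 2) powr q) \<le> c * E" if F: "finite F" for F
  proof -
    have "ennreal (\<Sum>k\<in>F. r powr k * (level k / 2) powr q) = (\<Sum>k\<in>F. ennreal (r powr k) * ennreal ((level k / 2) powr q))"
      by (subst sum_ennreal[symmetric]) (auto simp: ennreal_mult)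
    also have "\<dots> \<le> (\<Sum>k\<in>F. ennreal (r powr k) * (\<integral>\<^sup>+t. ennreal (t powr q / t) * indicator {0<..<level k} t \<partial>lborel))"
    proof (intro sum_mono mult_left_mono)
      fix k
      have "ennreal ((level k / 2) powr q) \<le> (\<integral>\<^sup>+t. ennreal ((level k / 2) powr (q - 1)) * indicator {level k / 2<..<level k} t \<partial>lborel)"
        using level_nonneg[of k]
        by (cases "level k = 0") (auto simp: nn_integral_cmult_indicator ennreal_mult[symmetric] powr_diff)
      also have "\<dots> \<le> (\<integral>\<^sup>+t. ennreal (t powr q / t) * indicator {0<..<level k} t \<partial>lborel)"
      proof (rule nn_integral_mono)
        fix t
        show "ennreal ((level k / 2) powr (q - 1)) * indicator {level k / 2<..<level k} t \<le> ennreal (t powr q / t) * indicator {0<..<level k} t"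
        proof (cases "t \<in> {level k / 2<..<level k}")
          case True
          then have "0 < t" using level_nonneg[of k] by auto
          moreover have "(level k / 2) powr (q - 1) \<le> t powr (q - 1)"
            using True q level_nonneg[of k] by (intro powr_mono2) auto
          ultimately show ?thesis using True by (auto simp: powr_diff intro: ennreal_leI)
        qed simp
      qed
      finally show "ennreal ((level k / 2) powr q) \<le> (\<integral>\<^sup>+t. ennreal (t powr q / t) * indicator {0<..<level k} t \<partial>lborel)" .
    qed auto
    also have "\<dots> = (\<integral>\<^sup>+t. (\<Sum>k\<in>F. ennreal (r powr k) * (ennreal (t powr q / t) * indicator {0<..<level k} t)) \<partial>lborel)"
      by (simp add: nn_integral_sum nn_integral_cmult)
    also have "\<dots> \<le> ennreal c * energy"
      unfolding energy_def
    proof (rule nn_integral_le_cmult[OF _ c])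
      fix t :: real
      define F' where "F' = {k\<in>F. 0 < t \<and> t < level k}"
      show "(\<Sum>k\<in>F. ennreal (r powr k) * (ennreal (t powr q / t) * indicator {0<..<level k} t)) \<le> ennreal c * (indicator {0<..} t * epow (distrib_fun M g t * ennreal (t powr p)) (q / p) * ennreal (1 / t))"
      proof (cases "F' = {}")
        case True
        then have "(\<Sum>k\<in>F. ennreal (r powr k) * (ennreal (t powr q / t) * indicator {0<..<level k} t)) = 0"
          by (intro sum.neutral) (auto simp: F'_def indicator_def)
        then show ?thesis by simp
      next
        case False
        have fF: "finite F'" using F by (simp add: F'_def)
        have t: "t > 0" using False by (auto simp: F'_def)
        define k0 where "k0 = Max F'"
        have k0: "k0 \<in> F'" "\<And>k. k \<in> F' \<Longrightarrow> k \<le> k0" using fF False by (auto simp: k0_def)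
        have "(\<Sum>k\<in>F. ennreal (r powr k) * (ennreal (t powr q / t) * indicator {0<..<level k} t)) = (\<Sum>k\<in>F'. ennreal (r powr k) * ennreal (t powr q / t))"
          unfolding F'_def using F t by (subst sum.inter_filter) (auto intro!: sum.cong simp: indicator_def)
        also have "\<dots> = ennreal (\<Sum>k\<in>F'. r powr k) * ennreal (t powr q / t)"
          by (simp add: sum_distrib_right[symmetric] sum_ennreal)
        also have "\<dots> \<le> ennreal (r powr k0 * c) * ennreal (t powr q / t)"
          using sum_powr_int_le[OF r fF k0(2)] unfolding c_def by (intro mult_right_mono ennreal_leI) auto
        also have "\<dots> = ennreal c * (ennreal (r powr k0 * t powr q) * ennreal (1 / t))"
          using c t by (simp add: ennreal_mult[symmetric] mult_ac)
        also have "\<dots> \<le> ennreal c * (epow (distrib_fun M g t * ennreal (t powr p)) (q / p) * ennreal (1 / t))"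
        proof (intro mult_left_mono mult_right_mono)
          have "ennreal (2 powr (D * k0)) \<le> distrib_fun M g t"
            using emeasure_over_gt[of t k0] k0(1) t over_le_distrib[of t] by (auto simp: F'_def)
          then have "epow (ennreal (2 powr (D * k0)) * ennreal (t powr p)) (q / p) \<le> epow (distrib_fun M g t * ennreal (t powr p)) (q / p)"
            using p q by (intro epow_mono mult_right_mono) auto
          moreover have "epow (ennreal (2 powr (D * k0)) * ennreal (t powr p)) (q / p) = ennreal (r powr k0 * t powr q)"
            using p t by (simp add: ennreal_mult'[symmetric] epow_ennreal powr_mult powr_powr r_def mult_ac)
          ultimately show "ennreal (r powr k0 * t powr q) \<le> epow (distrib_fun M g t * ennreal (t powr p)) (q / p)" by simp
        qed auto
        finally show ?thesis using t by (simp add: mult_ac)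
      qed
    qed measurable
    also have "\<dots> = ennreal (c * E)" using c E by (simp add: ennreal_mult)
    finally show ?thesis using c E by (subst (asm) ennreal_le_iff) auto
  qed
  show ?thesis
  proof (intro exI[of _ "2 powr q * (c * E)"] conjI allI impI)
    fix F :: "int set" assume F: "finite F"
    have "(level k * 2 powr (D * k / p)) powr q = 2 powr q * (r powr k * (level k / 2) powr q)" for k
      using level_nonneg[of k] by (simp add: powr_mult powr_divide r_def powr_powr mult_ac)
    then have "(\<Sum>k\<in>F. (level k * 2 powr (D * k / p)) powr q) = 2 powr q * (\<Sum>k\<in>F. r powr k * (level k / 2) powr q)"
      by (simp add: sum_distrib_left)
    also have "\<dots> \<le> 2 powr q * (c * E)" by (intro mult_left_mono bound F) auto
    finally show "(\<Sum>k\<in>F. (level k * 2 powr (D * k / p)) powr q) \<le> 2 powr q * (c * E)" .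
  qed (use c E in auto)
qed

text \<open>A dyadic layer decomposition. Almost every x in \<open>over (level k)\<close> has a
  least i with \<bar>g(x)\<bar> \<le> level (k-i-1); minimality puts x in
  \<open>over (level (k-i))\<close>, of measure at most 2^(D (k-i)). Points above all the levels lie
  in sets of measure 2^(-D n) for every n, hence in a null set.\<close>

lemma tail_square_le:
  "(\<integral>\<^sup>+x. ennreal ((cmod (g x))\<^sup>2) * indicator (over (level k)) x \<partial>M)
    \<le> (\<Sum>i. ennreal ((level (k - int i - 1))\<^sup>2 * 2 powr (D * (k - int i))))"
proof -
  have "AE x in M. \<exists>j. cmod (g x) \<le> level j"
  proof (rule AE_I')
    let ?N = "\<Inter>n. over (level (- int n))"
    have "emeasure M ?N \<le> ennreal e" if e0: "e > 0" for e
    proof -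
      define r where "r = 1 / 2 powr D"
      have "r < 1" "r > 0" using D by (auto simp: r_def intro!: gr_one_powr)
      then obtain n where n: "r ^ n < e" using real_arch_pow_inv[OF e0] by blast
      have "emeasure M ?N \<le> emeasure M (over (level (- int n)))"
        by (intro emeasure_mono) auto
      also have "\<dots> \<le> ennreal (2 powr (D * (- int n)))" using emeasure_over_level[of "- int n"] by simp
      also have "2 powr (D * (- int n)) = r ^ n"
        by (simp add: r_def powr_minus powr_powr[symmetric] powr_realpow power_one_over inverse_eq_divide)
      also have "ennreal (r ^ n) \<le> ennreal e" using n by (intro ennreal_leI) auto
      finally show ?thesis .
    qed
    then have "emeasure M ?N \<le> 0 + ennreal e" if "e > 0" for e using that by (simp only: add_0)
    then have "emeasure M ?N \<le> 0" using ennreal_le_epsilon[of 0 "emeasure M ?N"] by blast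
    moreover have "?N \<in> sets M" by (intro sets.countable_INT) auto
    ultimately show "?N \<in> null_sets M" by (simp add: null_sets_def)
    show "{x \<in> space M. \<not> (\<exists>j. cmod (g x) \<le> level j)} \<subseteq> ?N"
      by (auto simp: over_def not_le)
  qed
  then have "(\<integral>\<^sup>+x. ennreal ((cmod (g x))\<^sup>2) * indicator (over (level k)) x \<partial>M)
     \<le> (\<integral>\<^sup>+x. (\<Sum>i. ennreal ((level (k - int i - 1))\<^sup>2) * indicator (over (level (k - int i))) x) \<partial>M)"
  proof (intro nn_integral_mono_AE, elim AE_mp, intro AE_I2 impI)
    fix x assume x: "x \<in> space M" and ex: "\<exists>j. cmod (g x) \<le> level j"
    show "ennreal ((cmod (g x))\<^sup>2) * indicator (over (level k)) x
      \<le> (\<Sum>i. ennreal ((level (k - int i - 1))\<^sup>2) * indicator (over (level (k - int i))) x)"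
    proof (cases "x \<in> over (level k)")
      case True
      obtain j where j: "cmod (g x) \<le> level j" using ex by blast
      have jk: "j < k"
      proof (rule ccontr)
        assume "\<not> j < k"
        have "level j \<le> level k"
        proof (rule ccontr)
          assume "\<not> level j \<le> level k"
          then have "ennreal (2 powr (D * j)) < emeasure M (over (level k))"
            using level_nonneg by (intro emeasure_over_gt) auto
          also have "\<dots> \<le> ennreal (2 powr (D * k))" by (rule emeasure_over_level)
          also have "\<dots> \<le> ennreal (2 powr (D * j))" using \<open>\<not> j < k\<close> D by (intro ennreal_leI powr_mono mult_left_mono) auto
          finally show False by simp
        qed
        then show False using j True by (simp add: over_def)
      qed
      define P where "P i \<longleftrightarrow> cmod (g x) \<le> level (k - int i - 1)" for i
      have "P (nat (k - 1 - j))" using j jk by (simp add: P_def)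
      define i where "i = (LEAST i. P i)"
      have Pi: "P i" unfolding i_def by (rule LeastI) fact
      have xi: "x \<in> over (level (k - int i))"
      proof (cases i)
        case 0 then show ?thesis using True by simp
      next
        case (Suc i')
        then have "\<not> P i'" unfolding i_def using not_less_Least[of i' P] by auto
        moreover have "k - int i' - 1 = k - int i" using Suc by simp
        ultimately show ?thesis using x by (simp add: P_def over_def)
      qed
      have "ennreal ((cmod (g x))\<^sup>2) \<le> ennreal ((level (k - int i - 1))\<^sup>2)"
        using Pi by (intro ennreal_leI power_mono) (auto simp: P_def)
      also have "\<dots> = (\<Sum>i\<in>{i}. ennreal ((level (k - int i - 1))\<^sup>2) * indicator (over (level (k - int i))) x)"
        using xi by simp
      also have "\<dots> \<le> (\<Sum>i. ennreal ((level (k - int i - 1))\<^sup>2) * indicator (over (level (k - int i))) x)"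
        by (rule sum_le_suminf) auto
      finally show ?thesis using True by simp
    qed simp
  qed
  also have "\<dots> = (\<Sum>i. ennreal ((level (k - int i - 1))\<^sup>2) * emeasure M (over (level (k - int i))))"
    by (subst nn_integral_suminf) (auto simp: nn_integral_cmult_indicator)
  also have "\<dots> \<le> (\<Sum>i. ennreal ((level (k - int i - 1))\<^sup>2 * 2 powr (D * (k - int i))))"
  proof (intro suminf_le)
    fix i
    show "ennreal ((level (k - int i - 1))\<^sup>2) * emeasure M (over (level (k - int i))) \<le> ennreal ((level (k - int i - 1))\<^sup>2 * 2 powr (D * (k - int i)))"
      using emeasure_over_level[of "k - int i"] by (simp add: ennreal_mult mult_left_mono)
  qed auto
  finally show ?thesis .
qed

text \<open>The sum bounding the tail is a convolution with a geometric sequence. Replacing the sequence by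
  its envelope, which is controlled by the sum of q-th powers, avoids Young's inequality.\<close>

lemma thresholds:
  "\<exists>(lam :: nat \<Rightarrow> real) (w :: nat \<Rightarrow> real). (\<forall>k. 0 \<le> lam k \<and> 0 \<le> w k) \<and> summable (\<lambda>k. w k powr q) \<and>
     (\<forall>k. \<exists>G\<ge>0. (\<integral>\<^sup>+x. ennreal ((cmod (g x))\<^sup>2) * indicator {x \<in> space M. cmod (g x) > lam k} x \<partial>M) \<le> ennreal (G\<^sup>2) \<and>
        2 powr (- D * (1 / 2 - 1 / p) * k) * G + lam k * 2 powr (D * k / p) \<le> w k)"
proof -
  define \<theta> where "\<theta> = 1 - 2 / p"
  have \<theta>: "\<theta> > 0" using p by (simp add: \<theta>_def)
  \<comment> \<open>Relative to the squared normalised levels \<open>\<nu>\<close>, the i-th tail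
    term decays like 2^(-D \<theta> i), the fourth power of \<open>\<sigma> ^ i\<close>. Half of
    this decay goes into the squares of \<open>\<mu>\<close>; the other half keeps the series in i
    convergent.\<close>
  define \<sigma> where "\<sigma> = 2 powr (- D * \<theta> / 4)"
  have \<sigma>: "0 < \<sigma>" "\<sigma> < 1" unfolding \<sigma>_def using D \<theta> by (auto intro!: powr_less_one)
  define \<nu> where "\<nu> k = level k * 2 powr (D * k / p)" for k :: int
  have \<nu>0: "\<nu> k \<ge> 0" for k using level_nonneg by (simp add: \<nu>_def)
  obtain C where C: "C \<ge> 0" "\<And>F. finite F \<Longrightarrow> (\<Sum>k\<in>F. \<nu> k powr q) \<le> C"
    using level_sum_bound unfolding \<nu>_def by blast
  define \<mu> where "\<mu> k i = \<sigma> ^ i * \<nu> (int k - int i - 1)" for k i :: nat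
  have \<mu>0: "\<mu> k i \<ge> 0" for k i using \<nu>0 \<sigma> by (simp add: \<mu>_def)
  have \<mu>q: "\<mu> k i powr q = (\<sigma> powr q) ^ i * \<nu> (int k - int i - 1) powr q" for k i
    using \<sigma> \<nu>0 by (simp add: \<mu>_def powr_mult powr_realpow[symmetric] powr_powr mult.commute)
  have \<sigma>q: "0 < \<sigma> powr q" "\<sigma> powr q < 1" using \<sigma> q powr_less_mono2[of q \<sigma> 1] by auto
  have \<nu>C: "\<nu> k powr q \<le> C" for k using C(2)[of "{k}"] by simp
  have s\<mu>: "summable (\<lambda>i. \<mu> k i powr q)" for k
  proof (rule summable_comparison_test')
    show "summable (\<lambda>i. C * (\<sigma> powr q) ^ i)" using \<sigma>q by (intro summable_mult summable_geometric) auto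
    show "norm (\<mu> k i powr q) \<le> C * (\<sigma> powr q) ^ i" for i
      unfolding \<mu>q using mult_right_mono[OF \<nu>C, of "(\<sigma> powr q) ^ i"] \<sigma>q by (simp add: mult.commute)
  qed
  define E where "E k = (\<Sum>i. \<mu> k i powr q)" for k
  have E0: "E k \<ge> 0" for k unfolding E_def by (intro suminf_nonneg s\<mu>) auto
  have \<mu>E: "\<mu> k i \<le> E k powr (1 / q)" for k i
  proof -
    have "\<mu> k i powr q \<le> E k" unfolding E_def using sum_le_suminf[OF s\<mu>, of "{i}" k] by simp
    then have "(\<mu> k i powr q) powr (1 / q) \<le> E k powr (1 / q)" using q by (intro powr_mono2) auto
    then show ?thesis using q \<mu>0[of k i] by (simp add: powr_powr)
  qed
  \<comment> \<open>For fixed i the shifted indices are distinct, so summing over k first leaves at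
    most C times a geometric term in i.\<close>
  have sE: "summable E"
  proof (rule summableI_nonneg_bounded)
    fix N
    have "(\<Sum>k<N. E k) = (\<Sum>i. \<Sum>k<N. \<mu> k i powr q)"
      unfolding E_def by (rule suminf_sum[symmetric]) (rule s\<mu>)
    also have "\<dots> \<le> (\<Sum>i. C * (\<sigma> powr q) ^ i)"
    proof (rule suminf_le)
      show "(\<Sum>k<N. \<mu> k i powr q) \<le> C * (\<sigma> powr q) ^ i" for i
      proof -
        have "(\<Sum>k<N. \<nu> (int k - int i - 1) powr q) = (\<Sum>k\<in>(\<lambda>k. int k - int i - 1) ` {..<N}. \<nu> k powr q)"
          by (subst sum.reindex) (auto simp: inj_on_def)
        also have "\<dots> \<le> C" by (rule C(2)) auto
        finally show ?thesis unfolding \<mu>q sum_distrib_left[symmetric]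
          using \<sigma>q by (simp add: mult.commute mult_right_mono)
      qed
      show "summable (\<lambda>i. \<Sum>k<N. \<mu> k i powr q)" by (intro summable_sum s\<mu>)
      show "summable (\<lambda>i. C * (\<sigma> powr q) ^ i)" using \<sigma>q by (intro summable_mult summable_geometric) auto
    qed
    finally show "(\<Sum>k<N. E k) \<le> (\<Sum>i. C * (\<sigma> powr q) ^ i)" .
  qed (rule E0)
  have s\<nu>: "summable (\<lambda>k::nat. \<nu> (int k) powr q)"
  proof (rule summableI_nonneg_bounded)
    fix N
    have "(\<Sum>k<N. \<nu> (int k) powr q) = (\<Sum>k\<in>int ` {..<N}. \<nu> k powr q)" by (subst sum.reindex) auto
    also have "\<dots> \<le> C" by (rule C(2)) auto
    finally show "(\<Sum>k<N. \<nu> (int k) powr q) \<le> C" .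
  qed auto
  \<comment> \<open>\<open>2 powr (D / p)\<close> is the cost of the shift by one in the index k - i
    - 1, and the root is the geometric series in \<sigma>^2.\<close>
  define c where "c = 2 powr (D / p) * sqrt (1 / (1 - \<sigma>\<^sup>2))"
  have \<sigma>2: "\<sigma>\<^sup>2 < 1" using \<sigma> by (simp add: power_less_one_iff)
  have c0: "c \<ge> 0" using \<sigma>2 by (simp add: c_def)
  define w where "w k = c * E k powr (1 / q) + \<nu> (int k)" for k
  have w0: "w k \<ge> 0" for k using c0 \<nu>0 by (simp add: w_def)
  have sw: "summable (\<lambda>k. w k powr q)"
  proof (rule summable_comparison_test')
    show "summable (\<lambda>k. 2 powr q * (c powr q * E k + \<nu> (int k) powr q))"
      by (intro summable_mult summable_add sE s\<nu>)
    show "norm (w k powr q) \<le> 2 powr q * (c powr q * E k + \<nu> (int k) powr q)" for k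
      using add_powr_le[of "c * E k powr (1 / q)" "\<nu> (int k)" q] c0 \<nu>0 q E0[of k] unfolding w_def
      by (simp add: powr_mult powr_powr)
  qed
  have G: "(\<integral>\<^sup>+x. ennreal ((cmod (g x))\<^sup>2) * indicator (over (level (int k))) x \<partial>M) \<le> ennreal ((2 powr (D * \<theta> / 2 * k) * (c * E k powr (1 / q)))\<^sup>2)" for k
  proof -
    define X where "X = E k powr (1 / q)"
    have summand: "(level (int k - int i - 1))\<^sup>2 * 2 powr (D * (int k - int i)) = 2 powr (2 * D / p) * 2 powr (D * \<theta> * k) * (\<sigma>\<^sup>2) ^ i * (\<mu> k i)\<^sup>2" for i
    proof -
      define j where "j = int k - int i - 1"
      have "(\<mu> k i)\<^sup>2 = (\<sigma>\<^sup>2) ^ i * (level j)\<^sup>2 * 2 powr (2 * D * j / p)"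
        by (simp add: \<mu>_def \<nu>_def j_def[symmetric] power_mult_distrib power_mult[symmetric] powr_power mult_ac)
      moreover have "(\<sigma>\<^sup>2) ^ i = 2 powr (- D * \<theta> / 2 * i)"
        by (simp add: \<sigma>_def powr_power mult_ac)
      ultimately have "2 powr (2 * D / p) * 2 powr (D * \<theta> * k) * (\<sigma>\<^sup>2) ^ i * (\<mu> k i)\<^sup>2
         = (level j)\<^sup>2 * (2 powr (2 * D / p) * 2 powr (D * \<theta> * k) * 2 powr (- D * \<theta> / 2 * i) * 2 powr (- D * \<theta> / 2 * i) * 2 powr (2 * D * j / p))"
        by (simp add: mult_ac)
      also have "2 powr (2 * D / p) * 2 powr (D * \<theta> * k) * 2 powr (- D * \<theta> / 2 * i) * 2 powr (- D * \<theta> / 2 * i) * 2 powr (2 * D * j / p)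
         = 2 powr (2 * D / p + D * \<theta> * k + (- D * \<theta> / 2 * i) + (- D * \<theta> / 2 * i) + 2 * D * j / p)"
        by (simp only: powr_add)
      also have "2 * D / p + D * \<theta> * k + (- D * \<theta> / 2 * i) + (- D * \<theta> / 2 * i) + 2 * D * j / p = D * (int k - int i)"
        using p by (simp add: \<theta>_def j_def field_simps)
      finally show ?thesis by (simp add: j_def)
    qed
    have "(\<integral>\<^sup>+x. ennreal ((cmod (g x))\<^sup>2) * indicator (over (level (int k))) x \<partial>M)
       \<le> (\<Sum>i. ennreal ((level (int k - int i - 1))\<^sup>2 * 2 powr (D * (int k - int i))))" using tail_square_le[of "int k"] by simp
    also have "\<dots> \<le> (\<Sum>i. ennreal ((2 powr (2 * D / p) * 2 powr (D * \<theta> * k) * X\<^sup>2) * (\<sigma>\<^sup>2) ^ i))"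
    proof (intro suminf_le ennreal_leI)
      fix i
      have "(\<mu> k i)\<^sup>2 \<le> X\<^sup>2" unfolding X_def by (intro power_mono \<mu>E \<mu>0)
      then have "2 powr (2 * D / p) * 2 powr (D * \<theta> * k) * (\<sigma>\<^sup>2) ^ i * (\<mu> k i)\<^sup>2 \<le> 2 powr (2 * D / p) * 2 powr (D * \<theta> * k) * (\<sigma>\<^sup>2) ^ i * X\<^sup>2"
        by (intro mult_left_mono) auto
      then show "(level (int k - int i - 1))\<^sup>2 * 2 powr (D * (int k - int i)) \<le> (2 powr (2 * D / p) * 2 powr (D * \<theta> * k) * X\<^sup>2) * (\<sigma>\<^sup>2) ^ i"
        unfolding summand by (simp only: mult_ac)
    qed auto
    also have "\<dots> = ennreal (\<Sum>i. (2 powr (2 * D / p) * 2 powr (D * \<theta> * k) * X\<^sup>2) * (\<sigma>\<^sup>2) ^ i)"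
      using \<sigma>2 by (intro suminf_ennreal2 summable_mult summable_geometric) auto
    also have "(\<Sum>i. (2 powr (2 * D / p) * 2 powr (D * \<theta> * k) * X\<^sup>2) * (\<sigma>\<^sup>2) ^ i) = 2 powr (2 * D / p) * 2 powr (D * \<theta> * k) * X\<^sup>2 * (1 / (1 - \<sigma>\<^sup>2))"
      using \<sigma>2 by (subst suminf_mult) (auto simp: suminf_geometric summable_geometric)
    also have "\<dots> = (2 powr (D * \<theta> / 2 * k) * (c * X))\<^sup>2"
      using \<sigma>2 by (simp add: c_def power_mult_distrib powr_power mult_ac)
    finally show ?thesis by (simp add: X_def)
  qed
  have fin: "\<exists>G\<ge>0. (\<integral>\<^sup>+x. ennreal ((cmod (g x))\<^sup>2) * indicator {x \<in> space M. cmod (g x) > level (int k)} x \<partial>M) \<le> ennreal (G\<^sup>2) \<and>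
        2 powr (- D * (1 / 2 - 1 / p) * k) * G + level (int k) * 2 powr (D * k / p) \<le> w k" for k :: nat
    proof (intro exI[of _ "2 powr (D * \<theta> / 2 * k) * (c * E k powr (1 / q))"] conjI)
      show "(\<integral>\<^sup>+x. ennreal ((cmod (g x))\<^sup>2) * indicator {x \<in> space M. cmod (g x) > level (int k)} x \<partial>M) \<le> ennreal ((2 powr (D * \<theta> / 2 * k) * (c * E k powr (1 / q)))\<^sup>2)"
        using G[of k] by (simp add: over_def)
      have "2 powr (- D * (1 / 2 - 1 / p) * k) * 2 powr (D * \<theta> / 2 * k) = 2 powr (- D * (1 / 2 - 1 / p) * k + D * \<theta> / 2 * k)"
        by (simp only: powr_add)
      also have "- D * (1 / 2 - 1 / p) * k + D * \<theta> / 2 * k = 0" by (simp add: \<theta>_def field_simps)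
      finally have "2 powr (- D * (1 / 2 - 1 / p) * k) * 2 powr (D * \<theta> / 2 * k) = 1" by simp
      then have "2 powr (- D * (1 / 2 - 1 / p) * k) * (2 powr (D * \<theta> / 2 * k) * (c * E k powr (1 / q))) = c * E k powr (1 / q)"
        by (simp only: mult.assoc[symmetric] mult_1)
      then show "2 powr (- D * (1 / 2 - 1 / p) * k) * (2 powr (D * \<theta> / 2 * k) * (c * E k powr (1 / q))) + level (int k) * 2 powr (D * k / p) \<le> w k"
        unfolding w_def \<nu>_def by (simp only: order_refl of_int_of_nat_eq)
    qed (use c0 in auto)
  show ?thesis
    by (intro exI[of _ "\<lambda>k. level (int k)"] exI[of _ w] conjI allI level_nonneg w0 sw fin)
qed

end


section \<open>Uniqueness: vanishing against all Fourier transforms of test functions\<close>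

text \<open>The positive and negative parts, taken as densities, give measures that agree on boxes,
  an intersection-stable generator; equal measures have densities that agree almost
  everywhere.\<close>

lemma AE_zero_of_box_integrals_real:
  fixes f :: "'a::euclidean_space \<Rightarrow> real"
  assumes [measurable]: "f \<in> borel_measurable borel"
    and int: "\<And>a b. integrable lborel (\<lambda>x. indicator (box a b) x * f x)"
    and zero: "\<And>a b. (\<integral>x. indicator (box a b) x * f x \<partial>lborel) = 0"
  shows "AE x in lborel. f x = 0"
proof -
  let ?p = "\<lambda>x. ennreal (f x)" and ?n = "\<lambda>x. ennreal (- f x)"
  let ?E = "range (\<lambda>(a, b). box a b::'a set)"
  have fin: "(\<integral>\<^sup>+x. ?p x * indicator (box a b) x \<partial>lborel) \<noteq> \<infinity>" for a b
  proof -
    have "(\<integral>\<^sup>+x. ?p x * indicator (box a b) x \<partial>lborel) \<le> (\<integral>\<^sup>+x. ennreal (norm (indicator (box a b) x * f x)) \<partial>lborel)"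
      by (intro nn_integral_mono) (auto simp: indicator_def intro!: ennreal_leI)
    also have "\<dots> < \<infinity>" using int[of a b] by (simp add: integrable_iff_bounded)
    finally show ?thesis by simp
  qed
  have eq: "(\<integral>\<^sup>+x. ?p x * indicator (box a b) x \<partial>lborel) = (\<integral>\<^sup>+x. ?n x * indicator (box a b) x \<partial>lborel)" for a b
  proof -
    let ?h = "\<lambda>x. indicator (box a b) x * f x"
    have p: "(\<integral>\<^sup>+x. ?p x * indicator (box a b) x \<partial>lborel) = (\<integral>\<^sup>+x. ennreal (?h x) \<partial>lborel)"
      by (intro nn_integral_cong) (auto simp: indicator_def)
    have n: "(\<integral>\<^sup>+x. ?n x * indicator (box a b) x \<partial>lborel) = (\<integral>\<^sup>+x. ennreal (- ?h x) \<partial>lborel)"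
      by (intro nn_integral_cong) (auto simp: indicator_def)
    have "(\<integral>\<^sup>+x. ennreal (?h x) \<partial>lborel) < \<infinity>" using fin[of a b] p by (simp add: less_top)
    moreover have "(\<integral>\<^sup>+x. ennreal (- ?h x) \<partial>lborel) < \<infinity>"
    proof -
      have "(\<integral>\<^sup>+x. ennreal (- ?h x) \<partial>lborel) \<le> (\<integral>\<^sup>+x. ennreal (norm (?h x)) \<partial>lborel)"
        by (intro nn_integral_mono ennreal_leI) auto
      also have "\<dots> < \<infinity>" using int[of a b] by (simp add: integrable_iff_bounded)
      finally show ?thesis .
    qed
    moreover have "enn2real (\<integral>\<^sup>+x. ennreal (?h x) \<partial>lborel) = enn2real (\<integral>\<^sup>+x. ennreal (- ?h x) \<partial>lborel)"
      using real_lebesgue_integral_def[OF int[of a b]] zero[of a b] by simp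
    ultimately show ?thesis unfolding p n by (metis ennreal_enn2real infinity_ennreal_def)
  qed
  have "density lborel ?p = density lborel ?n"
  proof (rule measure_eqI_generator_eq)
    show "Int_stable ?E" by (auto simp: Int_stable_def box_Int_box)
    show "?E \<subseteq> Pow UNIV" "sets (density lborel ?p) = sigma_sets UNIV ?E" "sets (density lborel ?n) = sigma_sets UNIV ?E"
      by (simp_all add: borel_eq_box)
    let ?A = "\<lambda>n::nat. box (- (real n *\<^sub>R One)) (real n *\<^sub>R One) :: 'a set"
    show "range ?A \<subseteq> ?E" "(\<Union>i. ?A i) = UNIV"
      unfolding UN_box_eq_UNIV by auto
    show "emeasure (density lborel ?p) (?A i) \<noteq> \<infinity>" for i
      using fin by (simp add: emeasure_density)
    show "emeasure (density lborel ?p) X = emeasure (density lborel ?n) X" if "X \<in> ?E" for X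
      using that eq by (auto simp: emeasure_density)
  qed
  then have "AE x in lborel. ?p x = ?n x"
    by (intro sigma_finite_measure.density_unique[OF sigma_finite_lborel]) auto
  then show ?thesis
  proof (rule AE_mp, intro AE_I2 impI)
    fix x assume "?p x = ?n x"
    then show "f x = 0"
      using ennreal_neg[of "f x"] ennreal_neg[of "- f x"] ennreal_eq_0_iff[of "f x"] ennreal_eq_0_iff[of "- f x"]
      by (cases "f x \<ge> 0") auto
  qed
qed

lemma AE_zero_of_box_integrals:
  fixes g :: "'a::euclidean_space \<Rightarrow> complex"
  assumes [measurable]: "g \<in> borel_measurable borel"
    and int: "\<And>a b. integrable lborel (\<lambda>x. indicator (box a b) x * g x)"
    and zero: "\<And>a b. (\<integral>x. indicator (box a b) x * g x \<partial>lborel) = 0"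
  shows "AE x in lborel. g x = 0"
proof -
  have R: "Re (indicator (box a b) x * g x) = indicator (box a b) x * Re (g x)"
    and I: "Im (indicator (box a b) x * g x) = indicator (box a b) x * Im (g x)" for a b x
    by (auto simp: indicator_def)
  have "AE x in lborel. Re (g x) = 0"
  proof (rule AE_zero_of_box_integrals_real)
    fix a b
    show "integrable lborel (\<lambda>x. indicator (box a b) x * Re (g x))" using integrable_Re[OF int[of a b]] unfolding R .
    show "(\<integral>x. indicator (box a b) x * Re (g x) \<partial>lborel) = 0"
      using integral_Re[OF int[of a b]] zero[of a b] unfolding R by simp
  qed measurable
  moreover have "AE x in lborel. Im (g x) = 0"
  proof (rule AE_zero_of_box_integrals_real)
    fix a b
    show "integrable lborel (\<lambda>x. indicator (box a b) x * Im (g x))" using integrable_Im[OF int[of a b]] unfolding I .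
    show "(\<integral>x. indicator (box a b) x * Im (g x) \<partial>lborel) = 0"
      using integral_Im[OF int[of a b]] zero[of a b] unfolding I by simp
  qed measurable
  ultimately show ?thesis by eventually_elim (simp add: complex_eq_iff)
qed

section \<open>A kernel of nonzero mass and its modulated dilates\<close>

definition scut :: "real \<Rightarrow> 'a::euclidean_space \<Rightarrow> complex" where
  "scut r x = (\<Prod>b\<in>Basis. ubump (x \<bullet> (r *\<^sub>R b) + 0))"

lemma scut_scale: "scut r x = scut 1 (r *\<^sub>R x)"
  by (simp add: scut_def)

lemma test_fun_scut:
  assumes "r > 0" shows "test_fun (scut r :: 'a::euclidean_space \<Rightarrow> complex)"
  unfolding test_fun_def
proof
  show "smooth_fun (scut r :: 'a \<Rightarrow> complex)"
    unfolding scut_def[abs_def] by (intro smooth_fun_prod smooth_fun_ridge(1) smooth_ubump)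
  have "{x. scut r x \<noteq> 0} \<subseteq> cbox (- (\<Sum>b\<in>Basis. (1 / r) *\<^sub>R b)) (\<Sum>b\<in>Basis. (1 / r) *\<^sub>R b :: 'a)"
  proof
    fix x :: 'a assume "x \<in> {x. scut r x \<noteq> 0}"
    then have "ubump (r * (x \<bullet> b)) \<noteq> 0" if "b \<in> Basis" for b using that by (auto simp: scut_def)
    then have "\<bar>r * (x \<bullet> b)\<bar> < 1" if "b \<in> Basis" for b using ubump_supp that by (meson not_le)
    then have "r * (x \<bullet> b) < 1" "- 1 < r * (x \<bullet> b)" if "b \<in> Basis" for b using that abs_less_iff by fastforce+
    then have "x \<bullet> b \<le> 1 / r" "- (1 / r) \<le> x \<bullet> b" if "b \<in> Basis" for b
      using assms that by (auto simp: field_simps less_imp_le)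
    then show "x \<in> cbox (- (\<Sum>b\<in>Basis. (1 / r) *\<^sub>R b)) (\<Sum>b\<in>Basis. (1 / r) *\<^sub>R b)"
      by (auto simp: mem_box inner_sum_left inner_Basis if_distrib[of "\<lambda>x. _ * x"] cong: if_cong)
  qed
  then show "bounded {x::'a. scut r x \<noteq> 0}" by (rule bounded_subset[OF bounded_cbox])
qed

lemma norm_scut_le: "cmod (scut r x) \<le> 1"
proof -
  have "cmod (ubump y) \<le> 1" for y using ubump_sum_le(1)[of "{0}" y] by simp
  then show ?thesis unfolding scut_def prod_norm[symmetric] by (intro prod_le_1) auto
qed

lemma scut_0: "scut r 0 = 1"
  by (simp add: scut_def)

text \<open>One application of \<open>bessel_op\<close> gives decay by 1 / sqrt D, which is only
  square integrable; applying it twice gives decay by 1 / D, which is integrable.\<close>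

lemma integrable_inv_fourier_test_fun:
  fixes f :: "'a::euclidean_space \<Rightarrow> complex"
  assumes "test_fun f"
  shows "integrable lborel (inv_fourier f)"
proof -
  obtain bs :: "'a list" where bs: "distinct bs" "set bs = Basis" using finite_distinct_list[of Basis] by auto
  obtain K where K: "(\<integral>\<^sup>+\<xi>. ennreal (1 / (\<Prod>b\<in>Basis. 1 + (1 * (\<xi> \<bullet> b))\<^sup>2)) \<partial>(lborel :: 'a measure)) = ennreal K"
    using nn_integral_cauchy_kernel[where 'a='a] zero_less_one by metis
  let ?D = "\<lambda>\<xi>::'a. (\<Prod>b\<in>Basis. 1 + (1 * (\<xi> \<bullet> b))\<^sup>2)"
  have D1: "?D \<xi> \<ge> 1" for \<xi> by (rule prod_ge_1) auto
  note t1 = test_fun_bessel_op[OF assms, of 1 bs]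
  note t2 = test_fun_bessel_op[OF t1, of 1 bs]
  define B where "B = (\<integral>x. cmod (bessel_op 1 bs (bessel_op 1 bs f) x) \<partial>lborel)"
  have [measurable]: "inv_fourier f \<in> borel_measurable borel"
    using assms by (intro borel_measurable_inv_fourier test_fun_borel)
  have le: "cmod (inv_fourier f \<xi>) \<le> B * (1 / ?D \<xi>)" for \<xi>
  proof -
    have "(cmod (inv_fourier (bessel_op 1 bs (bessel_op 1 bs f)) \<xi>))\<^sup>2 = (?D \<xi> * cmod (inv_fourier f \<xi>))\<^sup>2"
      unfolding norm_inv_fourier_bessel_op[OF t1 bs] norm_inv_fourier_bessel_op[OF assms bs]
      by (simp only: power_mult_distrib power2_eq_square mult_ac)
    moreover have "0 \<le> ?D \<xi>" using D1[of \<xi>] by linarith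
    ultimately have "cmod (inv_fourier (bessel_op 1 bs (bessel_op 1 bs f)) \<xi>) = ?D \<xi> * cmod (inv_fourier f \<xi>)"
      by (rule power2_eq_imp_eq[OF _ norm_ge_zero mult_nonneg_nonneg[OF _ norm_ge_zero]])
    then have "?D \<xi> * cmod (inv_fourier f \<xi>) \<le> B"
      unfolding B_def using norm_inv_fourier_le[OF test_fun_integrable[OF t2], of \<xi>] by simp
    moreover have "x \<le> B * (1 / d)" if "d * x \<le> B" "d \<ge> 1" for d x :: real using that by (simp add: field_simps)
    ultimately show ?thesis using D1[of \<xi>] by blast
  qed
  have i: "integrable lborel (\<lambda>\<xi>::'a. B * (1 / ?D \<xi>))"
  proof (intro integrable_mult_right integrableI_bounded)
    have "norm (1 / ?D \<xi>) = 1 / ?D \<xi>" for \<xi>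
      unfolding real_norm_def by (rule abs_of_nonneg[OF divide_nonneg_nonneg[OF zero_le_one order_trans[OF zero_le_one D1]]])
    then show "(\<integral>\<^sup>+\<xi>. ennreal (norm (1 / ?D \<xi>)) \<partial>lborel) < \<infinity>" by (simp only: K) simp
  qed measurable
  show ?thesis
  proof (rule Bochner_Integration.integrable_bound[OF i])
    have "norm (inv_fourier f \<xi>) \<le> norm (B * (1 / ?D \<xi>))" for \<xi>
      using le[of \<xi>] by (simp only: real_norm_def)
    then show "AE \<xi> in lborel. norm (inv_fourier f \<xi>) \<le> norm (B * (1 / ?D \<xi>))" by (intro AE_I2)
  qed measurable
qed

text \<open>Fourier inversion at the origin: the integral is (2 pi)^d times the value of the cutoff
  at 0, which is 1. It is computed with a Gaussian factor that is removed by dominated convergence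
  on both sides.\<close>

lemma integral_inv_fourier_scut:
  "(\<integral>\<xi>. inv_fourier (scut 1) \<xi> \<partial>(lborel :: 'a::euclidean_space measure)) \<noteq> 0"
proof -
  let ?\<chi> = "scut 1 :: 'a \<Rightarrow> complex" and ?K = "inv_fourier (scut 1) :: 'a \<Rightarrow> complex"
  have t: "test_fun ?\<chi>" by (rule test_fun_scut) simp
  have [measurable]: "?\<chi> \<in> borel_measurable borel" by (rule test_fun_borel[OF t])
  have [measurable]: "?K \<in> borel_measurable borel" by (intro borel_measurable_inv_fourier test_fun_borel t)
  have iK: "integrable lborel ?K" by (rule integrable_inv_fourier_test_fun[OF t])
  define e where "e n = 1 / real (Suc n)" for n
  have e: "e n > 0" for n by (simp add: e_def)
  have e0: "e \<longlonglongrightarrow> 0" unfolding e_def[abs_def] by (rule LIMSEQ_Suc[OF lim_1_over_n])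
  have L: "(\<lambda>n. \<integral>\<xi>. ?K \<xi> * of_real (gauss (e n) \<xi>) \<partial>lborel) \<longlonglongrightarrow> (\<integral>\<xi>. ?K \<xi> \<partial>lborel)"
  proof (rule integral_dominated_convergence[where w="\<lambda>\<xi>. cmod (?K \<xi>)"])
    show "AE \<xi> in lborel. (\<lambda>n. ?K \<xi> * of_real (gauss (e n) \<xi>)) \<longlonglongrightarrow> ?K \<xi>"
    proof (rule AE_I2)
      fix \<xi> :: 'a
      have "(\<lambda>n. ?K \<xi> * of_real (exp (- ((e n)\<^sup>2 * (\<xi> \<bullet> \<xi>)) / 2))) \<longlonglongrightarrow> ?K \<xi> * of_real (exp (- (0\<^sup>2 * (\<xi> \<bullet> \<xi>)) / 2))"
        by (intro tendsto_intros e0) auto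
      then show "(\<lambda>n. ?K \<xi> * of_real (gauss (e n) \<xi>)) \<longlonglongrightarrow> ?K \<xi>" by (simp add: gauss_def)
    qed
    show "AE \<xi> in lborel. norm (?K \<xi> * of_real (gauss (e n) \<xi>)) \<le> cmod (?K \<xi>)" for n
      by (auto simp: norm_mult intro!: AE_I2 mult_left_le gauss_le_1)
  qed (use iK in auto)
  let ?c = "sqrt (2 * pi) ^ DIM('a)"
  have eq: "(\<integral>\<xi>. ?K \<xi> * of_real (gauss (e n) \<xi>) \<partial>lborel) = of_real ?c * (\<integral>y. ?\<chi> (e n *\<^sub>R y) * of_real (gauss 1 y) \<partial>lborel)" for n
  proof -
    let ?f = "\<lambda>x. ?\<chi> x * of_real ((sqrt (2 * pi) / e n) ^ DIM('a) * gauss (1 / e n) x)"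
    have ig: "integrable lborel (\<lambda>\<xi>::'a. complex_of_real (gauss (e n) \<xi>))"
      using integrable_gauss[OF e[of n], where 'a='a] by simp
    have "(\<integral>\<xi>. ?K \<xi> * of_real (gauss (e n) \<xi>) \<partial>lborel) = (\<integral>x. ?f x \<partial>lborel)"
      unfolding inv_fourier_mult_formula[OF test_fun_integrable[OF t] ig] gauss_fourier(2)[OF e] ..
    also have "\<dots> = (\<bar>e n\<bar> ^ DIM('a)) *\<^sub>R (\<integral>x. ?f (0 + e n *\<^sub>R x) \<partial>lborel)"
      using e[of n] by (intro integral_lborel_affine) auto
    also have "(\<integral>x. ?f (0 + e n *\<^sub>R x) \<partial>lborel) = (\<integral>x. of_real ((sqrt (2 * pi) / e n) ^ DIM('a)) * (?\<chi> (e n *\<^sub>R x) * of_real (gauss 1 x)) \<partial>lborel)"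
    proof (intro Bochner_Integration.integral_cong refl)
      fix x :: 'a
      have "gauss (1 / e n) (e n *\<^sub>R x) = gauss 1 x" using e[of n] by (simp add: gauss_def power2_eq_square)
      then show "?f (0 + e n *\<^sub>R x) = of_real ((sqrt (2 * pi) / e n) ^ DIM('a)) * (?\<chi> (e n *\<^sub>R x) * of_real (gauss 1 x))"
        by (simp add: mult_ac)
    qed
    also have "\<dots> = of_real ((sqrt (2 * pi) / e n) ^ DIM('a)) * (\<integral>x. ?\<chi> (e n *\<^sub>R x) * of_real (gauss 1 x) \<partial>lborel)"
      by (rule integral_mult_right_zero)
    finally have 1: "(\<integral>\<xi>. ?K \<xi> * of_real (gauss (e n) \<xi>) \<partial>lborel) = (\<bar>e n\<bar> ^ DIM('a)) *\<^sub>R (of_real ((sqrt (2 * pi) / e n) ^ DIM('a)) * (\<integral>x. ?\<chi> (e n *\<^sub>R x) * of_real (gauss 1 x) \<partial>lborel))" .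
    have "\<bar>e n\<bar> ^ DIM('a) * (sqrt (2 * pi) / e n) ^ DIM('a) = ?c"
      using e[of n] by (simp add: power_divide)
    then show ?thesis unfolding 1 scaleR_conv_of_real mult.assoc[symmetric] of_real_mult[symmetric] by simp
  qed
  have "(\<lambda>n. \<integral>y. ?\<chi> (e n *\<^sub>R y) * of_real (gauss 1 y) \<partial>lborel) \<longlonglongrightarrow> (\<integral>y. complex_of_real (gauss 1 y) \<partial>(lborel::'a measure))"
  proof (rule integral_dominated_convergence[where w="gauss 1"])
    show "integrable lborel (gauss 1 :: 'a \<Rightarrow> real)" by (rule integrable_gauss) simp
    show "AE y in lborel. (\<lambda>n. ?\<chi> (e n *\<^sub>R y) * of_real (gauss 1 y)) \<longlonglongrightarrow> of_real (gauss 1 y)"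
    proof (rule AE_I2)
      fix y :: 'a
      have "isCont ?\<chi> 0" using t smooth_fun_continuous_on[of ?\<chi> UNIV] by (auto simp: test_fun_def continuous_on_eq_continuous_at)
      moreover have "(\<lambda>n. e n *\<^sub>R y) \<longlonglongrightarrow> 0 *\<^sub>R y" by (intro tendsto_intros e0)
      ultimately have "(\<lambda>n. ?\<chi> (e n *\<^sub>R y)) \<longlonglongrightarrow> ?\<chi> 0" by (intro isCont_tendsto_compose[of 0 ?\<chi>]) auto
      then have "(\<lambda>n. ?\<chi> (e n *\<^sub>R y) * of_real (gauss 1 y)) \<longlonglongrightarrow> ?\<chi> 0 * of_real (gauss 1 y)" by (intro tendsto_intros)
      then show "(\<lambda>n. ?\<chi> (e n *\<^sub>R y) * of_real (gauss 1 y)) \<longlonglongrightarrow> of_real (gauss 1 y)" by (simp add: scut_0)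
    qed
    show "AE y in lborel. norm (?\<chi> (e n *\<^sub>R y) * of_real (gauss 1 y)) \<le> gauss 1 y" for n
      by (auto simp: norm_mult intro!: AE_I2 mult_left_le_one_le norm_scut_le)
  qed auto
  then have "(\<lambda>n. of_real ?c * (\<integral>y. ?\<chi> (e n *\<^sub>R y) * of_real (gauss 1 y) \<partial>lborel)) \<longlonglongrightarrow> of_real ?c * (\<integral>y. complex_of_real (gauss 1 y) \<partial>(lborel::'a measure))"
    by (intro tendsto_mult tendsto_const)
  then have "(\<integral>\<xi>. ?K \<xi> \<partial>lborel) = of_real ?c * (\<integral>y. complex_of_real (gauss 1 y) \<partial>(lborel::'a measure))"
    using L unfolding eq by (rule LIMSEQ_unique[rotated])
  also have "(\<integral>y. complex_of_real (gauss 1 y) \<partial>(lborel::'a measure)) = of_real ?c"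
    using integral_gauss[of 1, where 'a='a] by simp
  finally show ?thesis by simp
qed


text \<open>Modulation by -\<eta> translates the transform, and widening the cutoff by N compresses
  it, giving an approximate identity centred at \<eta> up to a constant.\<close>

lemma inv_fourier_scut_modulated:
  fixes \<eta> \<xi> :: "'a::euclidean_space"
  assumes "N > 0"
  shows "test_fun (\<lambda>x::'a. scut (1 / N) x * cis (x \<bullet> (- \<eta>) + 0))"
    and "inv_fourier (\<lambda>x. scut (1 / N) x * cis (x \<bullet> (- \<eta>) + 0)) \<xi> = of_real (N ^ DIM('a)) * inv_fourier (scut 1) (N *\<^sub>R (\<xi> - \<eta>))"
proof -
  show t: "test_fun (\<lambda>x::'a. scut (1 / N) x * cis (x \<bullet> (- \<eta>) + 0))"
    using assms by (intro test_fun_mult test_fun_scut smooth_fun_ridge(1) smooth_fun_cis) auto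
  have [measurable]: "(scut 1 :: 'a \<Rightarrow> complex) \<in> borel_measurable borel"
    by (rule test_fun_borel[OF test_fun_scut]) simp
  let ?f = "\<lambda>x::'a. scut 1 x * cis (x \<bullet> (N *\<^sub>R (\<xi> - \<eta>)))"
  have "inv_fourier (\<lambda>x. scut (1 / N) x * cis (x \<bullet> (- \<eta>) + 0)) \<xi> = (\<integral>x. ?f (0 + (1 / N) *\<^sub>R x) \<partial>lborel)"
    unfolding inv_fourier_lborel[OF test_fun_borel[OF t]]
    using assms
    by (intro Bochner_Integration.integral_cong refl)
       (simp add: scut_scale[of "1 / N"] cis_mult inner_diff_right mult.assoc right_diff_distrib)
  moreover have "inv_fourier (scut 1) (N *\<^sub>R (\<xi> - \<eta>)) = (\<integral>x. ?f x \<partial>lborel)"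
    by (rule inv_fourier_lborel) measurable
  moreover have "(\<integral>x. ?f x \<partial>lborel) = (\<bar>1 / N\<bar> ^ DIM('a)) *\<^sub>R (\<integral>x. ?f (0 + (1 / N) *\<^sub>R x) \<partial>lborel)"
    using assms by (intro integral_lborel_affine) auto
  ultimately show "inv_fourier (\<lambda>x. scut (1 / N) x * cis (x \<bullet> (- \<eta>) + 0)) \<xi> = of_real (N ^ DIM('a)) * inv_fourier (scut 1) (N *\<^sub>R (\<xi> - \<eta>))"
    using assms by (simp add: scaleR_conv_of_real power_divide)
qed

text \<open>Testing with modulated and dilated cutoffs shows that g vanishes after convolution with the
  dilates of an integrable kernel of nonzero mass; integrate this over a box and let the
  dilates concentrate.\<close>

lemma AE_zero_of_inv_fourier_pairings:
  fixes g :: "'a::euclidean_space \<Rightarrow> complex"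
  assumes g [measurable]: "g \<in> borel_measurable borel" and lam: "0 \<le> lam"
    and tail: "(\<integral>\<^sup>+\<xi>. ennreal ((cmod (g \<xi>))\<^sup>2) * indicator {\<xi>. cmod (g \<xi>) > lam} \<xi> \<partial>lborel) < \<infinity>"
    and zero: "\<And>\<psi>. test_fun \<psi> \<Longrightarrow> (\<integral>\<xi>. g \<xi> * inv_fourier \<psi> \<xi> \<partial>lborel) = 0"
  shows "AE \<xi> in lborel. g \<xi> = 0"
proof -
  let ?h = "\<lambda>\<xi>. ennreal ((cmod (g \<xi>))\<^sup>2) * indicator {\<xi>. cmod (g \<xi>) > lam} \<xi>"
  obtain T where T: "(\<integral>\<^sup>+\<xi>. ?h \<xi> \<partial>lborel) = ennreal T" "T \<ge> 0"
    using tail by (cases "\<integral>\<^sup>+\<xi>. ?h \<xi> \<partial>lborel") auto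
  have bound: "(\<integral>\<^sup>+\<eta>. ennreal (cmod (indicator B \<eta> * g (\<eta> + z))) \<partial>lborel) \<le> ennreal ((lam + 1) * measure lborel B + T)"
    if B: "B \<in> sets borel" "emeasure lborel B < \<infinity>" for B z
  proof -
    have "(\<integral>\<^sup>+\<eta>. ennreal (cmod (indicator B \<eta> * g (\<eta> + z))) \<partial>lborel)
       \<le> (\<integral>\<^sup>+\<eta>. ennreal (lam + 1) * indicator B \<eta> + ?h (\<eta> + z) \<partial>lborel)"
    proof (rule nn_integral_mono)
      fix \<eta>
      \<comment> \<open>From 2\<bar>g\<bar> \<le> \<bar>g\<bar>^2 + 1 above the height. The
        square-integrable tail is translation invariant, so the resulting local L1 bound is uniform
        in z.\<close>
      have *: "ennreal (cmod (g \<xi>)) \<le> ennreal (lam + 1) + ?h \<xi>" for \<xi>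
      proof (cases "cmod (g \<xi>) > lam")
        case True
        have "2 * cmod (g \<xi>) \<le> (cmod (g \<xi>))\<^sup>2 + 1"
          using zero_le_power2[of "cmod (g \<xi>) - 1"] by (simp add: power2_diff)
        then have "cmod (g \<xi>) \<le> (lam + 1) + (cmod (g \<xi>))\<^sup>2"
          using lam zero_le_power2[of "cmod (g \<xi>)"] by linarith
        then show ?thesis using True lam by (simp add: ennreal_plus[symmetric] ennreal_leI del: ennreal_plus)
      next
        case False
        then have "cmod (g \<xi>) \<le> lam + 1" by simp
        then show ?thesis by (rule add_increasing2[OF zero_le ennreal_leI])
      qed
      show "ennreal (cmod (indicator B \<eta> * g (\<eta> + z))) \<le> ennreal (lam + 1) * indicator B \<eta> + ?h (\<eta> + z)"
        using *[of "\<eta> + z"] by (cases "\<eta> \<in> B") simp_all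
    qed
    also have "\<dots> = ennreal (lam + 1) * emeasure lborel B + (\<integral>\<^sup>+\<eta>. ?h (\<eta> + z) \<partial>lborel)"
      using B by (simp add: nn_integral_add nn_integral_cmult_indicator)
    also have "(\<integral>\<^sup>+\<eta>. ?h (\<eta> + z) \<partial>lborel) = ennreal T"
      using nn_integral_lborel_affine[of ?h 1 z] T by (simp add: add.commute)
    also have "ennreal (lam + 1) * emeasure lborel B + ennreal T = ennreal ((lam + 1) * measure lborel B + T)"
      using B lam T by (simp add: emeasure_eq_ennreal_measure ennreal_mult ennreal_plus)
    finally show ?thesis .
  qed
  have int: "integrable lborel (\<lambda>\<eta>. indicator B \<eta> * g (\<eta> + z))" if "B \<in> sets borel" "emeasure lborel B < \<infinity>" for B z
  proof (rule integrableI_bounded)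
    show "(\<integral>\<^sup>+\<eta>. ennreal (cmod (indicator B \<eta> * g (\<eta> + z))) \<partial>lborel) < \<infinity>"
      using bound[OF that, of z] by (rule order_le_less_trans) simp
  qed (use that in measurable)
  let ?K = "inv_fourier (scut 1) :: 'a \<Rightarrow> complex"
  have t: "test_fun (scut 1 :: 'a \<Rightarrow> complex)" by (rule test_fun_scut) simp
  have [measurable]: "?K \<in> borel_measurable borel" by (intro borel_measurable_inv_fourier test_fun_borel t)
  have iK: "integrable lborel ?K" by (rule integrable_inv_fourier_test_fun[OF t])
  define e where "e n = 1 / real (Suc n)" for n
  have e: "e n > 0" "e n \<le> 1" for n by (auto simp: e_def)
  have e0: "e \<longlonglongrightarrow> 0" unfolding e_def[abs_def] by (rule LIMSEQ_Suc[OF lim_1_over_n])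
  \<comment> \<open>The hypothesis for the modulated cutoff, after the substitution \<xi> = \<eta> +
    e u that turns the dilated kernel into the fixed one.\<close>
  have Z: "(\<integral>u. g (\<eta> + e n *\<^sub>R u) * ?K u \<partial>lborel) = 0" for n \<eta>
  proof -
    let ?N = "real (Suc n)"
    have N: "?N > 0" by simp
    let ?F = "\<lambda>\<xi>. g \<xi> * ?K (?N *\<^sub>R (\<xi> - \<eta>))"
    have "0 = (\<integral>\<xi>. of_real (?N ^ DIM('a)) * ?F \<xi> \<partial>lborel)"
      using zero[OF inv_fourier_scut_modulated(1)[OF N, of \<eta>]]
      unfolding inv_fourier_scut_modulated(2)[OF N] by (simp only: mult_ac)
    also have "\<dots> = of_real (?N ^ DIM('a)) * (\<integral>\<xi>. ?F \<xi> \<partial>lborel)"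
      by (rule integral_mult_right_zero)
    finally have "(\<integral>\<xi>. ?F \<xi> \<partial>lborel) = 0" using N by (simp del: of_nat_Suc)
    moreover have "(\<integral>\<xi>. ?F \<xi> \<partial>lborel) = (\<bar>e n\<bar> ^ DIM('a)) *\<^sub>R (\<integral>u. ?F (\<eta> + e n *\<^sub>R u) \<partial>lborel)"
      using e[of n] by (intro integral_lborel_affine) auto
    moreover have "?F (\<eta> + e n *\<^sub>R u) = g (\<eta> + e n *\<^sub>R u) * ?K u" for u
      by (simp add: e_def del: of_nat_Suc)
    ultimately have "(\<bar>e n\<bar> ^ DIM('a)) *\<^sub>R (\<integral>u. g (\<eta> + e n *\<^sub>R u) * ?K u \<partial>lborel) = 0" by (simp only:)
    then show ?thesis using e(1)[of n] by simp
  qed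
  have box0: "(\<integral>x. indicator (box a b) x * g x \<partial>lborel) = 0" for a b :: 'a
  proof -
    let ?B = "box a b"
    have B: "?B \<in> sets borel" "emeasure lborel ?B < \<infinity>"
      by (auto simp: emeasure_lborel_box_eq)
    define m where "m = (lam + 1) * measure lborel ?B + T"
    have m: "m \<ge> 0" using lam T by (simp add: m_def)
    define A where "A n u = (\<integral>\<eta>. indicator ?B \<eta> * g (\<eta> + e n *\<^sub>R u) \<partial>lborel)" for n u
    have [measurable]: "A n \<in> borel_measurable borel" for n
      unfolding A_def[abs_def] by measurable
    have normint: "(\<integral>\<eta>. cmod (indicator ?B \<eta> * g (\<eta> + z)) \<partial>lborel) \<le> m" for z
    proof -
      have "ennreal (\<integral>\<eta>. cmod (indicator ?B \<eta> * g (\<eta> + z)) \<partial>lborel) = (\<integral>\<^sup>+\<eta>. ennreal (cmod (indicator ?B \<eta> * g (\<eta> + z))) \<partial>lborel)"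
        using int[OF B, of z] by (intro nn_integral_eq_integral[symmetric]) auto
      also have "\<dots> \<le> ennreal m" using bound[OF B, of z] by (simp add: m_def)
      finally show ?thesis using m by (simp add: ennreal_le_iff)
    qed
    have Am: "cmod (A n u) \<le> m" for n u
      unfolding A_def by (rule order_trans[OF integral_norm_bound normint])
    have KA: "(\<integral>u. ?K u * A n u \<partial>lborel) = 0" for n
    proof -
      let ?f = "\<lambda>u \<eta>. indicator ?B \<eta> * g (\<eta> + e n *\<^sub>R u) * ?K u"
      have "integrable (lborel \<Otimes>\<^sub>M lborel) (\<lambda>(u, \<eta>). ?f u \<eta>)"
      proof (rule lborel_pair.Fubini_integrable)
        show "(\<lambda>(u, \<eta>). ?f u \<eta>) \<in> borel_measurable (lborel \<Otimes>\<^sub>M lborel)" by measurable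
        have eq: "(\<integral>\<eta>. norm (case (u, \<eta>) of (u, \<eta>) \<Rightarrow> ?f u \<eta>) \<partial>lborel) = (\<integral>\<eta>. cmod (indicator ?B \<eta> * g (\<eta> + e n *\<^sub>R u)) \<partial>lborel) * cmod (?K u)" for u
          by (simp add: norm_mult)
        show "integrable lborel (\<lambda>u. \<integral>\<eta>. norm (case (u, \<eta>) of (u, \<eta>) \<Rightarrow> ?f u \<eta>) \<partial>lborel)"
          unfolding eq
        proof (rule Bochner_Integration.integrable_bound)
          show "integrable lborel (\<lambda>u. m * cmod (?K u))" using iK by simp
          show "AE u in lborel. norm ((\<integral>\<eta>. cmod (indicator ?B \<eta> * g (\<eta> + e n *\<^sub>R u)) \<partial>lborel) * cmod (?K u)) \<le> norm (m * cmod (?K u))"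
          proof (rule AE_I2)
            fix u :: 'a
            have "0 \<le> (\<integral>\<eta>. cmod (indicator ?B \<eta> * g (\<eta> + e n *\<^sub>R u)) \<partial>lborel)" by (intro integral_nonneg_AE) auto
            then show "norm ((\<integral>\<eta>. cmod (indicator ?B \<eta> * g (\<eta> + e n *\<^sub>R u)) \<partial>lborel) * cmod (?K u)) \<le> norm (m * cmod (?K u))"
              using normint[of "e n *\<^sub>R u"] m by (simp only: real_norm_def abs_mult abs_norm_cancel) (intro mult_right_mono, auto)
          qed
        qed measurable
        show "AE u in lborel. integrable lborel (\<lambda>\<eta>. case (u, \<eta>) of (u, \<eta>) \<Rightarrow> ?f u \<eta>)"
          using int[OF B] by (intro AE_I2) (simp add: integrable_mult_left)
      qed
      from lborel_pair.Fubini_integral[OF this]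
      have "(\<integral>\<eta>. (\<integral>u. ?f u \<eta> \<partial>lborel) \<partial>lborel) = (\<integral>u. (\<integral>\<eta>. ?f u \<eta> \<partial>lborel) \<partial>lborel)" .
      moreover have "(\<integral>u. ?f u \<eta> \<partial>lborel) = 0" for \<eta>
        using Z[of \<eta> n] by (simp add: mult.assoc)
      moreover have "(\<integral>\<eta>. ?f u \<eta> \<partial>lborel) = ?K u * A n u" for u
        unfolding A_def by (subst integral_mult_left_zero) (simp add: mult.commute)
      ultimately have "(\<integral>u. ?K u * A n u \<partial>lborel) = (\<integral>\<eta>. 0 \<partial>(lborel :: 'a measure))" by (simp only:)
      then show ?thesis by simp
    qed
    have Alim: "(\<lambda>n. A n u) \<longlonglongrightarrow> (\<integral>x. indicator ?B x * g x \<partial>lborel)" for u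
    proof -
      \<comment> \<open>The shift is moved from g to the box: indicators of shifted boxes converge
        pointwise off the boundary, a null set, whereas g has no continuity.\<close>
      have A': "A n u = (\<integral>\<xi>. indicator ?B (\<xi> - e n *\<^sub>R u) * g \<xi> \<partial>lborel)" for n
        unfolding A_def
        using integral_translate[of "\<lambda>\<xi>. indicator ?B (\<xi> - e n *\<^sub>R u) * g \<xi>" "e n *\<^sub>R u"] by simp
      obtain R where R: "\<And>x. x \<in> ?B \<Longrightarrow> norm x \<le> R" using bounded_box[of a b] by (auto simp: bounded_iff)
      let ?C = "cball (0::'a) (R + norm u)"
      have C: "?C \<in> sets borel" "emeasure lborel ?C < \<infinity>"
        using emeasure_bounded_finite[of ?C] by auto
      have "(\<lambda>n. \<integral>\<xi>. indicator ?B (\<xi> - e n *\<^sub>R u) * g \<xi> \<partial>lborel) \<longlonglongrightarrow> (\<integral>x. indicator ?B x * g x \<partial>lborel)"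
      proof (rule integral_dominated_convergence)
        show "integrable lborel (\<lambda>\<xi>. cmod (indicator ?C \<xi> * g \<xi>))"
          using int[OF C, of 0] by simp
        show "AE \<xi> in lborel. norm (indicator ?B (\<xi> - e n *\<^sub>R u) * g \<xi>) \<le> cmod (indicator ?C \<xi> * g \<xi>)" for n
        proof (rule AE_I2)
          fix \<xi> :: 'a
          have "\<xi> \<in> ?C" if "\<xi> - e n *\<^sub>R u \<in> ?B"
          proof -
            have "norm \<xi> \<le> norm (\<xi> - e n *\<^sub>R u) + norm (e n *\<^sub>R u)" using norm_triangle_ineq[of "\<xi> - e n *\<^sub>R u" "e n *\<^sub>R u"] by simp
            also have "\<dots> \<le> R + norm u" using R[OF that] e[of n] by (intro add_mono) (auto simp: mult_left_le_one_le)
            finally show ?thesis by simp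
          qed
          then show "norm (indicator ?B (\<xi> - e n *\<^sub>R u) * g \<xi>) \<le> cmod (indicator ?C \<xi> * g \<xi>)"
            by (cases "\<xi> - e n *\<^sub>R u \<in> ?B") (auto simp: norm_mult)
        qed
        have lim: "(\<lambda>n. \<xi> - e n *\<^sub>R u) \<longlonglongrightarrow> \<xi>" for \<xi>
        proof -
          have "(\<lambda>n. \<xi> - e n *\<^sub>R u) \<longlonglongrightarrow> \<xi> - 0 *\<^sub>R u" by (intro tendsto_intros e0)
          then show ?thesis by simp
        qed
        have null: "AE \<xi> in lborel. \<xi> \<notin> cbox a b - box a b"
        proof (rule AE_not_in)
          have "emeasure lborel (cbox a b - box a b) = emeasure lborel (cbox a b) - emeasure lborel (box a b)"
            using B(2) box_subset_cbox by (intro emeasure_Diff) auto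
          also have "\<dots> = 0" by (simp add: emeasure_lborel_cbox_eq emeasure_lborel_box_eq)
          finally show "cbox a b - box a b \<in> null_sets lborel" by (auto simp: null_sets_def)
        qed
        then show "AE \<xi> in lborel. (\<lambda>n. indicator ?B (\<xi> - e n *\<^sub>R u) * g \<xi>) \<longlonglongrightarrow> indicator ?B \<xi> * g \<xi>"
        proof eventually_elim
          case (elim \<xi>)
          have "\<forall>\<^sub>F n in sequentially. indicator ?B (\<xi> - e n *\<^sub>R u) * g \<xi> = indicator ?B \<xi> * g \<xi>"
          proof (cases "\<xi> \<in> ?B")
            case True
            have "\<forall>\<^sub>F n in sequentially. \<xi> - e n *\<^sub>R u \<in> ?B" by (rule topological_tendstoD[OF lim open_box True])
            then show ?thesis by eventually_elim (simp add: True)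
          next
            case False
            then have "\<xi> \<in> - cbox a b" using elim by auto
            then have "\<forall>\<^sub>F n in sequentially. \<xi> - e n *\<^sub>R u \<in> - cbox a b"
              by (intro topological_tendstoD[OF lim]) (auto simp: open_Compl closed_cbox)
            then show ?thesis
            proof eventually_elim
              case (elim n)
              then have "\<xi> - e n *\<^sub>R u \<notin> ?B" using box_subset_cbox[of a b] by blast
              then show ?case using False by simp
            qed
          qed
          then show ?case by (rule tendsto_eventually)
        qed
      qed (measurable, measurable)
      then show ?thesis by (simp only: A')
    qed
    have "(\<lambda>n. \<integral>u. ?K u * A n u \<partial>lborel) \<longlonglongrightarrow> (\<integral>u. ?K u * (\<integral>x. indicator ?B x * g x \<partial>lborel) \<partial>lborel)"
    proof (rule integral_dominated_convergence)
      show "integrable lborel (\<lambda>u. cmod (?K u) * m)" using iK by simp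
      show "AE u in lborel. norm (?K u * A n u) \<le> cmod (?K u) * m" for n
        using Am by (auto simp: norm_mult intro!: AE_I2 mult_left_mono)
      show "AE u in lborel. (\<lambda>n. ?K u * A n u) \<longlonglongrightarrow> ?K u * (\<integral>x. indicator ?B x * g x \<partial>lborel)"
        by (intro AE_I2 tendsto_intros Alim)
    qed (measurable, measurable)
    then have "(\<integral>u. ?K u * (\<integral>x. indicator ?B x * g x \<partial>lborel) \<partial>lborel) = 0"
      unfolding KA by (simp add: LIMSEQ_const_iff)
    then have "(\<integral>u. ?K u \<partial>lborel) * (\<integral>x. indicator ?B x * g x \<partial>lborel) = 0"
      by (simp only: integral_mult_left_zero)
    then show ?thesis using integral_inv_fourier_scut[where 'a='a] by simp
  qed
  show ?thesis
  proof (rule AE_zero_of_box_integrals[OF g _ box0])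
    show "integrable lborel (\<lambda>x. indicator (box a b) x * g x)" for a b :: 'a
      using int[of "box a b" 0] by (simp add: emeasure_lborel_box_eq)
  qed
qed


section \<open>Coverings adapted to a weight sequence\<close>

lemma sum_le_nnsum: "finite F \<Longrightarrow> sum f F \<le> nnsum f"
  unfolding nnsum_def by (rule SUP_upper) simp

lemma le_nnsum: "f k \<le> nnsum f"
  using sum_le_nnsum[of "{k}" f] by simp

text \<open>If y \<le> x^(q-1) the product is at most x^q; otherwise x is at most y^(1/(q-1)) and
  the product is at most the power of y. The sharp constants 1/q and 1/q' are not kept.\<close>

lemma Young_powr:
  fixes x y q :: real
  assumes "0 \<le> x" "0 \<le> y" "1 < q"
  shows "x * y \<le> x powr q + y powr (q / (q - 1))"
proof (cases "y \<le> x powr (q - 1)")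
  case True
  have "x * y \<le> x powr 1 * x powr (q - 1)" using True assms by (simp add: mult_left_mono)
  also have "\<dots> = x powr q" by (simp only: powr_add[symmetric]) simp
  finally show ?thesis by (simp add: add_increasing2)
next
  case False
  then have "(x powr (q - 1)) powr (1 / (q - 1)) \<le> y powr (1 / (q - 1))" using assms by (intro powr_mono2) auto
  then have "x \<le> y powr (1 / (q - 1))" using assms by (simp add: powr_powr)
  then have "x * y \<le> y powr (1 / (q - 1)) * y powr 1" using assms by (simp add: mult_right_mono)
  also have "\<dots> = y powr (1 / (q - 1) + 1)" by (simp only: powr_add)
  also have "1 / (q - 1) + 1 = q / (q - 1)" using assms by (simp add: field_simps)
  finally show ?thesis by (simp add: add_increasing)
qed

lemma summable_tail_le:
  fixes f :: "nat \<Rightarrow> real"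
  assumes "summable f" "\<And>k. 0 \<le> f k" "0 < \<epsilon>"
  shows "\<exists>K0. \<forall>K\<ge>K0. \<forall>N. (\<Sum>k=K..<N. f k) \<le> \<epsilon>"
proof -
  obtain K0 where "\<And>m n. m \<ge> K0 \<Longrightarrow> norm (\<Sum>k=m..<n. f k) < \<epsilon>"
    using assms(1,3) unfolding summable_Cauchy by blast
  then show ?thesis using assms(2) by (intro exI[of _ K0]) (fastforce simp: sum_nonneg less_imp_le)
qed

text \<open>\<open>K0\<close> depends on w, H and \<epsilon> but not on A: the cover that produces A
  can be chosen only after its scale has been fixed. For q = 1 the weights themselves are summable;
  for q > 1 Young's inequality separates w from A.\<close>

lemma weighted_tail_small:
  fixes w :: "nat \<Rightarrow> real" and q H \<epsilon> :: real
  assumes q: "1 \<le> q" and w: "\<And>k. 0 \<le> w k" "summable (\<lambda>k. w k powr q)" and H: "0 \<le> H" and \<epsilon>: "0 < \<epsilon>"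
  shows "\<exists>K0. \<forall>K\<ge>K0. \<forall>A N. (\<forall>k. 0 \<le> A k) \<longrightarrow>
     (if q = 1 then \<forall>k. A k \<le> H else \<forall>N. (\<Sum>k<N. A k powr (q / (q - 1) / 2)) \<le> H) \<longrightarrow>
       (\<Sum>k=K..<N. w k * sqrt (A k)) \<le> \<epsilon>"
proof (cases "q = 1")
  case True
  have "summable w" using w by (simp add: True)
  moreover have e: "0 < \<epsilon> / (sqrt H + 1)" using \<epsilon> H by (simp add: add_nonneg_pos)
  ultimately obtain K0 where K0: "\<And>K N. K \<ge> K0 \<Longrightarrow> (\<Sum>k=K..<N. w k) \<le> \<epsilon> / (sqrt H + 1)"
    using summable_tail_le w(1) by meson
  show ?thesis
  proof (intro exI[of _ K0] allI impI)
    fix K N and A :: "nat \<Rightarrow> real" assume K: "K \<ge> K0" and A: "\<forall>k. (0::real) \<le> A k" "if q = 1 then \<forall>k. A k \<le> H else \<forall>N. (\<Sum>k<N. A k powr (q / (q - 1) / 2)) \<le> H"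
    have "(\<Sum>k=K..<N. w k * sqrt (A k)) \<le> (\<Sum>k=K..<N. w k * (sqrt H + 1))"
    proof (intro sum_mono mult_left_mono w)
      fix k
      have "sqrt (A k) \<le> sqrt H" using A True by simp
      then show "sqrt (A k) \<le> sqrt H + 1" by linarith
    qed
    also have "\<dots> = (\<Sum>k=K..<N. w k) * (sqrt H + 1)" by (simp only: sum_distrib_right)
    also have "\<dots> \<le> \<epsilon> / (sqrt H + 1) * (sqrt H + 1)"
      using H by (intro mult_right_mono K0[OF K]) auto
    also have "\<dots> = \<epsilon>" using H by (simp add: add_nonneg_eq_0_iff)
    finally show "(\<Sum>k=K..<N. w k * sqrt (A k)) \<le> \<epsilon>" .
  qed
next
  case False
  then have q1: "q > 1" using q by simp
  define q' where "q' = q / (q - 1)"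
  have q': "q' > 0" using q1 by (simp add: q'_def)
  \<comment> \<open>The balance in Young's inequality: the share of A, at most
    \<open>\<tau> powr q' * H\<close>, is at most \<epsilon>/2, and the large factor this puts on w
    is absorbed by starting the tail late.\<close>
  define \<tau> where "\<tau> = (\<epsilon> / (2 * (H + 1))) powr (1 / q')"
  have \<tau>: "\<tau> > 0" using \<epsilon> H by (simp add: \<tau>_def)
  have \<tau>q: "\<tau> powr q' * H \<le> \<epsilon> / 2"
  proof -
    have "\<tau> powr q' = \<epsilon> / (2 * (H + 1))" using q' \<epsilon> H by (simp add: \<tau>_def powr_powr)
    then have "\<tau> powr q' * H = (\<epsilon> / 2) * (H / (H + 1))" using H by (simp add: field_simps)
    also have "\<dots> \<le> (\<epsilon> / 2) * 1" using H \<epsilon> by (intro mult_left_mono) auto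
    finally show ?thesis by simp
  qed
  have "summable (\<lambda>k. (1 / \<tau>) powr q * w k powr q)" using w by (intro summable_mult)
  moreover have "0 < \<epsilon> / 2" using \<epsilon> by simp
  ultimately obtain K0 where K0: "\<And>K N. K \<ge> K0 \<Longrightarrow> (\<Sum>k=K..<N. (1 / \<tau>) powr q * w k powr q) \<le> \<epsilon> / 2"
    using summable_tail_le[of "\<lambda>k. (1 / \<tau>) powr q * w k powr q"] by (metis mult_nonneg_nonneg powr_ge_zero)
  show ?thesis
  proof (intro exI[of _ K0] allI impI)
    fix K N and A :: "nat \<Rightarrow> real" assume K: "K \<ge> K0" and A: "\<forall>k. (0::real) \<le> A k" "if q = 1 then \<forall>k. A k \<le> H else \<forall>N. (\<Sum>k<N. A k powr (q / (q - 1) / 2)) \<le> H"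
    have "(\<Sum>k=K..<N. w k * sqrt (A k)) \<le> (\<Sum>k=K..<N. (1 / \<tau>) powr q * w k powr q + \<tau> powr q' * A k powr (q' / 2))"
    proof (rule sum_mono)
      fix k
      have "w k * sqrt (A k) = (1 / \<tau> * w k) * (\<tau> * sqrt (A k))" using \<tau> by simp
      also have "\<dots> \<le> (1 / \<tau> * w k) powr q + (\<tau> * sqrt (A k)) powr q'"
        unfolding q'_def using \<tau> w A q1 by (intro Young_powr) auto
      also have "\<dots> = (1 / \<tau>) powr q * w k powr q + \<tau> powr q' * sqrt (A k) powr q'"
        using \<tau> w A by (simp only: powr_mult)
      also have "sqrt (A k) powr q' = A k powr (q' / 2)"
        using A by (simp add: powr_half_sqrt[symmetric] powr_powr)
      finally show "w k * sqrt (A k) \<le> (1 / \<tau>) powr q * w k powr q + \<tau> powr q' * A k powr (q' / 2)" .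
    qed
    also have "\<dots> = (\<Sum>k=K..<N. (1 / \<tau>) powr q * w k powr q) + \<tau> powr q' * (\<Sum>k=K..<N. A k powr (q' / 2))"
      by (simp add: sum.distrib sum_distrib_left)
    also have "\<dots> \<le> \<epsilon> / 2 + \<tau> powr q' * H"
    proof (intro add_mono K0[OF K] mult_left_mono)
      have "(\<Sum>k=K..<N. A k powr (q' / 2)) \<le> (\<Sum>k<N. A k powr (q' / 2))" by (rule sum_mono2) auto
      also have "\<dots> \<le> H" using A(2) False by (simp add: q'_def)
      finally show "(\<Sum>k=K..<N. A k powr (q' / 2)) \<le> H" .
    qed auto
    also have "\<dots> \<le> \<epsilon>" using \<tau>q by simp
    finally show "(\<Sum>k=K..<N. w k * sqrt (A k)) \<le> \<epsilon>" .
  qed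
qed

section \<open>From finite capacity to finite covers with small weighted count\<close>

lemma dyadic_band_exists:
  assumes "0 < x" shows "\<exists>k. x \<in> dyadic_band k"
proof -
  define k where "k = \<lceil>- log 2 x\<rceil> - 1"
  have k: "- real_of_int k - 1 \<le> log 2 x" "log 2 x < - real_of_int k"
    unfolding k_def using ceiling_correct[of "- log 2 x"] by (simp_all, linarith+)
  have "2 powr (- real_of_int k - 1) \<le> 2 powr log 2 x" "2 powr log 2 x < 2 powr (- real_of_int k)"
    using k by (auto intro: powr_mono powr_less_mono)
  then show ?thesis using assms by (auto simp: dyadic_band_def)
qed

lemma cover_cost_bounds:
  fixes B :: "nat \<Rightarrow> 'a::metric_space set" and q :: real
  assumes q: "1 \<le> q" and cost: "cover_cost \<alpha> (dual_exp q / 2) B \<le> ennreal H" and H: "0 \<le> H"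
  obtains A :: "nat \<Rightarrow> real" where "\<And>k. 0 \<le> A k"
    "\<And>k. nnsum (\<lambda>j. if diameter (B j) \<in> dyadic_band (int k) then ennreal (diameter (B j) powr \<alpha>) else 0) = ennreal (A k)"
    "if q = 1 then \<forall>k. A k \<le> H else \<forall>N. (\<Sum>k<N. A k powr (q / (q - 1) / 2)) \<le> H"
proof -
  define I where "I k = nnsum (\<lambda>j. if diameter (B j) \<in> dyadic_band k then ennreal (diameter (B j) powr \<alpha>) else 0)" for k :: int
  \<comment> \<open>For q = 1 the exponent is \<infinity> / 2 = \<infinity>, hence the supremum
    branch of the cost.\<close>
  have c: "cover_cost \<alpha> (dual_exp q / 2) B = (if q = 1 then (SUP k. I k) else nnsum (\<lambda>k. epow (I k) (q / (q - 1) / 2)))"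
    by (auto simp: cover_cost_def Let_def I_def[abs_def] dual_exp_def)
  have fin: "I k < top" for k
  proof (cases "q = 1")
    case True
    have "I k \<le> (SUP k. I k)" by (rule SUP_upper) simp
    also have "\<dots> \<le> ennreal H" using cost c True by simp
    finally show ?thesis by (simp add: le_less_trans)
  next
    case False
    have "epow (I k) (q / (q - 1) / 2) \<le> ennreal H"
      using le_nnsum[of "\<lambda>k. epow (I k) (q / (q - 1) / 2)" k] cost c False by (auto intro: order_trans)
    then show ?thesis by (cases "I k = top") (auto simp: epow_def top_unique less_top)
  qed
  define A where "A k = enn2real (I (int k))" for k
  have A: "I (int k) = ennreal (A k)" for k using fin[of "int k"] by (simp add: A_def)
  have A0: "0 \<le> A k" for k by (simp add: A_def)
  have "if q = 1 then \<forall>k. A k \<le> H else \<forall>N. (\<Sum>k<N. A k powr (q / (q - 1) / 2)) \<le> H"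
  proof (cases "q = 1")
    case True
    have "ennreal (A k) \<le> ennreal H" for k
      using SUP_upper[of "int k" UNIV I] cost c True A[of k] by (auto intro: order_trans)
    then show ?thesis using H True by simp
  next
    case False
    have "(\<Sum>k<N. A k powr (q / (q - 1) / 2)) \<le> H" for N
    proof -
      have "ennreal (\<Sum>k<N. A k powr (q / (q - 1) / 2)) = (\<Sum>k<N. epow (I (int k)) (q / (q - 1) / 2))"
        unfolding A by (subst sum_ennreal[symmetric]) (auto simp: epow_def A0)
      also have "\<dots> = (\<Sum>k\<in>int ` {..<N}. epow (I k) (q / (q - 1) / 2))" by (subst sum.reindex) auto
      also have "\<dots> \<le> nnsum (\<lambda>k. epow (I k) (q / (q - 1) / 2))" by (rule sum_le_nnsum) auto
      also have "\<dots> \<le> ennreal H" using cost c False by simp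
      finally show ?thesis using H by (simp add: ennreal_le_iff)
    qed
    then show ?thesis using False by simp
  qed
  then show ?thesis by (rule that[OF A0 A[unfolded I_def]])
qed

text \<open>The cost bounds the number of sets in each band, and \<open>weighted_tail_small\<close>
  makes the weighted sum small. Sets of diameter 0 lie in no band and are free in the cost, yet each
  needs a ball; they are given pairwise distinct scales beyond K.\<close>

lemma NH_cap_weighted_cover:
  fixes F :: "'a::metric_space set" and w :: "nat \<Rightarrow> real" and q \<alpha> \<epsilon> :: real
  assumes \<alpha>: "0 < \<alpha>" and q: "1 \<le> q" and cap: "NH_cap \<alpha> (dual_exp q / 2) F < top"
    and w: "\<And>k. 0 \<le> w k" "summable (\<lambda>k. w k powr q)" and \<epsilon>: "0 < \<epsilon>"
  shows "\<exists>(B :: nat \<Rightarrow> 'a set) (\<kappa> :: nat \<Rightarrow> nat). F \<subseteq> (\<Union>j. B j) \<and> (\<forall>j. \<forall>x\<in>B j. \<forall>y\<in>B j. dist x y \<le> 1 / 2 ^ \<kappa> j) \<and>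
    (\<forall>J N. finite J \<longrightarrow> (\<Sum>k<N. w k * sqrt (real (card {j\<in>J. \<kappa> j = k}) * 2 powr (- \<alpha> * k))) \<le> \<epsilon>)"
proof -
  obtain H0 where H0: "NH_cap \<alpha> (dual_exp q / 2) F = ennreal H0" "H0 \<ge> 0"
    using cap by (cases "NH_cap \<alpha> (dual_exp q / 2) F") auto
  define H where "H = H0 + 1"
  have H: "H \<ge> 0" "H0 < H" using H0 by (auto simp: H_def)
  \<comment> \<open>A set in band k has diameter at least 2^-(k+1), not 2^-k, which costs a factor
    2^\<alpha> in the count and \<open>c\<close> under the square root.\<close>
  define c where "c = sqrt (2 powr \<alpha>)"
  have c: "c > 0" by (simp add: c_def)
  have "0 < \<epsilon> / (2 * c)" using c \<epsilon> by simp
  from weighted_tail_small[OF q w H(1) this]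
  obtain K1 where K1: "\<And>K A N. K \<ge> K1 \<Longrightarrow> (\<forall>k. 0 \<le> A k) \<Longrightarrow>
     (if q = 1 then \<forall>k. A k \<le> H else \<forall>N. (\<Sum>k<N. A k powr (q / (q - 1) / 2)) \<le> H) \<Longrightarrow>
       (\<Sum>k=K..<N. w k * sqrt (A k)) \<le> \<epsilon> / (2 * c)" by blast
  \<comment> \<open>The square root of the weight of one set at scale 1. Sets of diameter 0, at most
    one per scale, contribute at most \<open>w k * r ^ k\<close>, so it suffices that
    \<open>w k\<close> is at most 1 from \<open>K3\<close> on.\<close>
  define r where "r = 2 powr (- \<alpha> / 2)"
  have r: "0 < r" "r < 1" using \<alpha> by (auto simp: r_def intro!: powr_less_one)
  have "\<forall>\<^sub>F k in sequentially. w k powr q < 1"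
    by (rule order_tendstoD(2)[OF summable_LIMSEQ_zero[OF w(2)] zero_less_one])
  then obtain K3 where K3: "\<And>k. k \<ge> K3 \<Longrightarrow> w k powr q < 1"
    unfolding eventually_sequentially by blast
  have w1: "w k \<le> 1" if "k \<ge> K3" for k
  proof (rule ccontr)
    assume "\<not> w k \<le> 1"
    then have "1 \<le> w k powr q" using q by (intro ge_one_powr_ge_zero) auto
    then show False using K3[OF that] by simp
  qed
  have "summable (\<lambda>k. r ^ k)" using r by (intro summable_geometric) auto
  moreover have "0 < \<epsilon> / 2" using \<epsilon> by simp
  ultimately obtain K2 where K2: "\<And>K N. K \<ge> K2 \<Longrightarrow> (\<Sum>k=K..<N. r ^ k) \<le> \<epsilon> / 2"
    using summable_tail_le[of "\<lambda>k. r ^ k"] r by (metis less_imp_le zero_le_power)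
  define K where "K = max K1 (max K2 K3)"
  have "NH_cap_delta \<alpha> (dual_exp q / 2) F (1 / 2 ^ K) \<le> NH_cap \<alpha> (dual_exp q / 2) F"
    unfolding NH_cap_def by (rule SUP_upper) simp
  also have "\<dots> < ennreal H" using H H0 by (simp add: ennreal_less_iff)
  finally obtain B where B: "F \<subseteq> (\<Union>j. B j)" "\<And>j. bounded (B j)" "\<And>j. diameter (B j) < 1 / 2 ^ K"
    and "cover_cost \<alpha> (dual_exp q / 2) B < ennreal H"
    unfolding NH_cap_delta_def INF_less_iff by blast
  then have "cover_cost \<alpha> (dual_exp q / 2) B \<le> ennreal H" by simp
  from cover_cost_bounds[OF q this H(1)] obtain A :: "nat \<Rightarrow> real" where A: "\<And>k. 0 \<le> A k"
    "\<And>k. nnsum (\<lambda>j. if diameter (B j) \<in> dyadic_band (int k) then ennreal (diameter (B j) powr \<alpha>) else 0) = ennreal (A k)"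
    "if q = 1 then \<forall>k. A k \<le> H else \<forall>N. (\<Sum>k<N. A k powr (q / (q - 1) / 2)) \<le> H" by blast
  have band: "\<exists>k\<ge>K. diameter (B j) \<in> dyadic_band (int k)" if "diameter (B j) \<noteq> 0" for j
  proof -
    have "0 < diameter (B j)" using that diameter_ge_0[OF B(2)[of j]] by simp
    then obtain m where m: "diameter (B j) \<in> dyadic_band m" using dyadic_band_exists by blast
    then have "2 powr (- real_of_int m - 1) < 1 / 2 ^ K" using B(3)[of j] by (auto simp: dyadic_band_def)
    also have "1 / 2 ^ K = 2 powr (- real K)" by (simp add: powr_minus powr_realpow inverse_eq_divide)
    finally have "- real_of_int m - 1 < - real K" by simp
    then have "m \<ge> int K" by linarith
    then show ?thesis using m by (intro exI[of _ "nat m"]) auto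
  qed
  \<comment> \<open>Scale \<open>K + j\<close> for a set of diameter 0 makes the assignment
    injective on such sets.\<close>
  define \<kappa> where "\<kappa> j = (if diameter (B j) = 0 then K + j else SOME k. k \<ge> K \<and> diameter (B j) \<in> dyadic_band (int k))" for j
  have \<kappa>: "diameter (B j) \<noteq> 0 \<Longrightarrow> \<kappa> j \<ge> K \<and> diameter (B j) \<in> dyadic_band (int (\<kappa> j))" for j
    using someI_ex[OF band[of j]] by (simp add: \<kappa>_def)
  have \<kappa>K: "\<kappa> j \<ge> K" for j using \<kappa>[of j] by (cases "diameter (B j) = 0") (auto simp: \<kappa>_def)
  have dist: "dist x y \<le> 1 / 2 ^ \<kappa> j" if "x \<in> B j" "y \<in> B j" for j x y
  proof -
    have "dist x y \<le> diameter (B j)" by (rule diameter_bounded_bound[OF B(2) that])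
    also have "\<dots> \<le> 1 / 2 ^ \<kappa> j"
    proof (cases "diameter (B j) = 0")
      case False
      then have "diameter (B j) < 2 powr (- real (\<kappa> j))" using \<kappa>[of j] by (auto simp: dyadic_band_def)
      then show ?thesis by (simp add: powr_minus powr_realpow inverse_eq_divide)
    qed simp
    finally show ?thesis .
  qed
  have small: "(\<Sum>k<N. w k * sqrt (real (card {j\<in>J. \<kappa> j = k}) * 2 powr (- \<alpha> * k))) \<le> \<epsilon>" if J: "finite J" for J N
  proof -
    have card_le: "real (card {j\<in>J. \<kappa> j = k}) * 2 powr (- \<alpha> * k) \<le> 2 powr (- \<alpha> * k) + 2 powr \<alpha> * A k" for k
    proof -
      let ?Z = "{j\<in>J. \<kappa> j = k \<and> diameter (B j) = 0}" and ?P = "{j\<in>J. \<kappa> j = k \<and> diameter (B j) \<noteq> 0}"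
      have "{j\<in>J. \<kappa> j = k} = ?Z \<union> ?P" by auto
      then have "card {j\<in>J. \<kappa> j = k} \<le> card ?Z + card ?P" using card_Un_le[of ?Z ?P] by simp
      moreover have "card ?Z \<le> 1"
      proof -
        have "?Z \<subseteq> {k - K}" by (auto simp: \<kappa>_def)
        then show ?thesis using card_mono[of "{k - K}" ?Z] by simp
      qed
      ultimately have "real (card {j\<in>J. \<kappa> j = k}) \<le> 1 + real (card ?P)" by linarith
      then have "real (card {j\<in>J. \<kappa> j = k}) * 2 powr (- \<alpha> * k) \<le> (1 + real (card ?P)) * 2 powr (- \<alpha> * k)"
        by (intro mult_right_mono) auto
      moreover have "real (card ?P) * 2 powr (- \<alpha> * k) \<le> 2 powr \<alpha> * A k"
      proof -
        have bnd: "2 powr (- \<alpha> * (k + 1)) \<le> diameter (B j) powr \<alpha>" if "j \<in> ?P" for j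
        proof -
          have "2 powr (- real k - 1) \<le> diameter (B j)" using \<kappa>[of j] that by (auto simp: dyadic_band_def)
          then have "(2 powr (- real k - 1)) powr \<alpha> \<le> diameter (B j) powr \<alpha>" using \<alpha> by (intro powr_mono2) auto
          moreover have "(- real k - 1) * \<alpha> = - \<alpha> * (k + 1)" by (simp add: algebra_simps)
          ultimately show ?thesis by (simp only: powr_powr)
        qed
        have "ennreal (real (card ?P) * 2 powr (- \<alpha> * (k + 1))) = ennreal (\<Sum>j\<in>?P. 2 powr (- \<alpha> * (k + 1)))" by simp
        also have "\<dots> \<le> ennreal (\<Sum>j\<in>?P. diameter (B j) powr \<alpha>)" by (intro ennreal_leI sum_mono bnd)
        also have "\<dots> = (\<Sum>j\<in>?P. ennreal (diameter (B j) powr \<alpha>))" by (rule sum_ennreal[symmetric]) auto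
        also have "\<dots> = (\<Sum>j\<in>?P. if diameter (B j) \<in> dyadic_band (int k) then ennreal (diameter (B j) powr \<alpha>) else 0)"
          using \<kappa> by (intro sum.cong) auto
        also have "\<dots> \<le> ennreal (A k)" unfolding A(2)[symmetric] by (rule sum_le_nnsum) (use J in auto)
        finally have "real (card ?P) * 2 powr (- \<alpha> * (k + 1)) \<le> A k" using A(1)[of k] by (simp add: ennreal_le_iff)
        then have "2 powr \<alpha> * (real (card ?P) * 2 powr (- \<alpha> * (k + 1))) \<le> 2 powr \<alpha> * A k" by (intro mult_left_mono) auto
        then have "real (card ?P) * (2 powr \<alpha> * 2 powr (- \<alpha> * (k + 1))) \<le> 2 powr \<alpha> * A k" by (simp only: mult.left_commute)
        moreover have "2 powr \<alpha> * 2 powr (- \<alpha> * (k + 1)) = 2 powr (- \<alpha> * k)"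
          by (simp only: powr_add[symmetric]) (simp add: algebra_simps)
        ultimately show ?thesis by (simp only:)
      qed
      ultimately show ?thesis by (simp add: algebra_simps)
    qed
    have "(\<Sum>k<N. w k * sqrt (real (card {j\<in>J. \<kappa> j = k}) * 2 powr (- \<alpha> * k))) = (\<Sum>k=K..<N. w k * sqrt (real (card {j\<in>J. \<kappa> j = k}) * 2 powr (- \<alpha> * k)))"
    proof (rule sum.mono_neutral_right)
      show "\<forall>k\<in>{..<N} - {K..<N}. w k * sqrt (real (card {j\<in>J. \<kappa> j = k}) * 2 powr (- \<alpha> * k)) = 0"
      proof
        fix k assume "k \<in> {..<N} - {K..<N}"
        then have "{j\<in>J. \<kappa> j = k} = {}" using \<kappa>K by fastforce
        then show "w k * sqrt (real (card {j\<in>J. \<kappa> j = k}) * 2 powr (- \<alpha> * k)) = 0" by (simp only: card.empty) simp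
      qed
    qed auto
    also have "\<dots> \<le> (\<Sum>k=K..<N. r ^ k + c * (w k * sqrt (A k)))"
    proof (rule sum_mono)
      fix k assume "k \<in> {K..<N}"
      then have wk: "w k \<le> 1" using w1 by (auto simp: K_def)
      have "sqrt (real (card {j\<in>J. \<kappa> j = k}) * 2 powr (- \<alpha> * k)) \<le> sqrt (2 powr (- \<alpha> * k) + 2 powr \<alpha> * A k)"
        using card_le by (intro real_sqrt_le_mono)
      also have "\<dots> \<le> sqrt (2 powr (- \<alpha> * k)) + sqrt (2 powr \<alpha> * A k)"
        using A(1) by (intro sqrt_add_le_add_sqrt) auto
      also have "sqrt (2 powr (- \<alpha> * k)) = r ^ k"
        by (simp add: r_def powr_half_sqrt[symmetric] powr_powr powr_power mult_ac)
      also have "sqrt (2 powr \<alpha> * A k) = c * sqrt (A k)" by (simp add: c_def real_sqrt_mult)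
      finally have "w k * sqrt (real (card {j\<in>J. \<kappa> j = k}) * 2 powr (- \<alpha> * k)) \<le> w k * (r ^ k + c * sqrt (A k))"
        using w by (intro mult_left_mono) auto
      also have "\<dots> = w k * r ^ k + c * (w k * sqrt (A k))" by (simp add: algebra_simps)
      also have "w k * r ^ k \<le> 1 * r ^ k" using wk r by (intro mult_right_mono) auto
      finally show "w k * sqrt (real (card {j\<in>J. \<kappa> j = k}) * 2 powr (- \<alpha> * k)) \<le> r ^ k + c * (w k * sqrt (A k))" by simp
    qed
    also have "\<dots> = (\<Sum>k=K..<N. r ^ k) + c * (\<Sum>k=K..<N. w k * sqrt (A k))"
      by (simp add: sum.distrib sum_distrib_left)
    also have "\<dots> \<le> \<epsilon> / 2 + c * (\<epsilon> / (2 * c))"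
      using A c by (intro add_mono K2 mult_left_mono K1) (auto simp: K_def)
    also have "\<dots> = \<epsilon>" using c by simp
    finally show ?thesis .
  qed
  show ?thesis by (intro exI[of _ B] exI[of _ \<kappa>] conjI allI ballI impI B(1) dist small)
qed

lemma sqrt_sum_le: "finite I \<Longrightarrow> (\<And>i. i \<in> I \<Longrightarrow> 0 \<le> f i) \<Longrightarrow> sqrt (\<Sum>i\<in>I. f i) \<le> (\<Sum>i\<in>I. sqrt (f i))"
proof (induction I rule: finite_induct)
  case (insert i I)
  have "sqrt (f i + (\<Sum>i\<in>I. f i)) \<le> sqrt (f i) + sqrt (\<Sum>i\<in>I. f i)"
    using insert by (intro sqrt_add_le_add_sqrt sum_nonneg) auto
  then show ?case using insert by fastforce
qed simp

text \<open>Piece i receives the budget \<epsilon> / 2^(i+1) and its own starting scale, so no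
  uniform bound on the capacities of the pieces enters. Counts at one scale add over the pieces, and
  subadditivity of the square root lets the budgets be summed. Compactness then leaves finitely many
  balls.\<close>

lemma sigma_finite_weighted_cover:
  fixes S :: "'a::metric_space set" and w :: "nat \<Rightarrow> real" and q \<alpha> \<epsilon> :: real
  assumes \<alpha>: "0 < \<alpha>" and q: "1 \<le> q" and S: "compact S" "sigma_finite_NH \<alpha> (dual_exp q / 2) S"
    and w: "\<And>k. 0 \<le> w k" "summable (\<lambda>k. w k powr q)" and \<epsilon>: "0 < \<epsilon>"
  obtains P :: "(nat \<times> nat) set" and y :: "nat \<times> nat \<Rightarrow> 'a" and \<kappa> :: "nat \<times> nat \<Rightarrow> nat"
  where "finite P" "S \<subseteq> (\<Union>p\<in>P. ball (y p) (2 / 2 ^ \<kappa> p))"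
    "\<And>N. (\<Sum>k<N. w k * sqrt (real (card {p\<in>P. \<kappa> p = k}) * 2 powr (- \<alpha> * k))) \<le> \<epsilon>"
proof -
  from S(2)[unfolded sigma_finite_NH_def]
  obtain Si :: "nat \<Rightarrow> 'a set" where Si': "S = (\<Union>i. Si i) \<and> (\<forall>i. NH_cap \<alpha> (dual_exp q / 2) (Si i) < top)" ..
  note Si = Si'[THEN conjunct1] Si'[THEN conjunct2, rule_format]
  define good where "good i B\<kappa> \<longleftrightarrow> Si i \<subseteq> (\<Union>j. fst B\<kappa> j) \<and> (\<forall>j. \<forall>x\<in>fst B\<kappa> j. \<forall>y\<in>fst B\<kappa> j. dist x y \<le> 1 / 2 ^ snd B\<kappa> j) \<and>
    (\<forall>J N. finite J \<longrightarrow> (\<Sum>k<N. w k * sqrt (real (card {j\<in>J. snd B\<kappa> j = k}) * 2 powr (- \<alpha> * k))) \<le> \<epsilon> * (1 / 2) ^ Suc i)"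
    for i and B\<kappa> :: "(nat \<Rightarrow> 'a set) \<times> (nat \<Rightarrow> nat)"
  have "\<exists>B\<kappa>. good i B\<kappa>" for i
  proof -
    have "0 < \<epsilon> * (1 / 2) ^ Suc i" using \<epsilon> by simp
    from NH_cap_weighted_cover[OF \<alpha> q Si(2)[of i] w this] have "\<exists>B \<kappa>. good i (B, \<kappa>)"
      unfolding good_def fst_conv snd_conv .
    then show ?thesis by blast
  qed
  then obtain B\<kappa> where B\<kappa>: "\<And>i. good i (B\<kappa> i)" using choice[of good] by blast
  define B where "B i = fst (B\<kappa> i)" for i
  define \<kappa> where "\<kappa> i = snd (B\<kappa> i)" for i
  note G = B\<kappa>[unfolded good_def, folded B_def \<kappa>_def]
  note B = G[THEN conjunct1] G[THEN conjunct2, THEN conjunct1, rule_format]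
    G[THEN conjunct2, THEN conjunct2, rule_format]
  define y where "y p = (SOME x. x \<in> B (fst p) (snd p))" for p
  define k where "k p = \<kappa> (fst p) (snd p)" for p
  \<comment> \<open>Twice the diameter bound is taken as radius: the covering sets need not be open,
    but these balls are.\<close>
  have "S \<subseteq> (\<Union>p\<in>UNIV. ball (y p) (2 / 2 ^ k p))"
  proof
    fix x assume "x \<in> S"
    then obtain i j where x: "x \<in> B i j" using Si(1) B(1) by blast
    then have "y (i, j) \<in> B i j" unfolding y_def by (auto intro: someI)
    then have "dist (y (i, j)) x \<le> 1 / 2 ^ \<kappa> i j" using x by (intro B(2))
    also have "\<dots> < 2 / 2 ^ \<kappa> i j" by (simp add: divide_strict_right_mono)
    finally show "x \<in> (\<Union>p\<in>UNIV. ball (y p) (2 / 2 ^ k p))" by (intro UN_I[of "(i, j)"]) (auto simp: k_def)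
  qed
  then obtain P where P: "P \<subseteq> UNIV" "finite P" "S \<subseteq> (\<Union>p\<in>P. ball (y p) (2 / 2 ^ k p))"
    using compactE_image[OF S(1), of UNIV "\<lambda>p. ball (y p) (2 / 2 ^ k p)"] by auto
  have "(\<Sum>l<N. w l * sqrt (real (card {p\<in>P. k p = l}) * 2 powr (- \<alpha> * l))) \<le> \<epsilon>" for N
  proof -
    define I where "I = fst ` P"
    define J where "J i = {j. (i, j) \<in> P}" for i
    have fI: "finite I" using P by (simp add: I_def)
    have fJ: "finite (J i)" for i
    proof (rule finite_subset)
      show "J i \<subseteq> snd ` P" by (force simp: J_def)
    qed (use P in simp)
    have cardeq: "card {p\<in>P. k p = l} = (\<Sum>i\<in>I. card {j\<in>J i. \<kappa> i j = l})" for l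
    proof -
      have "{p\<in>P. k p = l} = Sigma I (\<lambda>i. {j\<in>J i. \<kappa> i j = l})" by (force simp: I_def J_def k_def)
      then show ?thesis using fI fJ by (simp add: card_SigmaI)
    qed
    have "(\<Sum>l<N. w l * sqrt (real (card {p\<in>P. k p = l}) * 2 powr (- \<alpha> * l)))
       \<le> (\<Sum>l<N. \<Sum>i\<in>I. w l * sqrt (real (card {j\<in>J i. \<kappa> i j = l}) * 2 powr (- \<alpha> * l)))"
    proof (rule sum_mono)
      fix l
      have "real (card {p\<in>P. k p = l}) * 2 powr (- \<alpha> * l) = (\<Sum>i\<in>I. real (card {j\<in>J i. \<kappa> i j = l}) * 2 powr (- \<alpha> * l))"
        by (simp add: cardeq sum_distrib_right)
      then have "sqrt (real (card {p\<in>P. k p = l}) * 2 powr (- \<alpha> * l)) \<le> (\<Sum>i\<in>I. sqrt (real (card {j\<in>J i. \<kappa> i j = l}) * 2 powr (- \<alpha> * l)))"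
        using sqrt_sum_le[OF fI, of "\<lambda>i. real (card {j\<in>J i. \<kappa> i j = l}) * 2 powr (- \<alpha> * l)"] by simp
      then show "w l * sqrt (real (card {p\<in>P. k p = l}) * 2 powr (- \<alpha> * l)) \<le> (\<Sum>i\<in>I. w l * sqrt (real (card {j\<in>J i. \<kappa> i j = l}) * 2 powr (- \<alpha> * l)))"
        unfolding sum_distrib_left[symmetric] by (intro mult_left_mono w)
    qed
    also have "\<dots> = (\<Sum>i\<in>I. \<Sum>l<N. w l * sqrt (real (card {j\<in>J i. \<kappa> i j = l}) * 2 powr (- \<alpha> * l)))" by (rule sum.swap)
    also have "\<dots> \<le> (\<Sum>i\<in>I. \<epsilon> * (1 / 2) ^ Suc i)" by (intro sum_mono B(3) fJ)
    also have "\<dots> \<le> (\<Sum>i. \<epsilon> * (1 / 2) ^ Suc i)"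
      using \<epsilon> fI power_half_series by (intro sum_le_suminf summable_mult sums_summable) auto
    also have "\<dots> = \<epsilon>"
      using sums_unique[OF sums_mult[OF power_half_series, of \<epsilon>]] by simp
    finally show ?thesis .
  qed
  then show ?thesis by (rule that[OF P(2,3)])
qed


section \<open>Localisation of test functions to the covering\<close>

text \<open>A cube of side 2 / 2^k containing the support of \<open>lbump k n\<close>; neighbouring
  cubes overlap.\<close>

definition dcube :: "nat \<Rightarrow> ('a::euclidean_space \<Rightarrow> int) \<Rightarrow> 'a set" where
  "dcube k n = cbox (\<Sum>b\<in>Basis. ((of_int (n b) - 1) / 2 ^ k) *\<^sub>R b) (\<Sum>b\<in>Basis. ((of_int (n b) + 1) / 2 ^ k) *\<^sub>R b)"

lemma dcube_iff: "x \<in> dcube k n \<longleftrightarrow> (\<forall>b\<in>Basis. \<bar>2 ^ k * (x \<bullet> b) - of_int (n b)\<bar> \<le> 1)"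
  by (simp add: dcube_def mem_box abs_le_iff field_simps) (smt (verit))

lemma emeasure_dcube: "emeasure lborel (dcube k n :: 'a::euclidean_space set) = ennreal ((2 / 2 ^ k) ^ DIM('a))"
proof -
  have "(of_int (n b) + 1) / 2 ^ k - (of_int (n b) - 1) / 2 ^ k = 2 / (2 :: real) ^ k" for b :: 'a
    by (simp add: diff_divide_distrib[symmetric])
  then show ?thesis
    unfolding dcube_def by (subst emeasure_lborel_cbox) (auto simp: divide_right_mono inner_diff_left)
qed

lemma lcut_outside: "x \<notin> (\<Union>n\<in>Q. dcube k n) \<Longrightarrow> lcut k Q x = 0"
  unfolding lcut_def by (rule sum.neutral) (use lbump_supp in \<open>force simp: dcube_iff\<close>)

definition layer :: "(nat \<Rightarrow> ('a::euclidean_space \<Rightarrow> int) set) \<Rightarrow> nat \<Rightarrow> 'a \<Rightarrow> complex" where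
  "layer Q k x = lcut k (Q k) x * (\<Prod>l<k. 1 - lcut l (Q l) x)"

lemma smooth_layer: "smooth_fun (layer Q k)"
  unfolding layer_def[abs_def]
  by (intro smooth_fun_mult smooth_fun_prod smooth_fun_diff smooth_lcut smooth_fun_const)

text \<open>Each layer is the difference of two consecutive partial products of complements.\<close>

lemma layer_telescope: "(\<Sum>k<N. layer Q k x) = 1 - (\<Prod>l<N. 1 - lcut l (Q l) x)"
  by (induction N) (auto simp: layer_def algebra_simps)

text \<open>Stated at s = 1, which by \<open>wsum_mono\<close> serves every scale 1 / 2^k.\<close>

lemma wsum_test_fun_bounded:
  fixes \<psi> :: "'a::euclidean_space \<Rightarrow> complex"
  assumes "test_fun \<psi>"
  shows "\<exists>B\<ge>0. \<forall>x. wsum 1 bs \<psi> x \<le> B"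
proof -
  let ?C = "closure {x. \<psi> x \<noteq> 0}"
  have sm: "smooth_fun \<psi>" and bd: "bounded {x. \<psi> x \<noteq> 0}" using assms by (auto simp: test_fun_def)
  have "compact (wsum 1 bs \<psi> ` ?C)"
    using bd by (intro compact_continuous_image wsum_continuous_on sm) (auto simp: compact_closure)
  then obtain B where B: "\<forall>x\<in>?C. \<bar>wsum 1 bs \<psi> x\<bar> \<le> B" by (auto dest!: compact_imp_bounded simp: bounded_iff)
  have "wsum 1 bs \<psi> x \<le> max B 0" for x
  proof (cases "x \<in> ?C")
    case True then show ?thesis using B by (fastforce simp: le_max_iff_disj)
  next
    case False
    have "wsum 1 bs \<psi> x = 0"
      by (rule wsum_zero_on[of "- ?C"]) (use False closure_subset[of "{x. \<psi> x \<noteq> 0}"] in auto)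
    then show ?thesis by simp
  qed
  then show ?thesis by (intro exI[of _ "max B 0"]) auto
qed

text \<open>At s = 1 / 2^k the localised function has bounded weighted norm and vanishes off the
  cubes of Q k, so the L2 norm of its \<open>bessel_op\<close> is at most a constant times the root
  of their total volume. \<open>C\<close> must not depend on Q, k or g, because the cover is chosen
  afterwards.\<close>

lemma layer_pairing_bound:
  fixes \<psi> :: "'a::euclidean_space \<Rightarrow> complex"
  assumes \<psi>: "test_fun \<psi>"
  shows "\<exists>C\<ge>0. \<forall>g k Q G lam. g \<in> borel_measurable borel \<longrightarrow> 0 \<le> G \<longrightarrow> 0 \<le> lam \<longrightarrow>
    (\<forall>l. finite (Q l) \<and> Q l \<subseteq> extensional Basis) \<longrightarrow>
    (\<integral>\<^sup>+\<xi>. ennreal ((cmod (g \<xi>))\<^sup>2) * indicator {\<xi>. cmod (g \<xi>) > lam} \<xi> \<partial>lborel) \<le> ennreal (G\<^sup>2) \<longrightarrow>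
    (\<integral>\<^sup>+\<xi>. ennreal (cmod (g \<xi>) * cmod (inv_fourier (\<lambda>x. \<psi> x * layer Q k x) \<xi>)) \<partial>lborel)
      \<le> ennreal (C * (G + lam * sqrt ((2 ^ k) ^ DIM('a))) * sqrt (real (card (Q k)) * (1 / 2 ^ k) ^ DIM('a)))"
proof -
  obtain bs :: "'a list" where bs: "distinct bs" "set bs = Basis" using finite_distinct_list[of Basis] by auto
  obtain C0 where C0: "C0 > 0" and C0': "\<forall>g f s \<mu> G V bs. g \<in> borel_measurable (borel :: 'a measure) \<longrightarrow> test_fun f \<longrightarrow> 0 < s \<longrightarrow> 0 \<le> \<mu> \<longrightarrow> 0 \<le> G \<longrightarrow> 0 \<le> V \<longrightarrow>
     distinct bs \<longrightarrow> set bs = (Basis :: 'a set) \<longrightarrow>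
     (\<integral>\<^sup>+\<xi>. ennreal ((cmod (g \<xi>))\<^sup>2) * indicator {\<xi>. cmod (g \<xi>) > \<mu>} \<xi> \<partial>lborel) \<le> ennreal (G\<^sup>2) \<longrightarrow>
     (\<integral>\<^sup>+x. ennreal ((cmod (bessel_op s bs f x))\<^sup>2) \<partial>lborel) \<le> ennreal (V\<^sup>2) \<longrightarrow>
     (\<integral>\<^sup>+\<xi>. ennreal (cmod (g \<xi>) * cmod (inv_fourier f \<xi>)) \<partial>lborel) \<le> ennreal (C0 * (G + \<mu> * sqrt ((1 / s) ^ DIM('a))) * V)"
    using inv_fourier_pairing_bound[where 'a='a] by (elim exE conjE)
  obtain C1 where C1: "C1 \<ge> 0" and C1'': "\<forall>k Q bs (x::'a). (\<forall>l. finite (Q l) \<and> Q l \<subseteq> extensional Basis) \<longrightarrow>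
    set bs \<subseteq> Basis \<longrightarrow> distinct bs \<longrightarrow> wsum (1 / 2 ^ k) bs (layer Q k) x \<le> C1"
    using wsum_lcut_prod[where 'a='a] unfolding layer_def[abs_def] by (elim exE conjE)
  have C1': "wsum (1 / 2 ^ k) bs (layer Q k) x \<le> C1" if "\<forall>l. finite (Q l) \<and> Q l \<subseteq> extensional Basis" for k Q x
    using C1''[rule_format, of Q bs k x] that bs by simp
  obtain B where B: "B \<ge> 0" "\<And>x. wsum 1 bs \<psi> x \<le> B" using wsum_test_fun_bounded[OF \<psi>] by blast
  \<comment> \<open>The root of 2^d accounts for cubes of side 2 / 2^k in place of 1 / 2^k.\<close>
  define c where "c = C0 * (B * C1) * sqrt (2 ^ DIM('a))"
  show ?thesis
  proof (intro exI[of _ c] conjI allI impI)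
    show "0 \<le> c" using C0 C1 B by (simp add: c_def)
  next
    fix g :: "'a \<Rightarrow> complex" and k and Q :: "nat \<Rightarrow> ('a \<Rightarrow> int) set" and G lam :: real
    assume g: "g \<in> borel_measurable borel" and G: "0 \<le> G" and lam: "0 \<le> lam"
      and Q: "\<forall>l. finite (Q l) \<and> Q l \<subseteq> extensional Basis"
      and tail: "(\<integral>\<^sup>+\<xi>. ennreal ((cmod (g \<xi>))\<^sup>2) * indicator {\<xi>. cmod (g \<xi>) > lam} \<xi> \<partial>lborel) \<le> ennreal (G\<^sup>2)"
    let ?f = "\<lambda>x. \<psi> x * layer Q k x" and ?s = "1 / 2 ^ k :: real"
    let ?Z = "\<Union>n\<in>Q k. dcube k n"
    have sm\<psi>: "smooth_fun \<psi>" using \<psi> by (simp add: test_fun_def)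
    have t: "test_fun ?f" by (intro test_fun_mult \<psi> smooth_layer)
    have s: "0 < ?s" "?s \<le> 1" by (auto simp: divide_le_eq)
    have wB: "wsum ?s bs ?f x \<le> B * C1" for x
    proof -
      have "wsum ?s bs ?f x \<le> wsum ?s bs \<psi> x * wsum ?s bs (layer Q k) x"
        using s by (intro wsum_mult sm\<psi> smooth_layer) auto
      also have "\<dots> \<le> B * C1"
        using s B C1 wsum_mono[of ?s 1 bs \<psi> x] C1'[OF Q, of k x] by (intro mult_mono order_trans[OF _ B(2)] wsum_nonneg) auto
      finally show ?thesis .
    qed
    have cZ: "closed ?Z" using Q by (intro closed_UN) (auto simp: dcube_def)
    have w0: "wsum ?s bs ?f x = 0" if "x \<notin> ?Z" for x
    proof (rule wsum_zero_on[of "- ?Z"])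
      show "open (- ?Z)" by (rule open_Compl[OF cZ])
      show "\<psi> x * layer Q k x = 0" if "x \<in> - ?Z" for x
        using that lcut_outside[of x k "Q k"] by (simp add: layer_def)
    qed (use that in simp)
    have "(\<integral>\<^sup>+x. ennreal ((cmod (bessel_op ?s bs ?f x))\<^sup>2) \<partial>lborel) \<le> (\<integral>\<^sup>+x. ennreal ((B * C1)\<^sup>2) * indicator ?Z x \<partial>lborel)"
    proof (rule nn_integral_mono)
      fix x
      have "cmod (bessel_op ?s bs ?f x) \<le> wsum ?s bs ?f x"
        using s t by (intro bessel_op_le_wsum) (auto simp: test_fun_def)
      then show "ennreal ((cmod (bessel_op ?s bs ?f x))\<^sup>2) \<le> ennreal ((B * C1)\<^sup>2) * indicator ?Z x"
        using w0[of x] wB[of x] by (cases "x \<in> ?Z") (auto intro!: ennreal_leI power_mono)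
    qed
    also have "\<dots> = ennreal ((B * C1)\<^sup>2) * emeasure lborel ?Z"
      using cZ by (intro nn_integral_cmult_indicator) auto
    also have "emeasure lborel ?Z \<le> (\<Sum>n\<in>Q k. emeasure lborel (dcube k n))"
      using Q by (intro emeasure_subadditive_finite) (auto simp: dcube_def)
    also have "\<dots> = ennreal (real (card (Q k)) * (2 / 2 ^ k) ^ DIM('a))"
      by (simp add: emeasure_dcube ennreal_mult ennreal_of_nat_eq_real_of_nat)
    finally have "(\<integral>\<^sup>+x. ennreal ((cmod (bessel_op ?s bs ?f x))\<^sup>2) \<partial>lborel) \<le> ennreal ((B * C1)\<^sup>2) * ennreal (real (card (Q k)) * (2 / 2 ^ k) ^ DIM('a))"
      by (simp add: mult_left_mono)
    also have "\<dots> = ennreal ((B * C1 * sqrt (real (card (Q k)) * (2 / 2 ^ k) ^ DIM('a)))\<^sup>2)"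
      by (simp add: ennreal_mult'[symmetric] power_mult_distrib)
    finally have V: "(\<integral>\<^sup>+x. ennreal ((cmod (bessel_op ?s bs ?f x))\<^sup>2) \<partial>lborel) \<le> ennreal ((B * C1 * sqrt (real (card (Q k)) * (2 / 2 ^ k) ^ DIM('a)))\<^sup>2)" .
    have "(\<integral>\<^sup>+\<xi>. ennreal (cmod (g \<xi>) * cmod (inv_fourier ?f \<xi>)) \<partial>lborel)
       \<le> ennreal (C0 * (G + lam * sqrt ((1 / ?s) ^ DIM('a))) * (B * C1 * sqrt (real (card (Q k)) * (2 / 2 ^ k) ^ DIM('a))))"
      using B C1 by (intro C0'[rule_format, OF g t s(1) lam G _ bs tail V]) auto
    also have "C0 * (G + lam * sqrt ((1 / ?s) ^ DIM('a))) * (B * C1 * sqrt (real (card (Q k)) * (2 / 2 ^ k) ^ DIM('a)))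
       = c * (G + lam * sqrt ((2 ^ k) ^ DIM('a))) * sqrt (real (card (Q k)) * (1 / 2 ^ k) ^ DIM('a))"
    proof -
      have "real (card (Q k)) * (2 / 2 ^ k) ^ DIM('a) = 2 ^ DIM('a) * (real (card (Q k)) * (1 / 2 ^ k) ^ DIM('a))"
        by (simp add: power_divide)
      then have "sqrt (real (card (Q k)) * (2 / 2 ^ k) ^ DIM('a)) = sqrt (2 ^ DIM('a)) * sqrt (real (card (Q k)) * (1 / 2 ^ k) ^ DIM('a))"
        by (simp only: real_sqrt_mult)
      moreover have "1 / ?s = 2 ^ k" by simp
      ultimately show ?thesis unfolding c_def by (simp only: mult_ac)
    qed
    finally show "(\<integral>\<^sup>+\<xi>. ennreal (cmod (g \<xi>) * cmod (inv_fourier ?f \<xi>)) \<partial>lborel)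
      \<le> ennreal (c * (G + lam * sqrt ((2 ^ k) ^ DIM('a))) * sqrt (real (card (Q k)) * (1 / 2 ^ k) ^ DIM('a)))" .
  qed
qed

text \<open>In units of 2^-k, 3 is the radius 2 of a covering ball plus the half-side 1 of a
  cube.\<close>

definition near_cubes :: "nat \<Rightarrow> 'a::euclidean_space \<Rightarrow> ('a \<Rightarrow> int) set" where
  "near_cubes k y = {n \<in> extensional Basis. \<forall>b\<in>Basis. \<bar>2 ^ k * (y \<bullet> b) - of_int (n b)\<bar> \<le> 3}"

lemma near_cubes_card:
  fixes y :: "'a::euclidean_space"
  shows "finite (near_cubes k y)" and "card (near_cubes k y) \<le> 7 ^ DIM('a)"
proof -
  define F where "F b = {\<lceil>2 ^ k * (y \<bullet> b) - 3\<rceil>..\<lfloor>2 ^ k * (y \<bullet> b) + 3\<rfloor>}" for b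
  have sub: "near_cubes k y \<subseteq> PiE Basis F"
  proof
    fix n assume n: "n \<in> near_cubes k y"
    have "n b \<in> F b" if "b \<in> Basis" for b
    proof -
      have "\<bar>2 ^ k * (y \<bullet> b) - of_int (n b)\<bar> \<le> 3" using n that by (simp add: near_cubes_def)
      then have "2 ^ k * (y \<bullet> b) - 3 \<le> of_int (n b)" "of_int (n b) \<le> 2 ^ k * (y \<bullet> b) + 3" by linarith+
      then show ?thesis unfolding F_def atLeastAtMost_iff ceiling_le_iff le_floor_iff by blast
    qed
    then show "n \<in> PiE Basis F" using n by (simp add: near_cubes_def PiE_def Pi_def)
  qed
  have fin: "finite (PiE Basis F)" by (intro finite_PiE) (auto simp: F_def)
  show "finite (near_cubes k y)" by (rule finite_subset[OF sub fin])
  \<comment> \<open>An interval of length 6 contains at most 7 integers.\<close>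
  have "card (F b) \<le> 7" for b
  proof -
    have "\<lfloor>2 ^ k * (y \<bullet> b) + 3\<rfloor> - \<lceil>2 ^ k * (y \<bullet> b) - 3\<rceil> \<le> 6" by linarith
    then show ?thesis unfolding F_def card_atLeastAtMost_int nat_le_iff by linarith
  qed
  then have "card (PiE Basis F) \<le> 7 ^ DIM('a)"
    unfolding card_PiE[OF finite_Basis] using prod_mono[of Basis "\<lambda>b. card (F b)" "\<lambda>_. 7"] by simp
  then show "card (near_cubes k y) \<le> 7 ^ DIM('a)" using card_mono[OF fin sub] by simp
qed

lemma near_cubes_mem:
  fixes x y :: "'a::euclidean_space"
  assumes "x \<in> ball y (2 / 2 ^ k)" "n \<in> extensional Basis" "\<forall>b\<in>Basis. \<bar>2 ^ k * (x \<bullet> b) - of_int (n b)\<bar> \<le> 1"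
  shows "n \<in> near_cubes k y"
proof -
  have "\<bar>2 ^ k * (y \<bullet> b) - of_int (n b)\<bar> \<le> 3" if "b \<in> Basis" for b
  proof -
    have "\<bar>(y - x) \<bullet> b\<bar> \<le> norm (y - x)" using that by (rule Basis_le_norm)
    also have "\<dots> \<le> 2 / 2 ^ k" using assms(1) by (simp add: dist_norm)
    finally have "\<bar>2 ^ k * ((y - x) \<bullet> b)\<bar> \<le> 2" by (simp add: abs_mult field_simps)
    moreover have "2 ^ k * (y \<bullet> b) - of_int (n b) = 2 ^ k * ((y - x) \<bullet> b) + (2 ^ k * (x \<bullet> b) - of_int (n b))"
      by (simp add: algebra_simps)
    ultimately show ?thesis using assms(3) that by fastforce
  qed
  then show ?thesis using assms(2) by (simp add: near_cubes_def)
qed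

text \<open>The pairing bound at s = 1 has a finite right-hand side. Integrability is what allows
  the pairing to be split over the layers.\<close>

lemma integrable_pairing:
  fixes g f :: "'a::euclidean_space \<Rightarrow> complex"
  assumes g [measurable]: "g \<in> borel_measurable borel" and f: "test_fun f" and "0 \<le> lam" "0 \<le> G"
    and tail: "(\<integral>\<^sup>+\<xi>. ennreal ((cmod (g \<xi>))\<^sup>2) * indicator {\<xi>. cmod (g \<xi>) > lam} \<xi> \<partial>lborel) \<le> ennreal (G\<^sup>2)"
  shows "integrable lborel (\<lambda>\<xi>. g \<xi> * inv_fourier f \<xi>)"
proof (rule integrableI_bounded)
  obtain bs :: "'a list" where bs: "distinct bs" "set bs = Basis" using finite_distinct_list[of Basis] by auto
  let ?T = "bessel_op 1 bs f"
  have T: "test_fun ?T" by (rule test_fun_bessel_op[OF f])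
  have "integrable lborel (\<lambda>x. (cmod (?T x))\<^sup>2)"
    using T by (intro integrable_continuous_bounded_support continuous_intros smooth_fun_continuous_on) (auto simp: test_fun_def)
  then have "(\<integral>\<^sup>+x. ennreal ((cmod (?T x))\<^sup>2) \<partial>lborel) = ennreal (\<integral>x. (cmod (?T x))\<^sup>2 \<partial>lborel)"
    by (intro nn_integral_eq_integral) auto
  moreover have "0 \<le> (\<integral>x. (cmod (?T x))\<^sup>2 \<partial>lborel)" by (intro integral_nonneg_AE) auto
  ultimately have V: "(\<integral>\<^sup>+x. ennreal ((cmod (?T x))\<^sup>2) \<partial>lborel) \<le> ennreal ((sqrt (\<integral>x. (cmod (?T x))\<^sup>2 \<partial>lborel))\<^sup>2)" by simp
  have "\<exists>c. (\<integral>\<^sup>+\<xi>. ennreal (cmod (g \<xi>) * cmod (inv_fourier f \<xi>)) \<partial>lborel) \<le> ennreal c"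
    using inv_fourier_pairing_bound[where 'a='a]
  proof (elim exE conjE)
    fix C
    assume C: "\<forall>g f s \<mu> G V bs. g \<in> borel_measurable (borel :: 'a measure) \<longrightarrow> test_fun f \<longrightarrow> 0 < s \<longrightarrow> 0 \<le> \<mu> \<longrightarrow> 0 \<le> G \<longrightarrow> 0 \<le> V \<longrightarrow>
     distinct bs \<longrightarrow> set bs = (Basis :: 'a set) \<longrightarrow>
     (\<integral>\<^sup>+\<xi>. ennreal ((cmod (g \<xi>))\<^sup>2) * indicator {\<xi>. cmod (g \<xi>) > \<mu>} \<xi> \<partial>lborel) \<le> ennreal (G\<^sup>2) \<longrightarrow>
     (\<integral>\<^sup>+x. ennreal ((cmod (bessel_op s bs f x))\<^sup>2) \<partial>lborel) \<le> ennreal (V\<^sup>2) \<longrightarrow>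
     (\<integral>\<^sup>+\<xi>. ennreal (cmod (g \<xi>) * cmod (inv_fourier f \<xi>)) \<partial>lborel) \<le> ennreal (C * (G + \<mu> * sqrt ((1 / s) ^ DIM('a))) * V)"
    show ?thesis
      by (rule exI, rule C[rule_format, OF g f zero_less_one assms(3,4) _ bs tail V]) (auto intro!: integral_nonneg_AE)
  qed
  then obtain c where "(\<integral>\<^sup>+\<xi>. ennreal (cmod (g \<xi>) * cmod (inv_fourier f \<xi>)) \<partial>lborel) \<le> ennreal c" by blast
  then show "(\<integral>\<^sup>+\<xi>. ennreal (norm (g \<xi> * inv_fourier f \<xi>)) \<partial>lborel) < \<infinity>"
    by (simp add: norm_mult le_less_trans)
  have [measurable]: "inv_fourier f \<in> borel_measurable borel"
    by (intro borel_measurable_inv_fourier test_fun_borel f)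
  show "(\<lambda>\<xi>. g \<xi> * inv_fourier f \<xi>) \<in> borel_measurable lborel" by measurable
qed

text \<open>Vanishing on an open neighbourhood of S, and not just on S, keeps the closure of the
  nonvanishing set away from S.\<close>

lemma test_fun_offI:
  assumes "test_fun \<phi>" "open V" "S \<subseteq> V" "\<And>x. x \<in> V \<Longrightarrow> \<phi> x = 0"
  shows "test_fun_off S \<phi>"
proof -
  have "closure {x. \<phi> x \<noteq> 0} \<subseteq> - V"
    using assms by (intro closure_minimal) (auto simp: closed_Compl)
  then show ?thesis
    using assms by (auto simp: test_fun_off_def test_fun_def tsupport_def compact_closure)
qed

text \<open>With E = 2^(-D k (1/2 - 1/p)), the volume 2^(-D k) equals 2^(-2 D k / p) times E^2, and
  E turns the growth 2^(D k / 2) of the low part into 2^(D k / p). This is where the dimension 2 d /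
  p of the capacity arises.\<close>

lemma layer_weight_le:
  fixes G lam w p D :: real and n c m k d :: nat
  assumes "c \<le> n * m" "0 \<le> G" "0 \<le> lam" "D = real d"
    and w: "2 powr (- D * (1 / 2 - 1 / p) * k) * G + lam * 2 powr (D * k / p) \<le> w"
  shows "(G + lam * sqrt ((2 ^ k) ^ d)) * sqrt (real c * (1 / 2 ^ k) ^ d)
     \<le> sqrt (real m) * (w * sqrt (real n * 2 powr (- (2 * D / p) * k)))"
proof -
  define E where "E = 2 powr (- D * (1 / 2 - 1 / p) * k)"
  define a where "a = sqrt (real n * 2 powr (- (2 * D / p) * k))"
  have pw: "(2 ^ k) ^ d = 2 powr (D * k)"
    using assms(4) by (simp add: powr_realpow[symmetric] powr_powr mult.commute powr_power)
  have s1: "sqrt ((2 ^ k) ^ d) = 2 powr (D * k / 2)"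
    unfolding pw by (simp add: powr_half_sqrt[symmetric] powr_powr)
  have s2: "(1 / 2 ^ k) ^ d = 2 powr (- (2 * D / p) * k) * E\<^sup>2"
  proof -
    have "(1 / 2 ^ k) ^ d = 2 powr (- (D * k))" using pw by (simp add: power_one_over powr_minus inverse_eq_divide)
    also have "- (D * k) = - (2 * D / p) * k + (- D * (1 / 2 - 1 / p) * k + - D * (1 / 2 - 1 / p) * k)"
      by (simp add: algebra_simps)
    finally show ?thesis unfolding E_def power2_eq_square by (simp only: powr_add)
  qed
  have "sqrt (real c * (1 / 2 ^ k) ^ d) \<le> sqrt (real (n * m) * (1 / 2 ^ k) ^ d)"
    using assms(1) by (intro real_sqrt_le_mono mult_right_mono) (auto simp del: of_nat_mult)
  also have "real (n * m) * (1 / 2 ^ k) ^ d = real m * ((real n * 2 powr (- (2 * D / p) * k)) * E\<^sup>2)"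
    unfolding s2 by simp
  also have "sqrt \<dots> = sqrt (real m) * (a * E)" by (simp add: real_sqrt_mult a_def E_def)
  finally have "(G + lam * 2 powr (D * k / 2)) * sqrt (real c * (1 / 2 ^ k) ^ d) \<le> (G + lam * 2 powr (D * k / 2)) * (sqrt (real m) * (a * E))"
    using assms by (intro mult_left_mono) auto
  also have "\<dots> = sqrt (real m) * ((E * G + lam * (2 powr (D * k / 2) * E)) * a)" by (simp add: algebra_simps)
  also have "2 powr (D * k / 2) * E = 2 powr (D * k / p)"
    unfolding E_def powr_add[symmetric] by (simp add: algebra_simps)
  also have "sqrt (real m) * ((E * G + lam * 2 powr (D * k / p)) * a) \<le> sqrt (real m) * (w * a)"
    using w by (intro mult_left_mono mult_right_mono) (auto simp: E_def a_def)
  finally show ?thesis unfolding s1 a_def .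
qed

text \<open>\<open>C\<close> and \<open>m\<close> are fixed before \<epsilon>, while the cover,
  \<open>Q\<close> and \<open>N\<close> depend on it, so the bound
  \<open>C * (sqrt (real m) * \<epsilon>)\<close> may be sent to 0.\<close>

lemma pairing_vanishes:
  fixes S :: "'a::euclidean_space set" and g \<psi> :: "'a \<Rightarrow> complex" and p q :: real
  assumes p: "2 < p" and q: "1 \<le> q" and S: "compact S" "sigma_finite_NH (2 * real DIM('a) / p) (dual_exp q / 2) S"
    and g [measurable]: "g \<in> borel_measurable borel" and lor: "lorentz_qnorm_pow p q lborel g < top"
    and supp: "\<And>\<phi>. test_fun_off S \<phi> \<Longrightarrow> (\<integral>\<xi>. g \<xi> * inv_fourier \<phi> \<xi> \<partial>lborel) = 0"
    and \<psi>: "test_fun \<psi>"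
  shows "(\<integral>\<xi>. g \<xi> * inv_fourier \<psi> \<xi> \<partial>lborel) = 0"
proof -
  interpret lorentz_function lborel g p q "real DIM('a)"
    using p q lor by unfold_locales auto
  from thresholds obtain lam w :: "nat \<Rightarrow> real" where lw: "\<forall>k. 0 \<le> lam k \<and> 0 \<le> w k" "summable (\<lambda>k. w k powr q)"
    and ex: "\<forall>k. \<exists>G\<ge>0. (\<integral>\<^sup>+x. ennreal ((cmod (g x))\<^sup>2) * indicator {x \<in> space lborel. cmod (g x) > lam k} x \<partial>lborel) \<le> ennreal (G\<^sup>2) \<and>
        2 powr (- real DIM('a) * (1 / 2 - 1 / p) * k) * G + lam k * 2 powr (real DIM('a) * k / p) \<le> w k"
    by (elim exE conjE)
  from lw have lw: "\<And>k. 0 \<le> lam k" "\<And>k. 0 \<le> w k" "summable (\<lambda>k. w k powr q)" by blast+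
  from choice[OF ex[unfolded Bex_def]] obtain G where G0: "\<forall>k. 0 \<le> G k \<and> (\<integral>\<^sup>+x. ennreal ((cmod (g x))\<^sup>2) * indicator {x \<in> space lborel. cmod (g x) > lam k} x \<partial>lborel) \<le> ennreal ((G k)\<^sup>2) \<and>
        2 powr (- real DIM('a) * (1 / 2 - 1 / p) * k) * G k + lam k * 2 powr (real DIM('a) * k / p) \<le> w k" ..
  have G: "G k \<ge> 0"
    "(\<integral>\<^sup>+x. ennreal ((cmod (g x))\<^sup>2) * indicator {x. cmod (g x) > lam k} x \<partial>lborel) \<le> ennreal ((G k)\<^sup>2)"
    "2 powr (- real DIM('a) * (1 / 2 - 1 / p) * k) * G k + lam k * 2 powr (real DIM('a) * k / p) \<le> w k" for k
    using G0[rule_format, of k] by simp_all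
  obtain C where C: "C \<ge> 0" and C': "\<forall>g k Q G lam. g \<in> borel_measurable borel \<longrightarrow> 0 \<le> G \<longrightarrow> 0 \<le> lam \<longrightarrow>
    (\<forall>l. finite (Q l) \<and> Q l \<subseteq> extensional Basis) \<longrightarrow>
    (\<integral>\<^sup>+\<xi>. ennreal ((cmod (g \<xi>))\<^sup>2) * indicator {\<xi>. cmod (g \<xi>) > lam} \<xi> \<partial>lborel) \<le> ennreal (G\<^sup>2) \<longrightarrow>
    (\<integral>\<^sup>+\<xi>. ennreal (cmod (g \<xi>) * cmod (inv_fourier (\<lambda>x. \<psi> x * layer Q k x) \<xi>)) \<partial>lborel)
      \<le> ennreal (C * (G + lam * sqrt ((2 ^ k) ^ DIM('a))) * sqrt (real (card (Q k)) * (1 / 2 ^ k) ^ DIM('a)))"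
    using layer_pairing_bound[OF \<psi>] by (elim exE conjE)
  define m where "m = (7::nat) ^ DIM('a)"
  have int: "integrable lborel (\<lambda>\<xi>. g \<xi> * inv_fourier f \<xi>)" if "test_fun f" for f
    by (rule integrable_pairing[OF g that lw(1) G(1) G(2)])
  have small: "cmod (\<integral>\<xi>. g \<xi> * inv_fourier \<psi> \<xi> \<partial>lborel) \<le> C * (sqrt (real m) * \<epsilon>)" if \<epsilon>: "\<epsilon> > 0" for \<epsilon>
  proof -
    have \<alpha>: "0 < 2 * real DIM('a) / p" using p by simp
    obtain P :: "(nat \<times> nat) set" and y :: "nat \<times> nat \<Rightarrow> 'a" and \<kappa> :: "nat \<times> nat \<Rightarrow> nat" where
      P: "finite P" "S \<subseteq> (\<Union>x\<in>P. ball (y x) (2 / 2 ^ \<kappa> x))"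
      "\<And>N. (\<Sum>k<N. w k * sqrt (real (card {x\<in>P. \<kappa> x = k}) * 2 powr (- (2 * real DIM('a) / p) * k))) \<le> \<epsilon>"
      by (rule sigma_finite_weighted_cover[OF \<alpha> q S lw(2,3) \<epsilon>], rule that)
    define Q where "Q k = (\<Union>x\<in>{x\<in>P. \<kappa> x = k}. near_cubes k (y x))" for k
    have Q: "\<forall>k. finite (Q k) \<and> Q k \<subseteq> extensional Basis"
      using P(1) near_cubes_card(1) by (auto simp: Q_def near_cubes_def)
    have cardQ: "card (Q k) \<le> card {x\<in>P. \<kappa> x = k} * m" for k
    proof -
      have "card (Q k) \<le> (\<Sum>x\<in>{x\<in>P. \<kappa> x = k}. card (near_cubes k (y x)))"
        unfolding Q_def using P(1) by (intro card_UN_le) auto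
      also have "\<dots> \<le> (\<Sum>x\<in>{x\<in>P. \<kappa> x = k}. m)" unfolding m_def by (intro sum_mono near_cubes_card(2))
      finally show ?thesis by simp
    qed
    obtain N where N: "\<And>x. x \<in> P \<Longrightarrow> \<kappa> x < N"
      using finite_nat_set_iff_bounded[of "\<kappa> ` P"] P(1) by auto
    define rest where "rest x = \<psi> x * (\<Prod>l<N. 1 - lcut l (Q l) x)" for x
    have trest: "test_fun rest" unfolding rest_def[abs_def]
      by (intro test_fun_mult \<psi> smooth_fun_prod smooth_fun_diff smooth_lcut smooth_fun_const)
    have "test_fun_off S rest"
    proof (rule test_fun_offI[OF trest _ P(2)])
      show "open (\<Union>x\<in>P. ball (y x) (2 / 2 ^ \<kappa> x))" by auto
      fix z assume "z \<in> (\<Union>x\<in>P. ball (y x) (2 / 2 ^ \<kappa> x))"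
      then obtain x where x: "x \<in> P" "z \<in> ball (y x) (2 / 2 ^ \<kappa> x)" by blast
      \<comment> \<open>All lattice bumps of scale \<open>\<kappa> x\<close> that see the ball
        belong to \<open>Q\<close>, so one complement vanishes on the ball and with it the whole
        product.\<close>
      have "lcut (\<kappa> x) (Q (\<kappa> x)) z = 1"
      proof (rule lcut_eq_1)
        fix n assume "n \<in> extensional Basis" "\<forall>b\<in>Basis. \<bar>2 ^ \<kappa> x * (z \<bullet> b) - of_int (n b)\<bar> \<le> 1"
        then have "n \<in> near_cubes (\<kappa> x) (y x)" by (rule near_cubes_mem[OF x(2)])
        then show "n \<in> Q (\<kappa> x)" unfolding Q_def using x(1) by (intro UN_I[of x]) auto
      qed (use Q in auto)
      then have "(\<Prod>l<N. 1 - lcut l (Q l) z) = 0" using N[OF x(1)] by (intro prod_zero) auto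
      then show "rest z = 0" by (simp add: rest_def)
    qed
    then have rest0: "(\<integral>\<xi>. g \<xi> * inv_fourier rest \<xi> \<partial>lborel) = 0" by (rule supp)
    define \<Phi> where "\<Phi> k x = \<psi> x * layer Q k x" for k x
    have t\<Phi>: "test_fun (\<Phi> k)" for k unfolding \<Phi>_def[abs_def] by (intro test_fun_mult \<psi> smooth_layer)
    have partial: "test_fun (\<lambda>x. \<Sum>k<n. \<Phi> k x) \<and> inv_fourier (\<lambda>x. \<Sum>k<n. \<Phi> k x) \<xi> = (\<Sum>k<n. inv_fourier (\<Phi> k) \<xi>)" for n \<xi>
    proof (induction n)
      case 0
      show ?case by (auto simp: test_fun_def inv_fourier_def)
    next
      case (Suc n)
      then have t: "test_fun (\<lambda>x. \<Sum>k<n. \<Phi> k x)" by blast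
      show ?case using Suc test_fun_add[OF t t\<Phi>[of n]]
          inv_fourier_add[OF test_fun_integrable[OF t] test_fun_integrable[OF t\<Phi>[of n]], of \<xi>] by simp
    qed
    have "\<psi> = (\<lambda>x. rest x + (\<Sum>k<N. \<Phi> k x))"
    proof
      fix x
      have "(\<Sum>k<N. \<Phi> k x) = \<psi> x * (\<Sum>k<N. layer Q k x)" by (simp add: \<Phi>_def sum_distrib_left)
      then show "\<psi> x = rest x + (\<Sum>k<N. \<Phi> k x)" by (simp add: layer_telescope rest_def algebra_simps)
    qed
    then have "inv_fourier \<psi> \<xi> = inv_fourier (\<lambda>x. rest x + (\<Sum>k<N. \<Phi> k x)) \<xi>" for \<xi> by simp
    also have "\<dots> \<xi> = inv_fourier rest \<xi> + (\<Sum>k<N. inv_fourier (\<Phi> k) \<xi>)" for \<xi>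
      using partial[of N \<xi>] by (subst inv_fourier_add) (auto intro: test_fun_integrable trest)
    finally have dec: "inv_fourier \<psi> \<xi> = inv_fourier rest \<xi> + (\<Sum>k<N. inv_fourier (\<Phi> k) \<xi>)" for \<xi> .
    have "(\<integral>\<xi>. g \<xi> * inv_fourier \<psi> \<xi> \<partial>lborel) = (\<integral>\<xi>. g \<xi> * inv_fourier rest \<xi> + (\<Sum>k<N. g \<xi> * inv_fourier (\<Phi> k) \<xi>) \<partial>lborel)"
      by (simp only: dec distrib_left sum_distrib_left)
    also have "\<dots> = (\<integral>\<xi>. g \<xi> * inv_fourier rest \<xi> \<partial>lborel) + (\<Sum>k<N. \<integral>\<xi>. g \<xi> * inv_fourier (\<Phi> k) \<xi> \<partial>lborel)"
      by (subst Bochner_Integration.integral_add, rule int[OF trest], rule Bochner_Integration.integrable_sum, rule int[OF t\<Phi>])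
         (subst Bochner_Integration.integral_sum, rule int[OF t\<Phi>], rule refl)
    finally have "cmod (\<integral>\<xi>. g \<xi> * inv_fourier \<psi> \<xi> \<partial>lborel) \<le> (\<Sum>k<N. cmod (\<integral>\<xi>. g \<xi> * inv_fourier (\<Phi> k) \<xi> \<partial>lborel))"
      unfolding rest0 by (simp add: norm_sum)
    also have "\<dots> \<le> (\<Sum>k<N. C * (sqrt (real m) * (w k * sqrt (real (card {x\<in>P. \<kappa> x = k}) * 2 powr (- (2 * real DIM('a) / p) * k)))))"
    proof (rule sum_mono)
      fix k
      have "ennreal (cmod (\<integral>\<xi>. g \<xi> * inv_fourier (\<Phi> k) \<xi> \<partial>lborel)) \<le> (\<integral>\<^sup>+\<xi>. ennreal (cmod (g \<xi> * inv_fourier (\<Phi> k) \<xi>)) \<partial>lborel)"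
        by (rule norm_integral_le_nn)
      also have "\<dots> \<le> ennreal (C * (G k + lam k * sqrt ((2 ^ k) ^ DIM('a))) * sqrt (real (card (Q k)) * (1 / 2 ^ k) ^ DIM('a)))"
        unfolding norm_mult \<Phi>_def[abs_def] by (rule C'[rule_format, OF g G(1) lw(1) _ G(2)]) (use Q in auto)
      finally have "cmod (\<integral>\<xi>. g \<xi> * inv_fourier (\<Phi> k) \<xi> \<partial>lborel) \<le> C * (G k + lam k * sqrt ((2 ^ k) ^ DIM('a))) * sqrt (real (card (Q k)) * (1 / 2 ^ k) ^ DIM('a))"
        using C G(1)[of k] lw(1)[of k] by (subst (asm) ennreal_le_iff) (auto intro!: mult_nonneg_nonneg add_nonneg_nonneg)
      also have "\<dots> = C * ((G k + lam k * sqrt ((2 ^ k) ^ DIM('a))) * sqrt (real (card (Q k)) * (1 / 2 ^ k) ^ DIM('a)))"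
        by (rule mult.assoc)
      also have "\<dots> \<le> C * (sqrt (real m) * (w k * sqrt (real (card {x\<in>P. \<kappa> x = k}) * 2 powr (- (2 * real DIM('a) / p) * k))))"
        by (intro mult_left_mono layer_weight_le[OF cardQ G(1) lw(1) refl G(3)] C)
      finally show "cmod (\<integral>\<xi>. g \<xi> * inv_fourier (\<Phi> k) \<xi> \<partial>lborel) \<le> C * (sqrt (real m) * (w k * sqrt (real (card {x\<in>P. \<kappa> x = k}) * 2 powr (- (2 * real DIM('a) / p) * k))))" .
    qed
    also have "\<dots> = C * (sqrt (real m) * (\<Sum>k<N. w k * sqrt (real (card {x\<in>P. \<kappa> x = k}) * 2 powr (- (2 * real DIM('a) / p) * k))))"
      by (simp only: sum_distrib_left)
    also have "\<dots> \<le> C * (sqrt (real m) * \<epsilon>)" using C by (intro mult_left_mono P(3)) auto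
    finally show ?thesis .
  qed
  have "cmod (\<integral>\<xi>. g \<xi> * inv_fourier \<psi> \<xi> \<partial>lborel) \<le> 0 + e" if "e > 0" for e
  proof -
    \<comment> \<open>The summand 1 makes the divisor positive also when C is 0.\<close>
    define c where "c = C * sqrt (real m) + 1"
    have c: "c > 0" using C by (simp add: c_def add_nonneg_pos)
    have "cmod (\<integral>\<xi>. g \<xi> * inv_fourier \<psi> \<xi> \<partial>lborel) \<le> C * (sqrt (real m) * (e / c))" using c that by (intro small) simp
    also have "\<dots> = (C * sqrt (real m) / c) * e" by simp
    also have "\<dots> \<le> 1 * e" using c that by (intro mult_right_mono) (auto simp: c_def)
    finally show ?thesis by simp
  qed
  then have "cmod (\<integral>\<xi>. g \<xi> * inv_fourier \<psi> \<xi> \<partial>lborel) \<le> 0" by (rule field_le_epsilon)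
  then show ?thesis by simp
qed

text \<open>The distribution is represented by its Fourier transform g, so its vanishing reads as g
  = 0 almost everywhere. The proof replaces g, measurable for the completed measure, by a Borel
  function \<open>h\<close> equal to it off a null set, so that the results on \<open>lborel\<close>
  apply.\<close>

theorem theorem1p7:
  fixes S :: "'a::euclidean_space set" and g :: "'a \<Rightarrow> complex" and p q :: real
  assumes "2 < p" and "1 \<le> q"
    and "compact S"
    and "sigma_finite_NH (2 * real DIM('a) / p) (dual_exp q / 2) S"
    and "in_lorentz p q lebesgue g"
    and "ft_distrib_supported_in g S"
  shows "AE \<xi> in lebesgue. g \<xi> = 0"
proof -
  have gm [measurable]: "g \<in> borel_measurable lebesgue" and lor: "lorentz_qnorm_pow p q lebesgue g < top"
    using assms(5) by (auto simp: in_lorentz_def)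
  obtain u where u [measurable]: "u \<in> borel_measurable lborel" "AE x in lborel. Re (g x) = u x"
    using completion_ex_borel_measurable_real[of "\<lambda>x. Re (g x)" lborel] by auto
  obtain v where v [measurable]: "v \<in> borel_measurable lborel" "AE x in lborel. Im (g x) = v x"
    using completion_ex_borel_measurable_real[of "\<lambda>x. Im (g x)" lborel] by auto
  define h where "h x = Complex (u x) (v x)" for x
  have "h = (\<lambda>x. of_real (u x) + \<i> * of_real (v x))" by (auto simp: h_def complex_eq_iff)
  then have h [measurable]: "h \<in> borel_measurable borel" using u v by simp
  have gh: "AE x in lborel. g x = h x" using u(2) v(2) by eventually_elim (simp add: h_def complex_eq_iff)
  then have gh': "AE x in lebesgue. g x = h x" by (rule AE_completion)
  have hl [measurable]: "h \<in> borel_measurable lebesgue" by (intro measurable_completion) simp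
  have "distrib_fun lebesgue g t = distrib_fun lborel h t" for t
  proof -
    have "emeasure lebesgue {x \<in> space lebesgue. cmod (g x) \<ge> t} = emeasure lebesgue {x \<in> space lebesgue. cmod (h x) \<ge> t}"
    proof (rule emeasure_eq_AE)
      show "AE x in lebesgue. x \<in> {x \<in> space lebesgue. cmod (g x) \<ge> t} \<longleftrightarrow> x \<in> {x \<in> space lebesgue. cmod (h x) \<ge> t}"
        using gh' by eventually_elim simp
    qed measurable
    also have "\<dots> = emeasure lborel {x \<in> space lborel. cmod (h x) \<ge> t}"
      by (subst emeasure_completion) simp_all
    finally show ?thesis by (simp add: distrib_fun_def)
  qed
  then have lor': "lorentz_qnorm_pow p q lborel h < top" using lor by (simp add: lorentz_qnorm_pow_def)
  have supp: "(\<integral>\<xi>. h \<xi> * inv_fourier \<phi> \<xi> \<partial>lborel) = 0" if \<phi>: "test_fun_off S \<phi>" for \<phi>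
  proof -
    have [measurable]: "inv_fourier \<phi> \<in> borel_measurable borel"
      using \<phi> by (intro borel_measurable_inv_fourier smooth_fun_borel) (simp add: test_fun_off_def)
    have [measurable]: "inv_fourier \<phi> \<in> borel_measurable lebesgue" by (intro measurable_completion) simp
    have "(\<integral>\<xi>. h \<xi> * inv_fourier \<phi> \<xi> \<partial>lborel) = (\<integral>\<xi>. h \<xi> * inv_fourier \<phi> \<xi> \<partial>lebesgue)"
      by (rule integral_completion[symmetric]) measurable
    also have "\<dots> = (\<integral>\<xi>. g \<xi> * inv_fourier \<phi> \<xi> \<partial>lebesgue)"
      using gh' by (intro integral_cong_AE) (measurable, auto elim!: AE_mp)
    also have "\<dots> = 0" using assms(6) \<phi> by (simp add: ft_distrib_supported_in_def)
    finally show ?thesis .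
  qed
  have zero: "(\<integral>\<xi>. h \<xi> * inv_fourier \<psi> \<xi> \<partial>lborel) = 0" if "test_fun \<psi>" for \<psi>
    by (rule pairing_vanishes[OF assms(1-4) h lor' supp that])
  interpret lorentz_function lborel h p q "real DIM('a)"
    using assms lor' by unfold_locales auto
  from thresholds obtain lam w :: "nat \<Rightarrow> real" where lam: "\<forall>k. 0 \<le> lam k \<and> 0 \<le> w k"
    and ex: "\<forall>k. \<exists>G\<ge>0. (\<integral>\<^sup>+x. ennreal ((cmod (h x))\<^sup>2) * indicator {x \<in> space lborel. cmod (h x) > lam k} x \<partial>lborel) \<le> ennreal (G\<^sup>2) \<and>
        2 powr (- real DIM('a) * (1 / 2 - 1 / p) * k) * G + lam k * 2 powr (real DIM('a) * k / p) \<le> w k"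
    by (elim exE conjE)
  \<comment> \<open>Any one threshold would do here: the uniqueness lemma asks only for some height
    above which h is square integrable.\<close>
  from ex[rule_format, of 0] obtain G where
    "(\<integral>\<^sup>+x. ennreal ((cmod (h x))\<^sup>2) * indicator {x \<in> space lborel. cmod (h x) > lam 0} x \<partial>lborel) \<le> ennreal (G\<^sup>2)"
    by (elim exE conjE)
  then have "(\<integral>\<^sup>+x. ennreal ((cmod (h x))\<^sup>2) * indicator {x. cmod (h x) > lam 0} x \<partial>lborel) < \<infinity>"
    by (simp add: le_less_trans)
  then have "AE x in lborel. h x = 0"
    by (rule AE_zero_of_inv_fourier_pairings[OF h lam[rule_format, THEN conjunct1] _ zero])
  with gh have "AE x in lborel. g x = 0" by eventually_elim simp
  then show ?thesis by (rule AE_completion)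
qed

end
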